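(* Let $K$ be an infinite field and let $G$ be a closed graph on the vertex set $[n]$, with binomial edge ideal $J_G\subset S=K[x_1,\ldots,x_n,y_1,\ldots,y_n]$. Then $$\ell(J_G)=\mathrm{mcd}(\Delta(J_G))+1 .$$
   Context: All graphs are finite and simple; a graph on $n$ vertices has vertex set $V=[n]=\{1,\ldots,n\}$ and edge set $E$. The binomial edge ideal of $G=(V,E)$ is $J_G=(x_iy_j-x_jy_i \mid \{i,j\}\in E)\subset S=K[x_1,\ldots,x_n,y_1,\ldots,y_n]$. For a homogeneous ideal $I\subset S$ and $\mathfrak m=(x_1,\ldots,x_n,y_1,\ldots,y_n)$, the Rees algebra is $S[It]=\bigoplus_{k\ge 0} I^k t^k$, the special fiber ring is $F(I)=S[It]/\mathfrak m S[It]$, and the analytic spread is $\ell(I)=\dim F(I)$ (Krull dimension). The graph $G$ (with its given labeling of vertices by $[n]$) is closed if $J_G$ has a quadratic Gröbner basis with respect to a diagonal term order, i.e. a monomial order for which the leading term of $x_iy_j-x_jy_i$ is $x_iy_j$ whenever $i<j$. Let $<$ denote the lexicographic order on $S$ with $x_1>x_2>\cdots>x_n>y_1>\cdots>y_n$ and let $\mathrm{in}_<(I)$ denote the initial ideal of $I$. A graded family of ideals in $S$ is a collection $\mathcal I=\{I_i\}_{i\ge 0}$ of ideals with $I_0=S$ and $I_pI_q\subseteq I_{p+q}$ for all $p,q\ge 1$. For $a=(a_1,\ldots,a_{2n})\in\mathbb Z_{\ge 0}^{2n}$ write $X^a=x_1^{a_1}\cdots x_n^{a_n}y_1^{a_{n+1}}\cdots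 y_n^{a_{2n}}$. For a graded family $\mathcal I$ of monomial ideals, its Newton–Okounkov region is $$\Delta(\mathcal I)=\overline{\bigcup_{k\ge 1}\text{convex hull}\left\{\frac{a}{k}\;\Big|\; X^a\in I_k\right\}}\subset\mathbb R^{2n}$$ (closure in the Euclidean topology). Define $\Delta(J_G)=\Delta(\mathcal I)$ for $\mathcal I=\{\mathrm{in}_<(J_G^i)\}_{i\ge 0}$. For a polyhedron $\Delta$, $\mathrm{mcd}(\Delta)$ denotes the maximum dimension of a compact face of $\Delta$, with the usual convention $\mathrm{mcd}(\emptyset)=\dim\emptyset=-1$ (relevant only if $G$ has no edges). *)

theory Defs
  imports
    "HOL-Analysis.Analysis"
    "HOL-Library.Poly_Mapping"
    "HOL-Algebra.Ideal_Product"
    "HOL-Algebra.QuotRing"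
    "HOL-Algebra.Algebraic_Closure_Type"
begin

text \<open>
  A graph on \<open>[n]\<close> is given by its edge set \<open>E :: 'n set set\<close>, where \<open>'n\<close> is a finite linearly
  ordered type: \<open>n\<close> is \<open>CARD('n)\<close>, and the order of \<open>'n\<close> is the labelling of the vertices.
  The variables of \<open>S\<close> are indexed by \<open>'n + 'n\<close>, with \<open>Inl i\<close> for \<open>x\<^sub>i\<close> and \<open>Inr i\<close> for \<open>y\<^sub>i\<close>, and
  \<open>\<real>\<^sup>2\<^sup>n\<close> is \<open>real ^ ('n + 'n)\<close>.
\<close>

type_synonym 'v expo = "'v \<Rightarrow>\<^sub>0 nat"
type_synonym ('v, 'k) mpolynomial = "('v \<Rightarrow>\<^sub>0 nat) \<Rightarrow>\<^sub>0 'k"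

abbreviation ring_of :: "'a::comm_ring_1 itself \<Rightarrow> 'a ring" where
  "ring_of _ \<equiv> ring_of_type_algebra"

definition ideal_gen :: "'a::comm_ring_1 set \<Rightarrow> 'a set" where
  "ideal_gen A = Idl\<^bsub>ring_of TYPE('a)\<^esub> A"

definition ideal_power :: "'a::comm_ring_1 set \<Rightarrow> nat \<Rightarrow> 'a set" where
  "ideal_power I k = I [^]\<^bsub>ideals_set (ring_of TYPE('a))\<^esub> k"

definition monomial :: "'v expo \<Rightarrow> ('v, 'k::zero_neq_one) mpolynomial" where
  "monomial a = Poly_Mapping.single a 1"

definition var :: "'v \<Rightarrow> ('v, 'k::zero_neq_one) mpolynomial" where
  "var v = monomial (Poly_Mapping.single v 1)"


section \<open>Krull dimension, Rees algebra and analytic spread\<close>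

text \<open>The supremum of the lengths \<open>d\<close> of chains \<open>P\<^sub>0 \<subset> \<dots> \<subset> P\<^sub>d\<close> of prime ideals; it is
  \<open>-\<infinity>\<close> for the zero ring.\<close>

definition krull_dim :: "('a, 'b) ring_scheme \<Rightarrow> ereal" where
  "krull_dim R = (SUP d \<in> {d. \<exists>P. (\<forall>i\<le>d. primeideal (P i) R) \<and> (\<forall>i<d. P i \<subset> P (Suc i))}.
     ereal (real d))"

definition rees_algebra :: "'a::comm_ring_1 set \<Rightarrow> 'a poly ring" where
  "rees_algebra I = (ring_of TYPE('a poly))
     \<lparr>carrier := {p. \<forall>k. Polynomial.coeff p k \<in> ideal_power I k}\<rparr>"

definition special_fiber :: "'a::comm_ring_1 set \<Rightarrow> 'a set \<Rightarrow> 'a poly set ring" where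
  "special_fiber \<mm> I = rees_algebra I Quot (Idl\<^bsub>rees_algebra I\<^esub> ((\<lambda>c. [:c:]) ` \<mm>))"

definition irrelevant_ideal :: "('v, 'k::comm_ring_1) mpolynomial set" where
  "irrelevant_ideal = ideal_gen (range var)"

definition analytic_spread :: "('v, 'k::comm_ring_1) mpolynomial set \<Rightarrow> ereal" where
  "analytic_spread I = krull_dim (special_fiber irrelevant_ideal I)"


section \<open>Monomial orders, initial ideals and Groebner bases\<close>

definition monomial_order :: "'v expo rel \<Rightarrow> bool" where
  "monomial_order r \<longleftrightarrow> linear_order r \<and> (\<forall>a. (0, a) \<in> r) \<and>
     (\<forall>a b c. (a, b) \<in> r \<longrightarrow> (a + c, b + c) \<in> r)"

definition lead_expo :: "'v expo rel \<Rightarrow> ('v, 'k::zero) mpolynomial \<Rightarrow> 'v expo" where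
  "lead_expo r p = (THE a. a \<in> Poly_Mapping.keys p \<and> (\<forall>b \<in> Poly_Mapping.keys p. (b, a) \<in> r))"

definition initial_ideal ::
  "'v expo rel \<Rightarrow> ('v, 'k::field) mpolynomial set \<Rightarrow> ('v, 'k) mpolynomial set" where
  "initial_ideal r A = ideal_gen {monomial (lead_expo r p) | p. p \<in> A \<and> p \<noteq> 0}"

definition groebner_basis ::
  "'v expo rel \<Rightarrow> ('v, 'k::field) mpolynomial set \<Rightarrow> ('v, 'k) mpolynomial set \<Rightarrow> bool" where
  "groebner_basis r I B \<longleftrightarrow> finite B \<and> B \<subseteq> I \<and> initial_ideal r B = initial_ideal r I"

definition homogeneous_of_degree :: "nat \<Rightarrow> ('v::finite, 'k::zero) mpolynomial \<Rightarrow> bool" where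
  "homogeneous_of_degree d p \<longleftrightarrow>
     (\<forall>a \<in> Poly_Mapping.keys p. (\<Sum>v\<in>UNIV. Poly_Mapping.lookup a v) = d)"

text \<open>\<open>var_gt v w\<close> is \<open>v > w\<close> for \<open>x\<^sub>1 > \<dots> > x\<^sub>n > y\<^sub>1 > \<dots> > y\<^sub>n\<close>: a smaller label gives a larger
  variable.\<close>

fun var_gt :: "'n::linorder + 'n \<Rightarrow> 'n + 'n \<Rightarrow> bool" where
  "var_gt (Inl i) (Inl j) \<longleftrightarrow> i < j"
| "var_gt (Inl i) (Inr j) \<longleftrightarrow> True"
| "var_gt (Inr i) (Inl j) \<longleftrightarrow> False"
| "var_gt (Inr i) (Inr j) \<longleftrightarrow> i < j"

definition lex_order :: "('n::linorder + 'n) expo rel" where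
  "lex_order = {(a, b). a = b \<or>
     (\<exists>v. Poly_Mapping.lookup a v < Poly_Mapping.lookup b v \<and>
          (\<forall>w. var_gt w v \<longrightarrow> Poly_Mapping.lookup a w = Poly_Mapping.lookup b w))}"


section \<open>Binomial edge ideals and closed graphs\<close>

definition simple_graph :: "'n set set \<Rightarrow> bool" where
  "simple_graph E \<longleftrightarrow> (\<forall>e\<in>E. card e = 2)"

definition edge_binomial :: "'n \<Rightarrow> 'n \<Rightarrow> ('n + 'n, 'k::comm_ring_1) mpolynomial" where
  "edge_binomial i j = var (Inl i) * var (Inr j) - var (Inl j) * var (Inr i)"

definition binomial_edge_ideal :: "'n set set \<Rightarrow> ('n + 'n, 'k::comm_ring_1) mpolynomial set" where
  "binomial_edge_ideal E = ideal_gen {edge_binomial i j | i j. {i, j} \<in> E}"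

definition diagonal_order :: "'k::field itself \<Rightarrow> ('n::linorder + 'n) expo rel \<Rightarrow> bool" where
  "diagonal_order _ r \<longleftrightarrow> monomial_order r \<and>
     (\<forall>i j. i < j \<longrightarrow>
        monomial (lead_expo r (edge_binomial i j :: ('n + 'n, 'k) mpolynomial)) =
          (var (Inl i) * var (Inr j) :: ('n + 'n, 'k) mpolynomial))"

definition closed_graph :: "'k::field itself \<Rightarrow> 'n::{finite,linorder} set set \<Rightarrow> bool" where
  "closed_graph k E \<longleftrightarrow> (\<exists>r B. diagonal_order k r \<and>
     groebner_basis r (binomial_edge_ideal E :: ('n + 'n, 'k) mpolynomial set) B \<and>
     (\<forall>g\<in>B. homogeneous_of_degree 2 g))"


section \<open>Newton--Okounkov regions\<close>

definition newton_okounkov ::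
  "(nat \<Rightarrow> ('v::finite, 'k::field) mpolynomial set) \<Rightarrow> (real ^ 'v) set" where
  "newton_okounkov I = closure (\<Union>k\<in>{1..}.
     convex hull {(\<chi> v. real (Poly_Mapping.lookup a v) / real k) | a. monomial a \<in> I k})"

definition initial_newton_okounkov ::
  "('n::{finite,linorder} + 'n, 'k::field) mpolynomial set \<Rightarrow> (real ^ ('n + 'n)) set" where
  "initial_newton_okounkov J = newton_okounkov (\<lambda>k. initial_ideal lex_order (ideal_power J k))"

text \<open>The empty set is a compact face of every set and has dimension \<open>-1\<close>, so the maximum is over
  a nonempty set and \<open>mcd {} = -1\<close>.\<close>

definition mcd :: "'a::euclidean_space set \<Rightarrow> int" where
  "mcd \<Delta> = Max {aff_dim F | F. F face_of \<Delta> \<and> compact F}"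

end

theory Submission
  imports Defs
begin

text \<open>
  Let \<open>D\<close> be the set of edges \<open>(i, j)\<close> with \<open>i < j\<close>, and write \<open>f\<^sub>i\<^sub>j = x\<^sub>i y\<^sub>j - x\<^sub>j y\<^sub>i\<close>. Both sides of the
  theorem are computed to be the number \<open>rank D\<close>, which is the dimension of the span of the
  exponent vectors of the monomials \<open>x\<^sub>i y\<^sub>j\<close>, \<open>(i, j) \<in> D\<close>.

  Closedness enters through its combinatorial form (\<open>closed_edges_if_closed_graph\<close>): two larger
  neighbours of a vertex are adjacent, and so are two smaller ones. From this comes the
  straightening law (\<open>straightening\<close>): two products \<open>m f\<^sub>e\<^sub>1 \<dots> f\<^sub>e\<^sub>k\<close> of a monomial and \<open>k\<close> edge
  binomials that have the same leading exponent differ by a linear combination of such products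
  with smaller leading exponent. So \<open>J\<^sup>k\<close> has a basis of products with pairwise distinct leading
  exponents, which has two consequences. First, \<open>in(J\<^sup>k)\<close> is generated by the products of \<open>k\<close>
  monomials \<open>x\<^sub>i y\<^sub>j\<close> (\<open>initial_ideal_power\<close>). Second, the Hilbert function of the algebra
  \<open>K[f\<^sub>e | e \<in> D]\<close> counts sums of exponent vectors of edges (\<open>fiber_upto_span_finite\<close>).

  For the right-hand side, the first consequence says that the Newton--Okounkov region is the
  polyhedron \<open>conv V + orthant\<close>, where \<open>V\<close> is the set of exponent vectors of the \<open>x\<^sub>i y\<^sub>j\<close>. All of
  \<open>V\<close> lies on the hyperplane where the coordinates sum to 2, so \<open>conv V\<close> is a compact face, and
  every compact face lies in \<open>conv V\<close> (\<open>mcd_newton_polyhedron\<close>). Hence \<open>mcd\<close> is one less than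
  the dimension of the span of \<open>V\<close>.

  For the left-hand side, \<open>J\<close> is generated by forms of the single degree 2, so the special fiber ring
  is \<open>K[f\<^sub>e | e \<in> D]\<close> (\<open>special_fiber_iso\<close>), and its Krull dimension is bounded from both sides by
  elementary means. A chain of primes of length \<open>rank D + 1\<close> would supply \<open>rank D + 1\<close> elements, one
  for each step; by the second consequence they satisfy a polynomial relation over \<open>K\<close>, and
  following the lexicographically smallest monomial of this relation along the chain puts a unit into
  the last prime (\<open>chain_length_le_rank\<close>). In the other direction, the polynomials in the algebra that
  vanish when a set \<open>W\<close> of variables is set to zero form a prime ideal; letting \<open>W\<close> grow through the
  variables in a suitable order gives \<open>rank D\<close> strict inclusions (\<open>chain_of_length_rank\<close>).
\<close>


type_synonym ('n, 'k) xypoly = "('n + 'n, 'k) mpolynomial"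

abbreviation lookup where "lookup \<equiv> Poly_Mapping.lookup"
abbreviation keys where "keys \<equiv> Poly_Mapping.keys"
abbreviation single where "single \<equiv> Poly_Mapping.single"

section \<open>Polynomials as a vector space\<close>

text \<open>
  Scalar multiplication, so that the library of vector spaces applies to polynomials.
\<close>

definition cmul :: "'k::field \<Rightarrow> ('v, 'k) mpolynomial \<Rightarrow> ('v, 'k) mpolynomial" where
  "cmul c p = single 0 c * p"

lemma lookup_cmul [simp]: "lookup (cmul c p) a = c * lookup p a"
  unfolding cmul_def mult_map_scale_conv_mult[symmetric]
  by (simp add: Poly_Mapping.map.rep_eq when_def)

lemma cmul_mult_left: "cmul c p * q = cmul c (p * q)"
  and cmul_mult_right: "p * cmul c q = cmul c (p * q)"
  by (simp_all add: cmul_def mult_ac)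

interpretation kvs: vector_space "cmul :: 'k::field \<Rightarrow> ('v, 'k) mpolynomial \<Rightarrow> ('v, 'k) mpolynomial"
  by unfold_locales (auto intro!: poly_mapping_eqI simp: lookup_add algebra_simps)

lemma poly_sum_monomials:
  "p = (\<Sum>b\<in>keys p. cmul (lookup p b) (monomial b))"
proof (rule poly_mapping_eqI)
  fix a
  show "lookup p a = lookup (\<Sum>b\<in>keys p. cmul (lookup p b) (monomial b)) a"
    by (cases "a \<in> keys p")
      (auto simp: lookup_sum monomial_def lookup_single when_def if_distrib sum.delta' in_keys_iff
        cong: if_cong)
qed

lemma span_monomials: "kvs.span (range monomial) = UNIV"
proof -
  have "p \<in> kvs.span (range monomial)" for p :: "('v, 'k::field) mpolynomial"
    by (subst poly_sum_monomials)
      (intro kvs.span_sum kvs.span_scale kvs.span_base rangeI)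
  thus ?thesis by blast
qed

lemma monomial_add: "monomial (a + b) = monomial a * (monomial b :: ('v, 'k::comm_ring_1) mpolynomial)"
  by (simp add: monomial_def mult_single)

lemma monomial_0 [simp]: "monomial 0 = (1 :: ('v, 'k::comm_ring_1) mpolynomial)"
  by (simp add: monomial_def)

lemma keys_monomial [simp]: "keys (monomial a :: ('v, 'k::zero_neq_one) mpolynomial) = {a}"
  by (simp add: monomial_def)

lemma lookup_mult_sum:
  fixes p q :: "('v, 'k::field) mpolynomial"
  shows "lookup (p * q) a = (\<Sum>b\<in>keys p. \<Sum>c\<in>keys q. if b + c = a then lookup p b * lookup q c else 0)"
proof -
  have "p * q = (\<Sum>b\<in>keys p. \<Sum>c\<in>keys q. cmul (lookup p b) (monomial b) * cmul (lookup q c) (monomial c))"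
    using poly_sum_monomials[of p] poly_sum_monomials[of q]
    by (metis (no_types) sum_product)
  also have "\<dots> = (\<Sum>b\<in>keys p. \<Sum>c\<in>keys q. cmul (lookup p b * lookup q c) (monomial (b + c)))"
    by (simp add: cmul_mult_left cmul_mult_right monomial_add mult_ac)
  finally show ?thesis
    by (simp add: lookup_sum monomial_def lookup_single when_def if_distrib cong: if_cong)
qed

lemma lookup_monomial_mult [simp]:
  "lookup (monomial m * p) (m + a) = lookup (p :: ('v, 'k::field) mpolynomial) a"
  by (auto simp: lookup_mult_sum monomial_def in_keys_iff if_distrib sum.delta cong: if_cong)

lemma keys_monomial_mult:
  "keys (monomial m * p) = (\<lambda>a. m + a) ` keys (p :: ('v, 'k::field) mpolynomial)"
proof
  show "keys (monomial m * p) \<subseteq> (\<lambda>a. m + a) ` keys p"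
    using keys_mult[of "monomial m" p] by auto
  show "(\<lambda>a. m + a) ` keys p \<subseteq> keys (monomial m * p)"
    by (auto simp: in_keys_iff)
qed

lemma keys_cmul_subset: "keys (cmul c p) \<subseteq> keys p"
  by (auto simp: in_keys_iff)

lemma keys_span_subset:
  fixes p :: "('v, 'k::field) mpolynomial"
  assumes "p \<in> kvs.span G"
  shows "keys p \<subseteq> (\<Union>g\<in>G. keys g)"
proof -
  have "kvs.subspace {p :: ('v, 'k::field) mpolynomial. keys p \<subseteq> (\<Union>g\<in>G. keys g)}"
    by (rule kvs.subspaceI) (use keys_add keys_cmul_subset in \<open>fastforce+\<close>)
  thus ?thesis
    using kvs.span_induct[OF assms, of "\<lambda>p. keys p \<subseteq> (\<Union>g\<in>G. keys g)"] by blast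
qed

text \<open>
  Ideals, their powers and the fiber algebra are all handled as linear spans of explicit products;
  multiplicative closure of each of them reduces to closure of the generating products.
\<close>

lemma span_mult:
  assumes "p \<in> kvs.span A" "q \<in> kvs.span B"
  shows "p * q \<in> kvs.span {a * b | a b. a \<in> A \<and> b \<in> B}" (is "_ \<in> kvs.span ?C")
proof -
  have *: "a * q \<in> kvs.span ?C" if "a \<in> A" for a
    using assms(2)
  proof (induct rule: kvs.span_induct)
    case (step b)
    then show ?case using that by (auto intro: kvs.span_base)
  next
    case base
    show ?case
      by (rule kvs.subspaceI)
        (auto simp: distrib_left cmul_mult_right intro: kvs.span_add kvs.span_scale kvs.span_zero)
  qed
  show ?thesis
    using assms(1)
  proof (induct rule: kvs.span_induct)
    case (step a)
    then show ?case using * by blast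
  next
    case base
    show ?case
      by (rule kvs.subspaceI)
        (auto simp: distrib_right cmul_mult_left intro: kvs.span_add kvs.span_scale kvs.span_zero)
  qed
qed

section \<open>Ideals and their powers as spans\<close>

lemma ring_of_simps [simp]:
  "carrier (ring_of TYPE('a::comm_ring_1)) = UNIV"
  "x \<otimes>\<^bsub>ring_of TYPE('a)\<^esub> y = x * y"
  "x \<oplus>\<^bsub>ring_of TYPE('a)\<^esub> y = x + y"
  "\<one>\<^bsub>ring_of TYPE('a)\<^esub> = 1"
  "\<zero>\<^bsub>ring_of TYPE('a)\<^esub> = 0"
  by (simp_all add: ring_of_type_algebra_def)

lemma ideal_ring_ofI:
  fixes I :: "'a::comm_ring_1 set"
  assumes "0 \<in> I" "\<And>x y. x \<in> I \<Longrightarrow> y \<in> I \<Longrightarrow> x + y \<in> I" "\<And>x y. x \<in> I \<Longrightarrow> y * x \<in> I"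
  shows "ideal I (ring_of TYPE('a))"
proof (rule idealI)
  show "ring (ring_of TYPE('a))" by (rule ring_from_type_algebra)
  have "- x \<in> I" if "x \<in> I" for x
    using assms(3)[OF that, of "-1"] by simp
  moreover have "inv\<^bsub>add_monoid (ring_of TYPE('a))\<^esub> x = - x" for x
  proof -
    interpret R: ring "ring_of TYPE('a)" by (rule ring_from_type_algebra)
    have "\<ominus>\<^bsub>ring_of TYPE('a)\<^esub> x = - x"
      by (rule R.minus_equality) auto
    thus ?thesis by (simp add: a_inv_def)
  qed
  ultimately show "subgroup I (add_monoid (ring_of TYPE('a)))"
    using assms by (auto simp: subgroup_def)
qed (use assms in \<open>auto simp: mult.commute\<close>)

lemma ideal_ring_ofD:
  fixes I :: "'a::comm_ring_1 set"
  assumes "ideal I (ring_of TYPE('a))"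
  shows "0 \<in> I" "x \<in> I \<Longrightarrow> y \<in> I \<Longrightarrow> x + y \<in> I" "x \<in> I \<Longrightarrow> y * x \<in> I"
proof -
  have sub: "additive_subgroup I (ring_of TYPE('a))"
    using assms by (rule ideal.axioms)
  show "0 \<in> I" using additive_subgroup.zero_closed[OF sub] by (simp only: ring_of_simps)
  show "x \<in> I \<Longrightarrow> y \<in> I \<Longrightarrow> x + y \<in> I"
    using additive_subgroup.a_closed[OF sub, of x y] by (simp only: ring_of_simps)
  show "x \<in> I \<Longrightarrow> y * x \<in> I"
    using ideal.I_l_closed[OF assms, of x y] by (simp only: ring_of_simps) simp
qed

lemma ideal_gen_eq_span:
  fixes A :: "('v, 'k::field) mpolynomial set"
  shows "ideal_gen A = kvs.span {monomial m * a | m a. a \<in> A}" (is "_ = kvs.span ?G")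
proof
  interpret R: ring "ring_of TYPE(('v, 'k) mpolynomial)" by (rule ring_from_type_algebra)
  have "y * x \<in> kvs.span ?G" if "x \<in> kvs.span ?G" for x y
  proof -
    have "y * x \<in> kvs.span {a * b | a b. a \<in> range monomial \<and> b \<in> ?G}"
      using that by (intro span_mult) (auto simp: span_monomials)
    also have "{a * b | a b. a \<in> range monomial \<and> b \<in> ?G} \<subseteq> ?G"
    proof safe
      fix n m a assume "a \<in> A"
      thus "\<exists>m' a'. monomial n * (monomial m * a) = monomial m' * a' \<and> a' \<in> A"
        by (intro exI[of _ "n + m"] exI[of _ a]) (simp add: monomial_add mult_ac)
    qed
    hence "kvs.span {a * b | a b. a \<in> range monomial \<and> b \<in> ?G} \<subseteq> kvs.span ?G"
      by (rule kvs.span_mono)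
    finally show ?thesis .
  qed
  hence "ideal (kvs.span ?G) (ring_of TYPE(('v, 'k) mpolynomial))"
    by (intro ideal_ring_ofI) (auto intro: kvs.span_add kvs.span_zero)
  moreover have "a \<in> kvs.span ?G" if "a \<in> A" for a
    using that by (intro kvs.span_base) (use monomial_0 in \<open>metis (mono_tags, lifting) mem_Collect_eq mult_1\<close>)
  ultimately show "ideal_gen A \<subseteq> kvs.span ?G"
    unfolding ideal_gen_def by (intro R.genideal_minimal) auto
  have id: "ideal (ideal_gen A) (ring_of TYPE(('v, 'k) mpolynomial))"
    unfolding ideal_gen_def by (intro R.genideal_ideal) auto
  have "A \<subseteq> ideal_gen A"
    unfolding ideal_gen_def by (intro R.genideal_self) auto
  thus "kvs.span ?G \<subseteq> ideal_gen A"
    by (intro kvs.span_minimal kvs.subspaceI)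
      (auto simp: cmul_def intro: ideal_ring_ofD[OF id])
qed

lemma ideal_power_0: "ideal_power I 0 = (UNIV :: 'a::comm_ring_1 set)"
  by (simp add: ideal_power_def ideals_set_def)

lemma ideal_power_Suc:
  "ideal_power I (Suc k) = ideal_prod (ring_of TYPE('a::comm_ring_1)) (ideal_power I k) I"
  by (simp add: ideal_power_def ideals_set_def)

lemma ideal_power_eq_span:
  fixes f :: "'e \<Rightarrow> ('v, 'k::field) mpolynomial"
  shows "ideal_power (ideal_gen (f ` D)) k =
     kvs.span {monomial m * (\<Prod>e\<in>#M. f e) | m M. set_mset M \<subseteq> D \<and> size M = k}"
    (is "_ = kvs.span (?G k)")
proof (induct k)
  case 0
  have "?G 0 = range monomial" by auto
  thus ?case by (simp add: ideal_power_0 span_monomials)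
next
  case (Suc k)
  define I where "I = ideal_gen (f ` D)"
  have I: "I = kvs.span {monomial m * a | m a. a \<in> f ` D}" 
    by (simp add: I_def ideal_gen_eq_span)
  have pw: "ideal_power I k = kvs.span (?G k)"
    using Suc by (simp add: I_def)
  let ?P = "ideal_prod (ring_of TYPE(('v, 'k) mpolynomial)) (ideal_power I k) I"
  have "?P \<subseteq> kvs.span (?G (Suc k))"
  proof
    fix x assume "x \<in> ?P"
    thus "x \<in> kvs.span (?G (Suc k))"
    proof (induct rule: ideal_prod.induct)
      case (prod i j)
      hence "i \<in> kvs.span (?G k)" "j \<in> kvs.span {monomial m * a | m a. a \<in> f ` D}"
        using I pw by auto
      hence "i * j \<in> kvs.span {a * b | a b. a \<in> ?G k \<and> b \<in> {monomial m * a | m a. a \<in> f ` D}}"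
        by (rule span_mult)
      also have "{a * b | a b. a \<in> ?G k \<and> b \<in> {monomial m * a | m a. a \<in> f ` D}} \<subseteq> ?G (Suc k)"
      proof safe
        fix m M m' d assume *: "d \<in> D" "set_mset M \<subseteq> D" "k = size M"
        have "monomial m * (\<Prod>e\<in>#M. f e) * (monomial m' * f d) = 
            monomial (m + m') * (\<Prod>e\<in>#add_mset d M. f e)"
          by (simp add: monomial_add mult_ac)
        thus "\<exists>m'' M'. monomial m * (\<Prod>e\<in>#M. f e) * (monomial m' * f d) = 
            monomial m'' * (\<Prod>e\<in>#M'. f e) \<and> set_mset M' \<subseteq> D \<and> size M' = Suc (size M)"
          using * by (intro exI[of _ "m+m'"] exI[of _ "add_mset d M"]) auto
      qed
      hence "kvs.span {a * b | a b. a \<in> ?G k \<and> b \<in> {monomial m * a | m a. a \<in> f ` D}} \<subseteq> kvs.span (?G (Suc k))"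
        by (rule kvs.span_mono)
      finally show ?case by simp
    qed (auto intro: kvs.span_add)
  qed
  moreover have "kvs.span (?G (Suc k)) \<subseteq> ?P"
  proof (rule kvs.span_minimal)
    show "?G (Suc k) \<subseteq> ?P"
    proof safe
      fix m M assume *: "set_mset M \<subseteq> D" "size M = Suc k"
      then obtain d M' where M: "M = add_mset d M'" by (metis size_eq_Suc_imp_eq_union)
      have "monomial m * (\<Prod>e\<in>#M'. f e) \<in> ideal_power I k"
        unfolding pw using * M by (intro kvs.span_base) auto
      moreover have "f d \<in> I"
        unfolding I using * M by (intro kvs.span_base) (auto intro!: exI[of _ 0] exI[of _ "f d"])
      ultimately have "monomial m * (\<Prod>e\<in>#M'. f e) * f d \<in> ?P"
        using ideal_prod.prod[of "monomial m * (\<Prod>e\<in>#M'. f e)" "ideal_power I k" "f d" I "ring_of TYPE(('v, 'k) mpolynomial)"] by simp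
      thus "monomial m * (\<Prod>e\<in>#M. f e) \<in> ?P" by (simp add: M mult_ac)
    qed
    show "kvs.subspace ?P"
    proof (rule kvs.subspaceI)
      have "0 \<in> ideal_power I k" "0 \<in> I"
        unfolding pw by (auto simp: I kvs.span_zero)
      from ideal_prod.prod[OF this, of "ring_of TYPE(('v, 'k) mpolynomial)"]
      show "0 \<in> ?P" by simp
      show "x + y \<in> ?P" if "x \<in> ?P" "y \<in> ?P" for x y
        using ideal_prod.sum[OF that] by simp
      show "cmul c x \<in> ?P" if "x \<in> ?P" for c x
        using that
      proof (induct rule: ideal_prod.induct)
        case (prod i j)
        hence "cmul c i \<in> ideal_power I k" by (simp add: pw kvs.span_scale)
        from ideal_prod.prod[OF this prod(2), of "ring_of TYPE(('v, 'k) mpolynomial)"] show ?case 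
          by (simp add: cmul_mult_left)
      next
        case (sum s1 s2)
        then show ?case using ideal_prod.sum[OF sum(2,4)] by (simp add: kvs.scale_right_distrib)
      qed
    qed
  qed
  ultimately show ?case by (simp add: ideal_power_Suc flip: I_def)
qed

section \<open>Monomial orders\<close>

lemma monomial_orderD:
  assumes "monomial_order r"
  shows "(a, a) \<in> r" "(a, b) \<in> r \<Longrightarrow> (b, a) \<in> r \<Longrightarrow> a = b"
    "(a, b) \<in> r \<Longrightarrow> (b, c) \<in> r \<Longrightarrow> (a, c) \<in> r" "(a, b) \<in> r \<or> (b, a) \<in> r"
    "(a, b) \<in> r \<Longrightarrow> (a + c, b + c) \<in> r" "(a, b) \<in> r \<Longrightarrow> (c + a, c + b) \<in> r" "(0, a) \<in> r"
proof -
  have lin: "linear_order r" using assms by (simp add: monomial_order_def)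
  show "(a, a) \<in> r"
    using lin by (auto simp: order_on_defs refl_on_def)
  show "(a, b) \<in> r \<Longrightarrow> (b, a) \<in> r \<Longrightarrow> a = b"
    using lin by (auto simp: order_on_defs antisym_def)
  show "(a, b) \<in> r \<Longrightarrow> (b, c) \<in> r \<Longrightarrow> (a, c) \<in> r"
    using lin by (auto simp: order_on_defs dest: transD)
  show "(a, b) \<in> r \<or> (b, a) \<in> r"
    using lin \<open>(a, a) \<in> r\<close> by (cases "a = b") (auto simp: order_on_defs total_on_def)
  show add: "(a, b) \<in> r \<Longrightarrow> (a + c, b + c) \<in> r" and "(0, a) \<in> r"
    using assms by (auto simp: monomial_order_def)
  show "(a, b) \<in> r \<Longrightarrow> (c + a, c + b) \<in> r"
    using add by (simp add: add.commute)
qed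

lemma monomial_order_ex_max:
  assumes "monomial_order r" "finite A" "A \<noteq> {}"
  shows "\<exists>a\<in>A. \<forall>b\<in>A. (b, a) \<in> r"
  using assms(2,3)
proof (induct A rule: finite_ne_induct)
  case (singleton x)
  then show ?case using monomial_orderD(1)[OF assms(1)] by simp
next
  case (insert x F)
  then obtain a where a: "a \<in> F" "\<forall>b\<in>F. (b, a) \<in> r" by blast
  show ?case
  proof (cases "(x, a) \<in> r")
    case True
    thus ?thesis using a by auto
  next
    case False
    hence "(a, x) \<in> r" using monomial_orderD(4)[OF assms(1)] by blast
    hence "\<forall>b\<in>insert x F. (b, x) \<in> r"
      using a monomial_orderD(1,3)[OF assms(1)] by blast
    thus ?thesis by blast
  qed
qed

lemma lead_expo_eqI:
  assumes "monomial_order r" "a \<in> keys p" "\<And>b. b \<in> keys p \<Longrightarrow> (b, a) \<in> r"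
  shows "lead_expo r p = a"
  unfolding lead_expo_def using assms monomial_orderD(2)[OF assms(1)] by (intro the_equality) blast+

lemma lead_expo:
  assumes "monomial_order r" "p \<noteq> 0"
  shows "lead_expo r p \<in> keys p" "b \<in> keys p \<Longrightarrow> (b, lead_expo r p) \<in> r"
proof -
  have "keys p \<noteq> {}"
    using assms(2) by (metis lookup_not_eq_zero_eq_in_keys lookup_zero poly_mapping_eqI empty_iff)
  then obtain a where a: "a \<in> keys p" "\<And>b. b \<in> keys p \<Longrightarrow> (b, a) \<in> r"
    using monomial_order_ex_max[OF assms(1), of "keys p"] by auto
  from lead_expo_eqI[OF assms(1) this] a
  show "lead_expo r p \<in> keys p" "b \<in> keys p \<Longrightarrow> (b, lead_expo r p) \<in> r" by auto
qed

lemma lead_expo_monomial_mult: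
  fixes p :: "('v, 'k::field) mpolynomial"
  assumes r: "monomial_order r" and p: "p \<noteq> 0"
  shows "lead_expo r (monomial m * p) = m + lead_expo r p"
  by (rule lead_expo_eqI[OF r])
    (auto simp: keys_monomial_mult lead_expo[OF r p] intro: monomial_orderD(6)[OF r])

text \<open>
  The set \<open>U\<close> is a face of the monoid of exponents: an exponent in \<open>U\<close> only splits into exponents in
  \<open>U\<close>. Hence the largest exponents of \<open>p\<close> and \<open>q\<close> inside \<open>U\<close> cannot be cancelled in \<open>p * q\<close>. With
  \<open>U = UNIV\<close> this says that leading terms multiply; with \<open>U\<close> the exponents avoiding a set of variables
  it gives the primality of \<open>vanishing D W\<close>.
\<close>

lemma lookup_mult_max_on_face:
  fixes p q :: "('v, 'k::field) mpolynomial"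
  assumes r: "monomial_order r" and U: "\<And>b c. b + c \<in> U \<longleftrightarrow> b \<in> U \<and> c \<in> U"
    and a: "a \<in> keys p \<inter> U" "\<And>c. c \<in> keys p \<inter> U \<Longrightarrow> (c, a) \<in> r"
    and b: "b \<in> keys q \<inter> U" "\<And>c. c \<in> keys q \<inter> U \<Longrightarrow> (c, b) \<in> r"
  shows "lookup (p * q) (a + b) = lookup p a * lookup q b"
proof -
  have uniq: "a' = a \<and> b' = b" if "a' \<in> keys p" "b' \<in> keys q" "a' + b' = a + b" for a' b'
  proof -
    have "a' + b' \<in> U" using that(3) U[of a b] a(1) b(1) by simp
    hence "a' \<in> U" "b' \<in> U" using U[of a' b'] by simp_all
    hence "(a', a) \<in> r" "(b', b) \<in> r" using a(2) b(2) that by blast+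
    note 1 = monomial_orderD(5)[OF r this(1), of b'] and 2 = monomial_orderD(6)[OF r this(2), of a]
    have "a' + b' = a + b'"
      by (rule monomial_orderD(2)[OF r 1]) (use 2 that(3) in simp)
    thus ?thesis using that(3) by simp
  qed
  have "lookup (p * q) (a + b) = (\<Sum>a'\<in>keys p. \<Sum>b'\<in>keys q. 
      if a' = a then if b' = b then lookup p a * lookup q b else 0 else 0)"
    unfolding lookup_mult_sum
  proof (intro sum.cong refl)
    fix a' b' assume "a' \<in> keys p" "b' \<in> keys q"
    hence "a' + b' = a + b \<longleftrightarrow> a' = a \<and> b' = b" using uniq by blast
    thus "(if a' + b' = a + b then lookup p a' * lookup q b' else 0) = 
      (if a' = a then if b' = b then lookup p a * lookup q b else 0 else 0)" by simp
  qed
  also have "\<dots> = (\<Sum>a'\<in>keys p. if a' = a then \<Sum>b'\<in>keys q. if b' = b then lookup p a * lookup q b else 0 else 0)"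
    by (intro sum.cong) auto
  finally show ?thesis using a(1) b(1) by simp
qed

lemma var_gt_irrefl: "\<not> var_gt v v"
  by (cases v) auto

lemma var_gt_trans: "var_gt u v \<Longrightarrow> var_gt v w \<Longrightarrow> var_gt u w"
  by (cases u; cases v; cases w) auto

lemma var_gt_total: "v \<noteq> w \<Longrightarrow> var_gt v w \<or> var_gt w v"
  by (cases v; cases w) auto

text \<open>
  Among the variables where two exponents differ there is a largest one: it is found as a variable
  with the fewest variables above it.
\<close>

lemma first_difference:
  fixes a b :: "('n::{finite,linorder} + 'n) expo"
  assumes "a \<noteq> b"
  shows "\<exists>v. lookup a v \<noteq> lookup b v \<and> (\<forall>w. var_gt w v \<longrightarrow> lookup a w = lookup b w)"
proof -
  define P where "P v \<longleftrightarrow> lookup a v \<noteq> lookup b v" for v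
  define h where "h v = card {u :: 'n + 'n. var_gt u v}" for v
  obtain u where "P u"
    using assms poly_mapping_eqI[of a b] unfolding P_def by blast
  from ex_has_least_nat[of P, OF this, of h]
  obtain v where v: "P v" "\<forall>w. P w \<longrightarrow> h v \<le> h w" by blast
  have "\<not> P w" if "var_gt w v" for w
  proof -
    have "{u. var_gt u w} \<subset> {u. var_gt u v}"
    proof
      show "{u. var_gt u w} \<subseteq> {u. var_gt u v}"
        using var_gt_trans[OF _ that] by (intro Collect_mono impI)
      show "{u. var_gt u w} \<noteq> {u. var_gt u v}"
        using that var_gt_irrefl[of w] by (metis mem_Collect_eq)
    qed
    hence "h w < h v"
      unfolding h_def by (rule psubset_card_mono[rotated]) (rule finite)
    thus ?thesis using v(2) by (metis leD)
  qed
  thus ?thesis using v(1) unfolding P_def by blast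
qed

lemma monomial_order_lex: "monomial_order (lex_order :: ('n::{finite,linorder} + 'n) expo rel)"
proof -
  let ?r = "lex_order :: ('n + 'n) expo rel"
  have lexD: "\<exists>v. lookup a v < lookup b v \<and> (\<forall>w. var_gt w v \<longrightarrow> lookup a w = lookup b w)"
    if "(a, b) \<in> ?r" "a \<noteq> b" for a b
    using that unfolding lex_order_def by blast
  have tr: "(a, c) \<in> ?r" if ab: "(a, b) \<in> ?r" and bc: "(b, c) \<in> ?r" for a b c
  proof (cases "a = b \<or> b = c")
    case False
    then obtain v v' where v: "lookup a v < lookup b v" "\<And>w. var_gt w v \<Longrightarrow> lookup a w = lookup b w"
      "lookup b v' < lookup c v'" "\<And>w. var_gt w v' \<Longrightarrow> lookup b w = lookup c w"
      using lexD[OF ab] lexD[OF bc] by blast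
    consider "v = v'" | "var_gt v v'" | "var_gt v' v" using var_gt_total by blast
    hence "\<exists>u. lookup a u < lookup c u \<and> (\<forall>w. var_gt w u \<longrightarrow> lookup a w = lookup c w)"
    proof cases
      case 1
      thus ?thesis using v by (intro exI[of _ v]) simp
    next
      case 2
      hence "lookup b w = lookup c w" if "var_gt w v \<or> w = v" for w
        using that v(4) var_gt_trans by blast
      thus ?thesis using v(1,2) by (intro exI[of _ v]) simp
    next
      case 3
      hence "lookup a w = lookup b w" if "var_gt w v' \<or> w = v'" for w
        using that v(2) var_gt_trans by blast
      thus ?thesis using v(3,4) by (intro exI[of _ v']) simp
    qed
    thus ?thesis by (simp add: lex_order_def)
  qed (use that in auto)
  have an: "a = b" if ab: "(a, b) \<in> ?r" and ba: "(b, a) \<in> ?r" for a b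
  proof (rule ccontr)
    assume "a \<noteq> b"
    then obtain v v' where v: "lookup a v < lookup b v" "\<And>w. var_gt w v \<Longrightarrow> lookup a w = lookup b w"
      "lookup b v' < lookup a v'" "\<And>w. var_gt w v' \<Longrightarrow> lookup b w = lookup a w"
      using lexD[OF ab] lexD[OF ba] by metis
    have "v \<noteq> v'" using v(1,3) by auto
    hence "var_gt v v' \<or> var_gt v' v" by (rule var_gt_total)
    thus False using v(1,3) v(2)[of v'] v(4)[of v] by auto
  qed
  have tot: "(a, b) \<in> ?r \<or> (b, a) \<in> ?r" for a b
  proof (cases "a = b")
    case False
    then obtain v where "lookup a v \<noteq> lookup b v" "\<And>w. var_gt w v \<Longrightarrow> lookup a w = lookup b w"
      using first_difference[OF False] by metis
    hence "(lookup a v < lookup b v \<or> lookup b v < lookup a v) \<and>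
        (\<forall>w. var_gt w v \<longrightarrow> lookup a w = lookup b w) \<and> (\<forall>w. var_gt w v \<longrightarrow> lookup b w = lookup a w)"
      by auto
    thus ?thesis unfolding lex_order_def by blast
  qed (simp add: lex_order_def)
  have zero: "(0, a) \<in> ?r" for a
  proof (cases "0 = a")
    case False
    then obtain v where "lookup 0 v \<noteq> lookup a v" "\<And>w. var_gt w v \<Longrightarrow> lookup 0 w = lookup a w"
      using first_difference[OF False] by metis
    hence "lookup 0 v < lookup a v \<and> (\<forall>w. var_gt w v \<longrightarrow> lookup 0 w = lookup a w)" by simp
    thus ?thesis unfolding lex_order_def by blast
  qed (simp add: lex_order_def)
  have add: "(a + c, b + c) \<in> ?r" if "(a, b) \<in> ?r" for a b c
  proof (cases "a = b")
    case False
    from lexD[OF that this] have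
      "\<exists>v. lookup (a + c) v < lookup (b + c) v \<and> (\<forall>w. var_gt w v \<longrightarrow> lookup (a + c) w = lookup (b + c) w)"
      by (simp add: lookup_add)
    thus ?thesis by (simp add: lex_order_def)
  qed (simp add: lex_order_def)
  have rfl: "(a, a) \<in> ?r" for a by (simp add: lex_order_def)
  have "refl ?r" by (rule reflI) (rule rfl)
  moreover have "trans ?r" by (rule transI) (rule tr)
  moreover have "antisym ?r" by (rule antisymI) (rule an)
  moreover have "total ?r" by (rule total_onI) (rule tot)
  ultimately have "linear_order ?r"
    unfolding linear_order_on_def partial_order_on_def preorder_on_def
    by (intro conjI) (assumption | (unfold UNIV_Times_UNIV, rule subset_UNIV))+
  moreover have "\<forall>a. (0, a) \<in> ?r"
    by (rule allI) (rule zero)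
  moreover have "\<forall>a b c. (a, b) \<in> ?r \<longrightarrow> (a + c, b + c) \<in> ?r"
    by (intro allI impI) (rule add)
  ultimately show ?thesis
    unfolding monomial_order_def by (intro conjI)
qed

lemmas lexD = monomial_orderD[OF monomial_order_lex]

lemma monomial_in_initial_ideal_iff:
  fixes A :: "('v, 'k::field) mpolynomial set"
  shows "monomial a \<in> initial_ideal r A \<longleftrightarrow> (\<exists>p\<in>A. p \<noteq> 0 \<and> (\<exists>m. a = m + lead_expo r p))"
proof
  assume "monomial a \<in> initial_ideal r A"
  from keys_span_subset[OF this[unfolded initial_ideal_def ideal_gen_eq_span]]
  show "\<exists>p\<in>A. p \<noteq> 0 \<and> (\<exists>m. a = m + lead_expo r p)"
    by (auto simp flip: monomial_add)
next
  assume "\<exists>p\<in>A. p \<noteq> 0 \<and> (\<exists>m. a = m + lead_expo r p)"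
  then obtain p m where "p \<in> A" "p \<noteq> 0" "a = m + lead_expo r p" by blast
  thus "monomial a \<in> initial_ideal r A"
    unfolding initial_ideal_def ideal_gen_eq_span
    by (intro kvs.span_base) (auto simp: monomial_add)
qed

section \<open>The binomial edge ideal and closedness\<close>

definition expo_deg :: "'v::finite expo \<Rightarrow> nat" where
  "expo_deg a = (\<Sum>v\<in>UNIV. lookup a v)"

lemma expo_deg_add [simp]: "expo_deg (a + b) = expo_deg a + expo_deg b"
  by (simp add: expo_deg_def lookup_add sum.distrib)

lemma expo_deg_single [simp]: "expo_deg (single v n) = n"
  by (simp add: expo_deg_def lookup_single when_def)

lemma expo_deg_zero [simp]: "expo_deg 0 = 0"
  by (simp add: expo_deg_def)

lemma expo_deg_eq_0_iff [simp]: "expo_deg a = 0 \<longleftrightarrow> a = 0"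
proof
  assume "expo_deg a = 0"
  hence "lookup a v = lookup 0 v" for v by (simp add: expo_deg_def)
  thus "a = 0" by (rule poly_mapping_eqI)
qed simp

definition xe :: "'n \<Rightarrow> ('n + 'n) expo" where "xe i = single (Inl i) 1"
definition ye :: "'n \<Rightarrow> ('n + 'n) expo" where "ye i = single (Inr i) 1"

lemma lookup_xe [simp]: "lookup (xe i) v = (if v = Inl i then 1 else 0)"
  and lookup_ye [simp]: "lookup (ye i) v = (if v = Inr i then 1 else 0)"
  by (auto simp: xe_def ye_def lookup_single when_def)

lemma expo_deg_xe [simp]: "expo_deg (xe i) = 1"
  and expo_deg_ye [simp]: "expo_deg (ye i) = 1"
  by (simp_all add: xe_def ye_def)

lemma var_Inl: "var (Inl i) = monomial (xe i)"
  and var_Inr: "var (Inr i) = monomial (ye i)"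
  by (simp_all add: var_def xe_def ye_def)

lemma edge_binomial_eq:
  "edge_binomial i j = monomial (xe i + ye j) - monomial (xe j + ye i)"
  by (simp add: edge_binomial_def var_Inl var_Inr monomial_add)

lemma xe_ye_eq_iff: "xe i + ye j = xe i' + ye j' \<longleftrightarrow> i = i' \<and> j = j'"
proof
  assume "xe i + ye j = xe i' + ye j'"
  hence "lookup (xe i + ye j) v = lookup (xe i' + ye j') v" for v
    by (rule arg_cong[where f = "\<lambda>a. lookup a v"])
  have "i = i'"
    using \<open>\<And>v. lookup (xe i + ye j) v = lookup (xe i' + ye j') v\<close>[of "Inl i"]
    by (simp add: lookup_add split: if_splits)
  moreover have "j = j'"
    using \<open>\<And>v. lookup (xe i + ye j) v = lookup (xe i' + ye j') v\<close>[of "Inr j"]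
    by (simp add: lookup_add split: if_splits)
  ultimately show "i = i' \<and> j = j'" ..
next
  assume "i = i' \<and> j = j'"
  thus "xe i + ye j = xe i' + ye j'" by (elim conjE) (rule arg_cong2[where f = "\<lambda>i j. xe i + ye j"])
qed

lemma lookup_monomial: "lookup (monomial m) a = (if a = m then 1 else 0)"
  by (cases "m = a") (simp_all add: monomial_def lookup_single when_def)

lemma keys_edge_binomial:
  assumes "i \<noteq> j"
  shows "keys (edge_binomial i j :: ('n, 'k::field) xypoly) = {xe i + ye j, xe j + ye i}"
proof (rule Set.set_eqI)
  fix a
  have "xe i + ye j \<noteq> xe j + ye i" using assms by (simp only: xe_ye_eq_iff) blast
  moreover have "lookup (edge_binomial i j :: ('n, 'k) xypoly) a = 
      (if a = xe i + ye j then 1 else 0) - (if a = xe j + ye i then 1 else 0)"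
    unfolding edge_binomial_eq lookup_minus lookup_monomial ..
  ultimately show "a \<in> keys (edge_binomial i j :: ('n, 'k) xypoly) \<longleftrightarrow>
      a \<in> {xe i + ye j, xe j + ye i}"
    by (cases "a = xe i + ye j"; cases "a = xe j + ye i") (simp_all add: in_keys_iff)
qed

lemma edge_binomial_nonzero:
  "i \<noteq> j \<Longrightarrow> edge_binomial i j \<noteq> (0 :: ('n, 'k::field) xypoly)"
  using keys_edge_binomial[of i j, where 'k = 'k] by (metis insert_not_empty keys_zero)

lemma lookup_edge_binomial:
  "lookup (edge_binomial i j :: ('n, 'k::field) xypoly) (xe a + ye b) = 
    (if a = i \<and> b = j then 1 else 0) - (if a = j \<and> b = i then 1 else 0)"
  unfolding edge_binomial_eq lookup_minus lookup_monomial xe_ye_eq_iff ..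

definition oriented_edges :: "'n::linorder set set \<Rightarrow> ('n \<times> 'n) set" where
  "oriented_edges E = {(i, j). i < j \<and> {i, j} \<in> E}"

definition ebin :: "'n \<times> 'n \<Rightarrow> ('n, 'k::comm_ring_1) xypoly" where
  "ebin e = edge_binomial (fst e) (snd e)"

definition vexp :: "'n \<times> 'n \<Rightarrow> ('n + 'n) expo" where
  "vexp e = xe (fst e) + ye (snd e)"

lemma expo_deg_vexp [simp]: "expo_deg (vexp e) = 2"
  by (simp add: vexp_def)

lemma ideal_gen_minimal:
  fixes A B :: "'a::comm_ring_1 set"
  assumes "A \<subseteq> ideal_gen B" shows "ideal_gen A \<subseteq> ideal_gen B"
proof -
  interpret R: ring "ring_of TYPE('a)" by (rule ring_from_type_algebra)
  show ?thesis using assms unfolding ideal_gen_def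
    by (intro R.genideal_minimal R.genideal_ideal) auto
qed

lemma ideal_gen_ideal: "ideal (ideal_gen A) (ring_of TYPE('a::comm_ring_1))"
proof -
  interpret R: ring "ring_of TYPE('a)" by (rule ring_from_type_algebra)
  show ?thesis unfolding ideal_gen_def by (intro R.genideal_ideal) auto
qed

lemma ideal_gen_self: "A \<subseteq> ideal_gen (A :: 'a::comm_ring_1 set)"
proof -
  interpret R: ring "ring_of TYPE('a)" by (rule ring_from_type_algebra)
  show ?thesis unfolding ideal_gen_def by (intro R.genideal_self) auto
qed

lemma binomial_edge_ideal_eq:
  fixes E :: "'n::linorder set set"
  assumes "simple_graph E"
  shows "(binomial_edge_ideal E :: ('n, 'k::comm_ring_1) xypoly set) = 
    ideal_gen (ebin ` oriented_edges E)"
proof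
  let ?B = "ideal_gen (ebin ` oriented_edges E) :: ('n, 'k) xypoly set"
  have "edge_binomial i j \<in> ?B" if "{i, j} \<in> E" for i j
  proof -
    have "i \<noteq> j" using that assms by (force simp: simple_graph_def)
    hence "i < j \<or> j < i" by auto
    thus ?thesis
    proof
      assume "i < j"
      hence "ebin (i, j) \<in> ?B" using that
        by (intro subsetD[OF ideal_gen_self]) (auto simp: oriented_edges_def)
      thus ?thesis by (simp add: ebin_def)
    next
      assume "j < i"
      hence "ebin (j, i) \<in> ?B" using that
        by (intro subsetD[OF ideal_gen_self]) (auto simp: oriented_edges_def insert_commute)
      from ideal_ring_ofD(3)[OF ideal_gen_ideal this, of "-1"] show ?thesis
        by (simp add: ebin_def edge_binomial_def algebra_simps)
    qed
  qed
  thus "binomial_edge_ideal E \<subseteq> ?B"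
    unfolding binomial_edge_ideal_def by (intro ideal_gen_minimal) auto
  have "ebin e \<in> {edge_binomial i j | i j. {i, j} \<in> E}" if "e \<in> oriented_edges E" for e
  proof -
    have "{fst e, snd e} \<in> E" using that by (auto simp: oriented_edges_def)
    thus ?thesis unfolding ebin_def by blast
  qed
  thus "?B \<subseteq> binomial_edge_ideal E"
    unfolding binomial_edge_ideal_def
    by (intro ideal_gen_minimal) (use ideal_gen_self in blast)
qed

text \<open>
  A product \<open>m f\<^sub>i\<^sub>j\<close> contributes to degree 2 only for \<open>m = 1\<close>, so the degree 2 part of an element of \<open>J\<close>
  is a linear combination of the \<open>f\<^sub>i\<^sub>j\<close> themselves.
\<close>

lemma degree_2_part:
  fixes p :: "('n::{finite,linorder}, 'k::field) xypoly"
  assumes "p \<in> ideal_gen (ebin ` oriented_edges E)"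
  shows "a \<in> keys p \<Longrightarrow> expo_deg a = 2 \<Longrightarrow> \<exists>(i, j)\<in>oriented_edges E. a = xe i + ye j \<or> a = xe j + ye i"
    and "lookup p (xe i + ye j) = - lookup p (xe j + ye i)"
proof -
  let ?G = "{monomial m * a | m a. a \<in> ebin ` oriented_edges E} :: ('n, 'k) xypoly set"
  have p: "p \<in> kvs.span ?G" using assms by (simp add: ideal_gen_eq_span)
  have keysG: "\<exists>m i j. (i, j) \<in> oriented_edges E \<and> i < j \<and> g = monomial m * edge_binomial i j \<and>
        keys g = {m + (xe i + ye j), m + (xe j + ye i)}"
    if "g \<in> ?G" for g
  proof -
    from that obtain m i j where *: "(i, j) \<in> oriented_edges E" "i < j" "g = monomial m * edge_binomial i j"
      by (auto simp: ebin_def oriented_edges_def)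
    thus ?thesis by (intro exI[of _ m] exI[of _ i] exI[of _ j]) (simp add: keys_monomial_mult keys_edge_binomial)
  qed
  {
    assume "a \<in> keys p" "expo_deg a = 2"
    then obtain g where "g \<in> ?G" "a \<in> keys g" using keys_span_subset[OF p] by blast
    then obtain m i j where ij: "(i, j) \<in> oriented_edges E" "a \<in> {m + (xe i + ye j), m + (xe j + ye i)}"
      using keysG by blast
    hence "expo_deg m = 0" using \<open>expo_deg a = 2\<close> by auto
    thus "\<exists>(i, j)\<in>oriented_edges E. a = xe i + ye j \<or> a = xe j + ye i" using ij by auto
  }
  show "lookup p (xe i + ye j) = - lookup p (xe j + ye i)"
  proof (rule kvs.span_induct[OF p, of "\<lambda>p. lookup p (xe i + ye j) = - lookup p (xe j + ye i)"])
    show "kvs.subspace {p :: ('n, 'k) xypoly. lookup p (xe i + ye j) = - lookup p (xe j + ye i)}"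
      by (rule kvs.subspaceI) (auto simp: lookup_add)
    fix g assume "g \<in> ?G"
    from keysG[OF this] obtain m i' j' where g: "g = monomial m * edge_binomial i' j'" 
        "keys g = {m + (xe i' + ye j'), m + (xe j' + ye i')}" by blast
    show "lookup g (xe i + ye j) = - lookup g (xe j + ye i)"
    proof (cases "m = 0")
      case True
      show ?thesis
        unfolding g(1) True monomial_0 mult_1 lookup_edge_binomial
        by (simp only: minus_diff_eq conj_commute)
    next
      case False
      hence "expo_deg m \<noteq> 0" by simp
      have "expo_deg a \<noteq> 2" if "a \<in> keys g" for a
        using that \<open>expo_deg m \<noteq> 0\<close> unfolding g(2) by auto
      hence "xe i + ye j \<notin> keys g" "xe j + ye i \<notin> keys g" by (metis expo_deg_add expo_deg_xe expo_deg_ye one_add_one)+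
      thus ?thesis by (simp add: in_keys_iff)
    qed
  qed
qed

lemma diagonal_order_lead:
  assumes "diagonal_order TYPE('k::field) r" "i < j"
  shows "lead_expo r (edge_binomial i j :: ('n::linorder, 'k) xypoly) = xe i + ye j"
proof -
  have "monomial (lead_expo r (edge_binomial i j :: ('n, 'k) xypoly)) =
        (monomial (xe i + ye j) :: ('n, 'k) xypoly)"
    using assms by (auto simp: diagonal_order_def var_Inl var_Inr monomial_add)
  thus ?thesis by (metis keys_monomial the_elem_eq)
qed

text \<open>
  The elements of a quadratic Groebner basis lie in the span of the \<open>f\<^sub>i\<^sub>j\<close>, and by the antisymmetry of
  their coefficients the leading monomial cannot be some \<open>x\<^sub>j y\<^sub>i\<close> with \<open>i < j\<close>. So the leading monomials
  of the basis are among the \<open>x\<^sub>i y\<^sub>j\<close> with \<open>(i, j)\<close> an edge, even if the basis does not consist of binomials.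
\<close>

lemma closed_graph_lead:
  fixes E :: "'n::{finite,linorder} set set"
  assumes "simple_graph E" "closed_graph TYPE('k::field) E"
  obtains r where "diagonal_order TYPE('k) r"
    "\<And>p :: ('n, 'k) xypoly. p \<in> ideal_gen (ebin ` oriented_edges E) \<Longrightarrow> p \<noteq> 0 \<Longrightarrow>
      \<exists>e\<in>oriented_edges E. \<exists>m. lead_expo r p = m + vexp e"
proof -
  let ?J = "ideal_gen (ebin ` oriented_edges E) :: ('n, 'k) xypoly set"
  obtain r B where d: "diagonal_order TYPE('k) r" and "groebner_basis r ?J B"
     and hom: "\<forall>g\<in>B. homogeneous_of_degree 2 g"
    using assms(2) unfolding closed_graph_def binomial_edge_ideal_eq[OF assms(1)] by blast
  hence B: "B \<subseteq> ?J" "initial_ideal r B = initial_ideal r ?J" by (auto simp: groebner_basis_def)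
  have r: "monomial_order r" using d by (simp add: diagonal_order_def)
  have "\<exists>e\<in>oriented_edges E. \<exists>m. lead_expo r p = m + vexp e" if p: "p \<in> ?J" "p \<noteq> 0" for p
  proof -
    have "monomial (lead_expo r p) \<in> initial_ideal r ?J"
      unfolding monomial_in_initial_ideal_iff using p by (metis add_0)
    then obtain b m where b: "b \<in> B" "b \<noteq> 0" "lead_expo r p = m + lead_expo r b"
      unfolding B(2)[symmetric] monomial_in_initial_ideal_iff by blast
    have bJ: "b \<in> ?J" using b B by blast
    have k: "lead_expo r b \<in> keys b" using lead_expo[OF r b(2)] by blast
    hence "expo_deg (lead_expo r b) = 2"
      using hom b(1) by (auto simp: homogeneous_of_degree_def expo_deg_def)
    from degree_2_part(1)[OF bJ k this] obtain i j where
      ij: "(i, j) \<in> oriented_edges E" "lead_expo r b = xe i + ye j \<or> lead_expo r b = xe j + ye i" by blast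
    have "i < j" using ij by (auto simp: oriented_edges_def)
    have "lead_expo r b \<noteq> xe j + ye i"
    proof
      assume l: "lead_expo r b = xe j + ye i"
      hence "lookup b (xe i + ye j) \<noteq> 0" using degree_2_part(2)[OF bJ, of i j] k by (simp add: in_keys_iff)
      hence "(xe i + ye j, xe j + ye i) \<in> r"
        using lead_expo(2)[OF r b(2)] l by (metis in_keys_iff)
      moreover have "(xe j + ye i, xe i + ye j) \<in> r"
      proof -
        have "edge_binomial i j \<noteq> (0 :: ('n, 'k) xypoly)"
          using \<open>i < j\<close> by (intro edge_binomial_nonzero) simp
        from lead_expo(2)[OF r this, of "xe j + ye i"] show ?thesis
          using \<open>i < j\<close> by (simp add: keys_edge_binomial diagonal_order_lead[OF d])
      qed
      ultimately have "xe j + ye i = xe i + ye j" using monomial_orderD(2)[OF r] by metis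
      hence "j = i" unfolding xe_ye_eq_iff by blast
      thus False using \<open>i < j\<close> by simp
    qed
    hence "lead_expo r p = m + vexp (i, j)" using ij(2) b(3) by (simp add: vexp_def)
    thus ?thesis using ij(1) by (intro bexI exI)
  qed
  thus ?thesis using that[OF d] by blast
qed

text \<open>
  The familiar combinatorial description of closed graphs.
\<close>

definition closed_edges :: "('n::linorder \<times> 'n) set \<Rightarrow> bool" where
  "closed_edges D \<longleftrightarrow> (\<forall>(i, j)\<in>D. i < j) \<and>
     (\<forall>i j k. (i, j) \<in> D \<longrightarrow> (i, k) \<in> D \<longrightarrow> j < k \<longrightarrow> (j, k) \<in> D) \<and>
     (\<forall>i j k. (i, k) \<in> D \<longrightarrow> (j, k) \<in> D \<longrightarrow> i < j \<longrightarrow> (i, j) \<in> D)"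

lemma closed_edgesD:
  assumes "closed_edges D"
  shows "(i, j) \<in> D \<Longrightarrow> i < j" "(i, j) \<in> D \<Longrightarrow> (i, k) \<in> D \<Longrightarrow> j < k \<Longrightarrow> (j, k) \<in> D"
    "(i, k) \<in> D \<Longrightarrow> (j, k) \<in> D \<Longrightarrow> i < j \<Longrightarrow> (i, j) \<in> D"
  using assms unfolding closed_edges_def by blast+

text \<open>
  These two identities are the S-polynomials of two edge binomials that share a vertex.
\<close>

lemma ye_mult_edge_binomial:
  "monomial (ye i) * edge_binomial j k = 
    monomial (ye j) * edge_binomial i k - monomial (ye k) * edge_binomial i j"
  by (simp add: edge_binomial_def var_Inl var_Inr algebra_simps)

lemma xe_mult_edge_binomial:
  "monomial (xe k) * edge_binomial i j = 
    monomial (xe j) * edge_binomial i k - monomial (xe i) * edge_binomial j k"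
  by (simp add: edge_binomial_def var_Inl var_Inr algebra_simps)

text \<open>
  If \<open>(i, j)\<close> and \<open>(i, k)\<close> are edges with \<open>j < k\<close>, then \<open>y\<^sub>i f\<^sub>j\<^sub>k \<in> J\<close> has leading monomial \<open>y\<^sub>i x\<^sub>j y\<^sub>k\<close>,
  and the only \<open>x\<^sub>a y\<^sub>b\<close> with \<open>a < b\<close> dividing it is \<open>x\<^sub>j y\<^sub>k\<close>. The other condition follows in the same way
  from \<open>x\<^sub>k f\<^sub>i\<^sub>j\<close>.
\<close>

lemma closed_edges_if_closed_graph:
  fixes E :: "'n::{finite,linorder} set set"
  assumes "simple_graph E" "closed_graph TYPE('k::field) E"
  shows "closed_edges (oriented_edges E)"
proof -
  let ?D = "oriented_edges E"
  let ?J = "ideal_gen (ebin ` ?D) :: ('n, 'k) xypoly set"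
  obtain r where d: "diagonal_order TYPE('k) r" and
    lead: "\<And>p :: ('n, 'k) xypoly. p \<in> ?J \<Longrightarrow> p \<noteq> 0 \<Longrightarrow>
      \<exists>e\<in>?D. \<exists>m. lead_expo r p = m + vexp e"
    using closed_graph_lead[OF assms] by blast
  have r: "monomial_order r" using d by (simp add: diagonal_order_def)
  have diff: "m * edge_binomial i j - m' * edge_binomial i' j' \<in> ?J"
    if "(i, j) \<in> ?D" "(i', j') \<in> ?D" for m m' i j i' j'
  proof -
    have "ebin (i, j) \<in> ?J" "ebin (i', j') \<in> ?J"
      by (rule subsetD[OF ideal_gen_self], rule imageI, rule that)+
    hence "m * edge_binomial i j + (- m') * edge_binomial i' j' \<in> ?J"
      unfolding ebin_def by (intro ideal_ring_ofD[OF ideal_gen_ideal]) simp_all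
    thus ?thesis by simp
  qed
  \<comment> \<open>used for the two S-polynomials: \<open>{i, j}\<close> need not be an edge, but the lead is divisible by that of an edge\<close>
  have key: "\<exists>a b m. (a, b) \<in> ?D \<and> v + (xe i + ye j) = m + (xe a + ye b)"
    if "monomial v * edge_binomial i j \<in> ?J" "i < j" for v i j
  proof -
    have ne: "edge_binomial i j \<noteq> (0 :: ('n, 'k) xypoly)"
      using that(2) by (intro edge_binomial_nonzero) simp
    have l: "lead_expo r (monomial v * edge_binomial i j :: ('n, 'k) xypoly) = v + (xe i + ye j)"
      by (simp only: lead_expo_monomial_mult[OF r ne] diagonal_order_lead[OF d \<open>i < j\<close>])
    have "lead_expo r (edge_binomial i j :: ('n, 'k) xypoly)
        \<in> keys (edge_binomial i j :: ('n, 'k) xypoly)"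
      by (rule lead_expo[OF r ne])
    hence "keys (monomial v * edge_binomial i j :: ('n, 'k) xypoly) \<noteq> {}"
      unfolding keys_monomial_mult by (metis empty_iff image_is_empty)
    hence "monomial v * edge_binomial i j \<noteq> (0 :: ('n, 'k) xypoly)" by (metis keys_zero)
    from lead[OF that(1) this] obtain e m where "e \<in> ?D" "v + (xe i + ye j) = m + vexp e"
      unfolding l by blast
    hence "(fst e, snd e) \<in> ?D \<and> v + (xe i + ye j) = m + (xe (fst e) + ye (snd e))"
      by (simp only: vexp_def prod.collapse)
    thus ?thesis by blast
  qed
  have lt: "i < j" if "(i, j) \<in> ?D" for i j using that by (simp add: oriented_edges_def)
  show ?thesis unfolding closed_edges_def
  proof (intro conjI allI impI)
    show "\<forall>(i, j)\<in>?D. i < j" by (simp add: oriented_edges_def)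
  next
    fix i j k assume *: "(i, j) \<in> ?D" "(i, k) \<in> ?D" "j < k"
    have "monomial (ye i) * edge_binomial j k \<in> ?J"
      by (subst ye_mult_edge_binomial) (rule diff[OF *(2,1)])
    from key[OF this \<open>j < k\<close>] obtain a b m where ab: "(a, b) \<in> ?D"
      and eq: "ye i + (xe j + ye k) = m + (xe a + ye b)" by blast
    have "lookup (ye i + (xe j + ye k)) (Inl a) \<ge> 1" "lookup (ye i + (xe j + ye k)) (Inr b) \<ge> 1"
      unfolding eq by (simp_all add: lookup_add)
    hence "a = j" "b = i \<or> b = k"
      by (auto simp: lookup_add split: if_splits)
    thus "(j, k) \<in> ?D" using ab lt[OF ab] lt[OF *(1)] by auto
  next
    fix i j k assume *: "(i, k) \<in> ?D" "(j, k) \<in> ?D" "i < j"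
    have "monomial (xe k) * edge_binomial i j \<in> ?J"
      by (subst xe_mult_edge_binomial) (rule diff[OF *(1,2)])
    from key[OF this \<open>i < j\<close>] obtain a b m where ab: "(a, b) \<in> ?D"
      and eq: "xe k + (xe i + ye j) = m + (xe a + ye b)" by blast
    have "lookup (xe k + (xe i + ye j)) (Inl a) \<ge> 1" "lookup (xe k + (xe i + ye j)) (Inr b) \<ge> 1"
      unfolding eq by (simp_all add: lookup_add)
    hence "a = k \<or> a = i" "b = j"
      by (auto simp: lookup_add split: if_splits)
    thus "(i, j) \<in> ?D" using ab lt[OF ab] lt[OF *(2)] by auto
  qed
qed

section \<open>Straightening\<close>

definition fprod :: "('n \<times> 'n) multiset \<Rightarrow> ('n, 'k::comm_ring_1) xypoly" where
  "fprod M = (\<Prod>e\<in>#M. ebin e)"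

definition vsum :: "('n \<times> 'n) multiset \<Rightarrow> ('n + 'n) expo" where
  "vsum M = (\<Sum>e\<in>#M. vexp e)"

lemma fprod_simps [simp]: "fprod {#} = 1" "fprod (add_mset e M) = ebin e * fprod M"
  by (simp_all add: fprod_def)

lemma vsum_simps [simp]: "vsum {#} = 0" "vsum (add_mset e M) = vexp e + vsum M"
  by (simp_all add: vsum_def)

lemma fprod_union: "fprod (M + N) = fprod M * fprod N"
  by (simp add: fprod_def)

lemma expo_deg_vsum [simp]: "expo_deg (vsum M) = 2 * size M"
  by (induct M) auto

lemma lookup_vsum_Inl: "lookup (vsum M) (Inl i) > 0 \<longleftrightarrow> (\<exists>j. (i, j) \<in># M)"
  by (induct M) (auto simp: lookup_add vexp_def)

lemma lookup_vsum_Inr: "lookup (vsum M) (Inr j) > 0 \<longleftrightarrow> (\<exists>i. (i, j) \<in># M)"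
  by (induct M) (auto simp: lookup_add vexp_def)

lemma expo_split:
  assumes "lookup m v > 0"
  obtains m0 where "m = m0 + single v (1::nat)"
proof
  show "m = (m - single v 1) + single v 1"
    by (rule poly_mapping_eqI) (use assms in \<open>auto simp: lookup_add lookup_minus lookup_single when_def\<close>)
qed

text \<open>
  The products that span the powers of \<open>J\<close>: the leading exponent of \<open>T m M\<close> is \<open>m + vsum M\<close>.
\<close>

abbreviation T :: "('n + 'n) expo \<Rightarrow> ('n \<times> 'n) multiset \<Rightarrow> ('n, 'k::comm_ring_1) xypoly" where
  "T m M \<equiv> monomial m * fprod M"

text \<open>
  The error terms allowed in the straightening law. Keeping the total degree fixed makes the
  induction on them terminate, and it also keeps the law inside \<open>K[f\<^sub>e | e \<in> D]\<close>, whose products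
  \<open>T 0 M\<close> are recognised by their degree \<open>2 * size M\<close>.
\<close>

definition lower :: "('n::{finite,linorder} \<times> 'n) set \<Rightarrow> nat \<Rightarrow> ('n + 'n) expo \<Rightarrow>
    ('n, 'k::field) xypoly set" where
  "lower D k a = {T m M | m M. set_mset M \<subseteq> D \<and> size M = k \<and> expo_deg (m + vsum M) = expo_deg a \<and>
     (m + vsum M, a) \<in> lex_order \<and> m + vsum M \<noteq> a}"

text \<open>
  Every error term of the moves below arises from the leading monomial by such an exchange.
\<close>

lemma lex_swap: "k < j \<Longrightarrow> (xe j + ye k, xe k + ye j) \<in> lex_order"
proof -
  assume "k < j"
  have "lookup (xe j + ye k) w = lookup (xe k + ye j) w" if "var_gt w (Inl k)" for w
    using that \<open>k < j\<close> by (cases w) (auto simp: lookup_add)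
  moreover have "lookup (xe j + ye k) (Inl k) < lookup (xe k + ye j) (Inl k)"
    using \<open>k < j\<close> by (simp add: lookup_add)
  ultimately show ?thesis unfolding lex_order_def by blast
qed

lemma lowerI:
  assumes "set_mset M \<subseteq> D" "size M = s" "k < j"
    and "m + vsum M = c + (xe j + ye k)" "a = c + (xe k + ye j)"
  shows "T m M \<in> kvs.span (lower D s a)"
proof (rule kvs.span_base)
  have "(m + vsum M, a) \<in> lex_order"
    unfolding assms(4,5) by (rule lexD(6)[OF lex_swap[OF \<open>k < j\<close>]])
  moreover have "expo_deg (m + vsum M) = expo_deg a"
    unfolding assms(4,5) by (simp only: expo_deg_add expo_deg_xe expo_deg_ye)
  moreover have "m + vsum M \<noteq> a"
  proof
    assume "m + vsum M = a"
    hence "xe j + ye k = xe k + ye j" unfolding assms(4,5) by (rule add_left_imp_eq)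
    hence "j = k" unfolding xe_ye_eq_iff by (rule conjunct1)
    thus False using \<open>k < j\<close> by simp
  qed
  ultimately show "T m M \<in> lower D s a"
    unfolding lower_def using assms(1,2) by blast
qed

lemma span_mult_left:
  assumes "p \<in> kvs.span G" "\<And>g. g \<in> G \<Longrightarrow> c * g \<in> kvs.span H"
  shows "c * p \<in> kvs.span H"
proof (rule kvs.span_induct[OF assms(1), of "\<lambda>p. c * p \<in> kvs.span H"])
  show "kvs.subspace {p. c * p \<in> kvs.span H}"
    by (rule kvs.subspaceI)
      (auto simp: distrib_left cmul_mult_right intro: kvs.span_add kvs.span_scale kvs.span_zero)
qed (rule assms(2))

lemma lower_mult_ebin:
  assumes "p \<in> kvs.span (lower D k a)" "e \<in> D"
  shows "ebin e * p \<in> kvs.span (lower D (Suc k) (vexp e + a))"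
  using assms(1)
proof (rule span_mult_left)
  fix g assume "g \<in> lower D k a"
  then obtain m M where *: "g = T m M" "set_mset M \<subseteq> D" "size M = k" "expo_deg (m + vsum M) = expo_deg a"
    "(m + vsum M, a) \<in> lex_order" "m + vsum M \<noteq> a" unfolding lower_def by blast
  have eq: "m + vsum (add_mset e M) = vexp e + (m + vsum M)" by (simp add: add_ac)
  have "ebin e * g = T m (add_mset e M)" by (simp add: * mult_ac)
  moreover have "T m (add_mset e M) \<in> lower D (Suc k) (vexp e + a)"
    unfolding lower_def mem_Collect_eq
  proof (intro exI conjI refl)
    show "expo_deg (m + vsum (add_mset e M)) = expo_deg (vexp e + a)"
      unfolding eq using * by (simp only: expo_deg_add)
    show "(m + vsum (add_mset e M), vexp e + a) \<in> lex_order"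
      unfolding eq by (rule lexD(6)[OF *(5)])
    show "m + vsum (add_mset e M) \<noteq> vexp e + a"
      unfolding eq using *(6) by (metis add_left_imp_eq)
  qed (use * assms(2) in auto)
  ultimately show "ebin e * g \<in> kvs.span (lower D (Suc k) (vexp e + a))"
    by (metis kvs.span_base)
qed

lemma lower_mult_monomial:
  assumes "p \<in> kvs.span (lower D k a)"
  shows "monomial c * p \<in> kvs.span (lower D k (c + a))"
  using assms(1)
proof (rule span_mult_left)
  fix g assume "g \<in> lower D k a"
  then obtain m M where *: "g = T m M" "set_mset M \<subseteq> D" "size M = k" "expo_deg (m + vsum M) = expo_deg a"
    "(m + vsum M, a) \<in> lex_order" "m + vsum M \<noteq> a" unfolding lower_def by blast
  have eq: "(c + m) + vsum M = c + (m + vsum M)" by (simp only: add_ac)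
  have "monomial c * g = T (c + m) M" by (simp add: * mult_ac monomial_add)
  moreover have "T (c + m) M \<in> lower D k (c + a)"
    unfolding lower_def mem_Collect_eq
  proof (intro exI conjI refl)
    show "expo_deg ((c + m) + vsum M) = expo_deg (c + a)"
      unfolding eq using * by (simp only: expo_deg_add)
    show "((c + m) + vsum M, c + a) \<in> lex_order"
      unfolding eq by (rule lexD(6)[OF *(5)])
    show "(c + m) + vsum M \<noteq> c + a"
      unfolding eq using *(6) by (metis add_left_imp_eq)
  qed (use * in auto)
  ultimately show "monomial c * g \<in> kvs.span (lower D k (c + a))"
    by (metis kvs.span_base)
qed

text \<open>
  The four moves exchange one product for another with the same leading exponent. In each case the
  difference is again a combination of products of edge binomials, by a syzygy or by the Pluecker
  relation, and the edges that appear exist because \<open>D\<close> is closed. This first one moves an unused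
  factor \<open>x\<^sub>k\<close> into an edge: \<open>x\<^sub>k f\<^sub>i\<^sub>j - x\<^sub>i f\<^sub>k\<^sub>j = x\<^sub>j f\<^sub>i\<^sub>k\<close>.
\<close>

lemma slide_x:
  assumes D: "closed_edges D" and "(i, j) \<in> D" "(k, j) \<in> D" "i < k" "set_mset M \<subseteq> D"
    and a: "a = m + xe k + vexp (i, j) + vsum M"
  shows "T (m + xe k) (add_mset (i, j) M) - T (m + xe i) (add_mset (k, j) M)
    \<in> kvs.span (lower D (Suc (size M)) a :: ('n::{finite,linorder}, 'k::field) xypoly set)"
proof -
  have "k < j" "(i, k) \<in> D" using closed_edgesD[OF D] assms by blast+
  have "T (m + xe k) (add_mset (i, j) M) - T (m + xe i) (add_mset (k, j) M) =
      (T (m + xe j) (add_mset (i, k) M) :: ('n, 'k) xypoly)"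
    by (simp add: monomial_add ebin_def edge_binomial_def var_Inl var_Inr algebra_simps)
  moreover have "T (m + xe j) (add_mset (i, k) M) \<in> kvs.span (lower D (Suc (size M)) a :: ('n, 'k) xypoly set)"
    by (rule lowerI[where c = "m + xe i + vsum M", OF _ _ \<open>k < j\<close>])
      (use assms \<open>(i, k) \<in> D\<close> in \<open>simp_all add: vexp_def add_ac\<close>)
  ultimately show ?thesis by (simp only:)
qed

lemma slide_y:
  assumes D: "closed_edges D" and "(i, j) \<in> D" "(i, l) \<in> D" "j < l" "set_mset M \<subseteq> D"
    and a: "a = m + ye l + vexp (i, j) + vsum M"
  shows "T (m + ye l) (add_mset (i, j) M) - T (m + ye j) (add_mset (i, l) M)
    \<in> kvs.span (lower D (Suc (size M)) a :: ('n::{finite,linorder}, 'k::field) xypoly set)"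
proof -
  have "i < j" "(j, l) \<in> D" using closed_edgesD[OF D] assms by blast+
  have "T (m + ye l) (add_mset (i, j) M) - T (m + ye j) (add_mset (i, l) M) =
      (- T (m + ye i) (add_mset (j, l) M) :: ('n, 'k) xypoly)"
    by (simp add: monomial_add ebin_def edge_binomial_def var_Inl var_Inr algebra_simps)
  moreover have "T (m + ye i) (add_mset (j, l) M) \<in> kvs.span (lower D (Suc (size M)) a :: ('n, 'k) xypoly set)"
    by (rule lowerI[where c = "m + ye l + vsum M", OF _ _ \<open>i < j\<close>])
      (use assms \<open>(j, l) \<in> D\<close> in \<open>simp_all add: vexp_def add_ac\<close>)
  ultimately show ?thesis by (simp only: kvs.span_neg)
qed

text \<open>
  If the monomial factor is divisible by the leading monomial of an edge, that edge can be exchanged for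
  any edge in the product. This is the Koszul syzygy, whose error terms carry the trailing monomials.
\<close>

lemma koszul_move:
  assumes D: "closed_edges D" and "(i, j) \<in> D" "(p, q) \<in> D" "set_mset M \<subseteq> D"
    and a: "a = m + vexp (i, j) + vexp (p, q) + vsum M"
  shows "T (m + vexp (i, j)) (add_mset (p, q) M) - T (m + vexp (p, q)) (add_mset (i, j) M)
    \<in> kvs.span (lower D (Suc (size M)) a :: ('n::{finite,linorder}, 'k::field) xypoly set)"
proof -
  have "i < j" "p < q" using closed_edgesD[OF D] assms by blast+
  have "T (m + vexp (i, j)) (add_mset (p, q) M) - T (m + vexp (p, q)) (add_mset (i, j) M) =
      (T (m + (xe j + ye i)) (add_mset (p, q) M) - T (m + (xe q + ye p)) (add_mset (i, j) M) :: ('n, 'k) xypoly)"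
    by (simp add: monomial_add ebin_def vexp_def edge_binomial_def var_Inl var_Inr algebra_simps)
  moreover have "T (m + (xe j + ye i)) (add_mset (p, q) M) \<in> kvs.span (lower D (Suc (size M)) a :: ('n, 'k) xypoly set)"
    by (rule lowerI[where c = "m + vexp (p, q) + vsum M", OF _ _ \<open>i < j\<close>])
      (use assms in \<open>simp_all add: vexp_def add_ac\<close>)
  moreover have "T (m + (xe q + ye p)) (add_mset (i, j) M) \<in> kvs.span (lower D (Suc (size M)) a :: ('n, 'k) xypoly set)"
    by (rule lowerI[where c = "m + vexp (i, j) + vsum M", OF _ _ \<open>p < q\<close>])
      (use assms in \<open>simp_all add: vexp_def add_ac\<close>)
  ultimately show ?thesis by (simp only: kvs.span_diff)
qed

text \<open>
  The Pluecker relation \<open>f\<^sub>i\<^sub>l f\<^sub>p\<^sub>j - f\<^sub>i\<^sub>j f\<^sub>p\<^sub>l = - f\<^sub>i\<^sub>p f\<^sub>j\<^sub>l\<close> for \<open>i < p < j < l\<close>.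
\<close>

lemma swap_edges:
  assumes D: "closed_edges D" and "(i, j) \<in> D" "(i, l) \<in> D" "(p, j) \<in> D" "i < p" "j < l"
    and "set_mset M \<subseteq> D" and a: "a = m + vexp (i, l) + vexp (p, j) + vsum M"
  shows "T m (add_mset (i, l) (add_mset (p, j) M)) - T m (add_mset (i, j) (add_mset (p, l) M))
    \<in> kvs.span (lower D (Suc (Suc (size M))) a :: ('n::{finite,linorder}, 'k::field) xypoly set)"
proof -
  have "p < j" "(i, p) \<in> D" "(j, l) \<in> D" using closed_edgesD[OF D] assms by blast+
  have "T m (add_mset (i, l) (add_mset (p, j) M)) - T m (add_mset (i, j) (add_mset (p, l) M)) =
      (- T m (add_mset (i, p) (add_mset (j, l) M)) :: ('n, 'k) xypoly)"
    by (simp add: monomial_add ebin_def edge_binomial_def var_Inl var_Inr algebra_simps)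
  moreover have "T m (add_mset (i, p) (add_mset (j, l) M)) \<in> kvs.span (lower D (Suc (Suc (size M))) a :: ('n, 'k) xypoly set)"
    by (rule lowerI[where c = "m + xe i + ye l + vsum M", OF _ _ \<open>p < j\<close>])
      (use assms \<open>(i, p) \<in> D\<close> \<open>(j, l) \<in> D\<close> in \<open>simp_all add: vexp_def add_ac\<close>)
  ultimately show ?thesis by (simp only: kvs.span_neg)
qed

text \<open>
  At most one move takes the product \<open>T m M\<close>, up to error terms, to a product that shares an edge or a
  variable of the monomial factor with \<open>T m' M'\<close>. The common factor can then be cancelled, which is
  the induction step of the straightening law.
\<close>

definition linked :: "('n::{finite,linorder} \<times> 'n) set \<Rightarrow> 'k::field itself \<Rightarrow> ('n + 'n) expo \<Rightarrow>
    ('n \<times> 'n) multiset \<Rightarrow> ('n + 'n) expo \<Rightarrow> ('n \<times> 'n) multiset \<Rightarrow> bool" where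
  "linked D K m M m' M' \<longleftrightarrow> (\<exists>m1 M1. set_mset M1 \<subseteq> D \<and> size M1 = size M \<and> m1 + vsum M1 = m + vsum M \<and>
     T m M - T m1 M1 \<in> kvs.span (lower D (size M) (m + vsum M) :: ('n, 'k) xypoly set) \<and>
     ((\<exists>e. e \<in># M1 \<and> e \<in># M') \<or> (\<exists>v. lookup m1 v > 0 \<and> lookup m' v > 0)))"

lemma linkedI:
  assumes "set_mset M1 \<subseteq> D" "size M1 = size M" "m1 + vsum M1 = m + vsum M"
    "T m M - T m1 M1 \<in> kvs.span (lower D (size M) (m + vsum M) :: ('n::{finite,linorder}, 'k::field) xypoly set)"
    "(\<exists>e. e \<in># M1 \<and> e \<in># M') \<or> (\<exists>v. lookup m1 v > 0 \<and> lookup m' v > 0)"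
  shows "linked D TYPE('k) m M m' M'"
  unfolding linked_def using assms by blast

lemma linked_refl:
  assumes "set_mset M \<subseteq> D" "(\<exists>e. e \<in># M \<and> e \<in># M') \<or> (\<exists>v. lookup m v > 0 \<and> lookup m' v > 0)"
  shows "linked D TYPE('k::field) m M m' M'"
  by (rule linkedI[OF assms(1) refl refl _ assms(2)]) (simp add: kvs.span_zero)

text \<open>
  Here \<open>x\<^sub>i\<close> is the largest variable that occurs, unused in one product and used by an edge \<open>(i, j)\<close> in the
  other. If \<open>y\<^sub>j\<close> is unused as well, a Koszul move creates the edge \<open>(i, j)\<close>; otherwise \<open>y\<^sub>j\<close> is used
  by an edge \<open>(k, j)\<close>, where \<open>i < k\<close> by the choice of \<open>i\<close>, and \<open>slide_x\<close> turns it into \<open>(i, j)\<close>.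
\<close>

lemma linked_slack:
  fixes M M' :: "('n::{finite,linorder} \<times> 'n) multiset"
  assumes D: "closed_edges D" and MD: "set_mset M \<subseteq> D" "set_mset M' \<subseteq> D" and sz: "size M = size M'"
    and eq: "m + vsum M = m' + vsum M'"
    and min: "\<And>k. lookup (m + vsum M) (Inl k) > 0 \<Longrightarrow> i \<le> k"
    and i: "lookup m (Inl i) > 0" and e: "(i, j) \<in># M'"
  shows "linked D TYPE('k::field) m M m' M'"
proof -
  let ?L = "kvs.span (lower D (size M) (m + vsum M) :: ('n, 'k) xypoly set)"
  have ij: "(i, j) \<in> D" using MD e by blast
  have "lookup (m' + vsum M') (Inr j) > 0" using e lookup_vsum_Inr[of M' j] by (auto simp: lookup_add)
  hence "lookup (m + vsum M) (Inr j) > 0" by (simp only: eq)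
  then consider "lookup m (Inr j) > 0" | k where "(k, j) \<in># M"
    using lookup_vsum_Inr[of M j] by (auto simp: lookup_add)
  thus ?thesis
  proof cases
    case 1
    have "lookup m (Inl i) > 0" by fact
    then obtain m1 where m1: "m = m1 + xe i" unfolding xe_def by (rule expo_split)
    have "lookup m1 (Inr j) > 0" using 1 by (simp add: m1 lookup_add)
    then obtain m0 where "m1 = m0 + ye j" unfolding ye_def by (rule expo_split)
    hence m: "m = m0 + vexp (i, j)" by (simp add: m1 vexp_def add_ac)
    have "size M \<noteq> 0" using sz e by auto
    then obtain p q M0 where M: "M = add_mset (p, q) M0" by (metis multiset_cases size_empty prod.exhaust)
    have "T m M - T (m0 + vexp (p, q)) (add_mset (i, j) M0) \<in> ?L"
      unfolding m M size_add_mset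
      by (rule koszul_move[OF D]) (use MD ij M in \<open>simp_all add: add_ac\<close>)
    thus ?thesis
      by (intro linkedI[where ?m1.0 = "m0 + vexp (p, q)" and ?M1.0 = "add_mset (i, j) M0"])
        (use MD ij M m e in \<open>auto simp add: add_ac\<close>)
  next
    case 2
    show ?thesis
    proof (cases "k = i")
      case True
      thus ?thesis using 2 e by (intro linked_refl[OF MD(1)]) blast
    next
      case False
      have "lookup (m + vsum M) (Inl k) > 0" using 2 lookup_vsum_Inl[of M k] by (auto simp: lookup_add)
      hence "i < k" using min[of k] False by simp
      obtain m0 where m: "m = m0 + xe i" using i unfolding xe_def by (rule expo_split)
      obtain M0 where M: "M = add_mset (k, j) M0" using 2 by (metis multi_member_split)
      have "T (m0 + xe k) (add_mset (i, j) M0) - T m M \<in> ?L"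
        unfolding m M size_add_mset
        by (rule slide_x[OF D]) (use MD ij M \<open>i < k\<close> in \<open>simp_all add: vexp_def add_ac\<close>)
      from kvs.span_neg[OF this]
      have "T m M - T (m0 + xe k) (add_mset (i, j) M0) \<in> ?L"
        by (simp only: minus_diff_eq)
      thus ?thesis
        by (intro linkedI[where ?m1.0 = "m0 + xe k" and ?M1.0 = "add_mset (i, j) M0"])
          (use MD ij M m e in \<open>auto simp add: vexp_def add_ac\<close>)
    qed
  qed
qed

text \<open>
  Now \<open>x\<^sub>i\<close> is used in both products, by \<open>(i, j)\<close> and \<open>(i, l)\<close> with \<open>j < l\<close>. The move is made in the
  product with the longer edge: there \<open>y\<^sub>j\<close> is unused or used by some \<open>(p, j)\<close>, and since \<open>i < p < j < l\<close>
  the exchange to \<open>(i, j)\<close>, \<open>(p, l)\<close> never leaves \<open>D\<close>. In the other product it could.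
\<close>

lemma linked_edge:
  fixes M M' :: "('n::{finite,linorder} \<times> 'n) multiset"
  assumes D: "closed_edges D" and MD: "set_mset M \<subseteq> D" "set_mset M' \<subseteq> D" and sz: "size M = size M'"
    and eq: "m + vsum M = m' + vsum M'"
    and min: "\<And>k. lookup (m + vsum M) (Inl k) > 0 \<Longrightarrow> i \<le> k"
    and e: "(i, j) \<in># M" and e': "(i, l) \<in># M'" and "j < l"
  shows "linked D TYPE('k::field) m' M' m M"
proof -
  let ?L = "kvs.span (lower D (size M') (m' + vsum M') :: ('n, 'k) xypoly set)"
  have ij: "(i, j) \<in> D" "(i, l) \<in> D" using MD e e' by blast+
  have "lookup (m + vsum M) (Inr j) > 0" using e lookup_vsum_Inr[of M j] by (auto simp: lookup_add)
  hence "lookup (m' + vsum M') (Inr j) > 0" by (simp only: eq)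
  then consider "lookup m' (Inr j) > 0" | p where "(p, j) \<in># M'"
    using lookup_vsum_Inr[of M' j] by (auto simp: lookup_add)
  thus ?thesis
  proof cases
    case 1
    then obtain m0 where m: "m' = m0 + ye j" unfolding ye_def by (rule expo_split)
    obtain M0 where M: "M' = add_mset (i, l) M0" using e' by (metis multi_member_split)
    have "T (m0 + ye l) (add_mset (i, j) M0) - T m' M' \<in> ?L"
      unfolding m M size_add_mset
      by (rule slide_y[OF D]) (use MD ij M \<open>j < l\<close> in \<open>simp_all add: vexp_def add_ac\<close>)
    from kvs.span_neg[OF this]
    have "T m' M' - T (m0 + ye l) (add_mset (i, j) M0) \<in> ?L"
      by (simp only: minus_diff_eq)
    thus ?thesis
      by (intro linkedI[where ?m1.0 = "m0 + ye l" and ?M1.0 = "add_mset (i, j) M0"])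
        (use MD ij M m e in \<open>auto simp add: vexp_def add_ac\<close>)
  next
    case 2
    show ?thesis
    proof (cases "p = i")
      case True
      thus ?thesis using 2 e by (intro linked_refl[OF MD(2)]) blast
    next
      case False
      have "lookup (m' + vsum M') (Inl p) > 0" using 2 lookup_vsum_Inl[of M' p] by (auto simp: lookup_add)
      hence "lookup (m + vsum M) (Inl p) > 0" by (simp only: eq)
      hence "i < p" using min[of p] False by simp
      obtain M1 where M1: "M' = add_mset (i, l) M1" using e' by (metis multi_member_split)
      have "(p, j) \<in># M1" using 2 M1 False by auto
      then obtain M0 where M: "M' = add_mset (i, l) (add_mset (p, j) M0)"
        using M1 by (metis multi_member_split)
      have pj: "(p, j) \<in> D" using 2 MD by blast
      have "(i, p) \<in> D" by (rule closed_edgesD(3)[OF D ij(1) pj \<open>i < p\<close>])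
      moreover have "p < l" using closed_edgesD(1)[OF D pj] \<open>j < l\<close> by simp
      ultimately have pl: "(p, l) \<in> D" by (rule closed_edgesD(2)[OF D _ ij(2)])
      have "T m' M' - T m' (add_mset (i, j) (add_mset (p, l) M0)) \<in> ?L"
        unfolding M size_add_mset
        by (rule swap_edges[OF D]) (use MD ij pj M \<open>j < l\<close> \<open>i < p\<close> in \<open>simp_all add: add_ac\<close>)
      thus ?thesis
        by (intro linkedI[where ?m1.0 = "m'" and ?M1.0 = "add_mset (i, j) (add_mset (p, l) M0)"])
          (use MD ij pl M e in \<open>auto simp add: vexp_def add_ac\<close>)
    qed
  qed
qed

lemma linked_or_linked:
  fixes M M' :: "('n::{finite,linorder} \<times> 'n) multiset"
  assumes D: "closed_edges D" and MD: "set_mset M \<subseteq> D" "set_mset M' \<subseteq> D" and sz: "size M = size M'"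
    and eq: "m + vsum M = m' + vsum M'" and ne: "M \<noteq> {#}"
  shows "linked D TYPE('k::field) m M m' M' \<or> linked D TYPE('k) m' M' m M"
proof -
  let ?I = "{i. lookup (m + vsum M) (Inl i) > 0}"
  obtain i0 j0 where "(i0, j0) \<in># M" using ne by (metis multiset_nonemptyE prod.exhaust)
  hence "i0 \<in> ?I" using lookup_vsum_Inl[of M i0] by (auto simp: lookup_add)
  define i where "i = Min ?I"
  have iI: "i \<in> ?I" unfolding i_def by (rule Min_in) (use \<open>i0 \<in> ?I\<close> in \<open>auto intro: finite\<close>)
  have min: "i \<le> k" if "lookup (m + vsum M) (Inl k) > 0" for k
    unfolding i_def using that by (intro Min_le) (auto intro: finite)
  have min': "i \<le> k" if "lookup (m' + vsum M') (Inl k) > 0" for k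
    using min[of k] that by (simp only: eq)
  have iI': "lookup (m' + vsum M') (Inl i) > 0" using iI by (simp add: eq)
  have c: "lookup m (Inl i) > 0 \<or> (\<exists>j. (i, j) \<in># M)" 
    using iI lookup_vsum_Inl[of M i] by (auto simp: lookup_add)
  have c': "lookup m' (Inl i) > 0 \<or> (\<exists>j. (i, j) \<in># M')" 
    using iI' lookup_vsum_Inl[of M' i] by (auto simp: lookup_add)
  show ?thesis
  proof (cases "lookup m (Inl i) > 0")
    case m: True
    show ?thesis
    proof (cases "lookup m' (Inl i) > 0")
      case True
      thus ?thesis using m linked_refl[OF MD(1), of M' m m'] by blast
    next
      case False
      then obtain j where "(i, j) \<in># M'" using c' by metis
      from linked_slack[OF D MD sz eq min m this] show ?thesis ..
    qed
  next
    case False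
    then obtain j where j: "(i, j) \<in># M" using c by metis
    show ?thesis
    proof (cases "lookup m' (Inl i) > 0")
      case True
      from linked_slack[OF D MD(2,1) sz[symmetric] eq[symmetric] min' True j] show ?thesis ..
    next
      case False
      then obtain l where l: "(i, l) \<in># M'" using c' by metis
      consider "j < l" | "j = l" | "l < j" using less_linear[of j l] by blast
      thus ?thesis
      proof cases
        case 1
        from linked_edge[OF D MD sz eq min j l this] show ?thesis ..
      next
        case 2
        thus ?thesis using j l linked_refl[OF MD(1), of M' m m'] by blast
      next
        case 3
        from linked_edge[OF D MD(2,1) sz[symmetric] eq[symmetric] min' l j this] show ?thesis ..
      qed
    qed
  qed
qed

text \<open>
  Induction on the degree: after at most one move the two products have a common factor, and
  multiplying the error terms of the smaller instance by it preserves their order.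
\<close>

theorem straightening:
  assumes D: "closed_edges D" and MD: "set_mset M \<subseteq> D" "set_mset M' \<subseteq> D" and sz: "size M = size M'"
    and eq: "m + vsum M = m' + vsum M'"
  shows "T m M - T m' M' \<in> kvs.span (lower D (size M) (m + vsum M) :: ('n::{finite,linorder}, 'k::field) xypoly set)"
  using MD sz eq
proof (induct "expo_deg (m + vsum M)" arbitrary: m M m' M' rule: less_induct)
  case less
  let ?L = "kvs.span (lower D (size M) (m + vsum M) :: ('n, 'k) xypoly set)"
  have strip: "T m1 M1 - T m2 M2 \<in> ?L"
    if M12: "set_mset M1 \<subseteq> D" "set_mset M2 \<subseteq> D" "size M1 = size M" "size M2 = size M" 
      and eq: "m1 + vsum M1 = m + vsum M" "m2 + vsum M2 = m + vsum M"
      and sh: "(\<exists>e. e \<in># M1 \<and> e \<in># M2) \<or> (\<exists>v. lookup m1 v > 0 \<and> lookup m2 v > 0)"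
    for m1 M1 m2 M2
    using sh
  proof (elim disjE exE conjE)
    fix e assume "e \<in># M1" "e \<in># M2"
    then obtain N1 N2 where N: "M1 = add_mset e N1" "M2 = add_mset e N2" by (metis multi_member_split)
    have eqN: "m + vsum M = vexp e + (m1 + vsum N1)"
      unfolding eq(1)[symmetric] N(1) by (simp add: add_ac)
    moreover have "m + vsum M = vexp e + (m2 + vsum N2)"
      unfolding eq(2)[symmetric] N(2) by (simp add: add_ac)
    ultimately have "vexp e + (m1 + vsum N1) = vexp e + (m2 + vsum N2)" by (rule subst)
    hence eq': "m1 + vsum N1 = m2 + vsum N2" by (rule add_left_imp_eq)
    have szM: "size M = Suc (size N1)" using M12 N by simp
    have "T m1 N1 - T m2 N2 \<in> kvs.span (lower D (size N1) (m1 + vsum N1) :: ('n, 'k) xypoly set)"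
    proof (rule less.hyps)
      show "expo_deg (m1 + vsum N1) < expo_deg (m + vsum M)"
        unfolding eqN by (simp only: expo_deg_add expo_deg_vexp)
    qed (use M12 N eq' in auto)
    from lower_mult_ebin[OF this, of e]
    have "ebin e * (T m1 N1 - T m2 N2) \<in> ?L"
      unfolding szM eqN(1) using M12 N by simp
    thus ?thesis by (simp add: N algebra_simps)
  next
    fix v assume "lookup m1 v > 0" "lookup m2 v > 0"
    obtain n1 where n1: "m1 = n1 + single v 1" using \<open>lookup m1 v > 0\<close> by (rule expo_split)
    obtain n2 where n2: "m2 = n2 + single v 1" using \<open>lookup m2 v > 0\<close> by (rule expo_split)
    have eqN: "m + vsum M = single v 1 + (n1 + vsum M1)"
      unfolding eq(1)[symmetric] n1 by (simp add: add_ac)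
    moreover have "m + vsum M = single v 1 + (n2 + vsum M2)"
      unfolding eq(2)[symmetric] n2 by (simp add: add_ac)
    ultimately have "single v 1 + (n1 + vsum M1) = single v 1 + (n2 + vsum M2)" by (rule subst)
    hence eq': "n1 + vsum M1 = n2 + vsum M2" by (rule add_left_imp_eq)
    have "T n1 M1 - T n2 M2 \<in> kvs.span (lower D (size M1) (n1 + vsum M1) :: ('n, 'k) xypoly set)"
    proof (rule less.hyps)
      show "expo_deg (n1 + vsum M1) < expo_deg (m + vsum M)"
        unfolding eqN by (simp only: expo_deg_add expo_deg_single)
    qed (use M12 eq' in auto)
    from lower_mult_monomial[OF this, of "single v 1"]
    have "monomial (single v 1) * (T n1 M1 - T n2 M2) \<in> ?L"
      unfolding eqN M12(3) .
    thus ?thesis by (simp add: n1 n2 monomial_add algebra_simps)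
  qed
  show ?case
  proof (cases "M = {#}")
    case True
    hence "M' = {#}" using less.prems(3) by simp
    thus ?thesis using True less.prems(4) by (simp add: kvs.span_zero)
  next
    case False
    from linked_or_linked[OF D less.prems False, where 'k = 'k] show ?thesis
    proof
      assume "linked D TYPE('k) m M m' M'"
      then obtain m1 M1 where 1: "set_mset M1 \<subseteq> D" "size M1 = size M" "m1 + vsum M1 = m + vsum M"
        "T m M - T m1 M1 \<in> ?L"
        "(\<exists>e. e \<in># M1 \<and> e \<in># M') \<or> (\<exists>v. lookup m1 v > 0 \<and> lookup m' v > 0)"
        unfolding linked_def by blast
      from strip[OF 1(1) less.prems(2) 1(2) less.prems(3)[symmetric] 1(3) less.prems(4)[symmetric] 1(5)]
      have "T m1 M1 - T m' M' \<in> ?L" .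
      from kvs.span_add[OF 1(4) this] show ?thesis by simp
    next
      assume "linked D TYPE('k) m' M' m M"
      then obtain m1 M1 where 1: "set_mset M1 \<subseteq> D" "size M1 = size M" "m1 + vsum M1 = m + vsum M"
        "T m' M' - T m1 M1 \<in> ?L"
        "(\<exists>e. e \<in># M1 \<and> e \<in># M) \<or> (\<exists>v. lookup m1 v > 0 \<and> lookup m v > 0)"
        unfolding linked_def less.prems(3,4) by blast
      from strip[OF 1(1) less.prems(1) 1(2) refl 1(3) refl 1(5)]
      have "T m1 M1 - T m M \<in> ?L" .
      from kvs.span_neg[OF kvs.span_add[OF 1(4) this]] show ?thesis by simp
    qed
  qed
qed

section \<open>Leading exponents of the powers\<close>

lemma fprod_lead:
  fixes M :: "('n::{finite,linorder} \<times> 'n) multiset"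
  assumes "closed_edges D" "set_mset M \<subseteq> D"
  shows "lookup (fprod M :: ('n, 'k::field) xypoly) (vsum M) = 1 \<and>
    (\<forall>b\<in>keys (fprod M :: ('n, 'k) xypoly). (b, vsum M) \<in> lex_order)"
  using assms(2)
proof (induct M)
  case empty
  show ?case by (simp add: lexD(7))
next
  case (add e M)
  obtain i j where e: "e = (i, j)" by (rule prod.exhaust)
  have "i < j" using add.prems assms(1) e closed_edgesD(1)[of D i j] by simp
  hence "i \<noteq> j" by simp
  have ve: "vexp e = xe i + ye j" by (simp add: vexp_def e)
  let ?p = "ebin e :: ('n, 'k) xypoly" and ?q = "fprod M :: ('n, 'k) xypoly"
  have p: "keys ?p = {xe i + ye j, xe j + ye i}"
    using keys_edge_binomial[OF \<open>i \<noteq> j\<close>, where 'k = 'k] by (simp add: ebin_def e)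
  have p1: "lookup ?p (vexp e) = 1"
    using \<open>i \<noteq> j\<close> unfolding ve unfolding e ebin_def fst_conv snd_conv lookup_edge_binomial by simp
  have pl: "(b, vexp e) \<in> lex_order" if "b \<in> keys ?p" for b
    using that lex_swap[OF \<open>i < j\<close>] lexD(1) unfolding p ve by blast
  have IH: "lookup ?q (vsum M) = 1" "\<And>b. b \<in> keys ?q \<Longrightarrow> (b, vsum M) \<in> lex_order"
    using add by auto
  have "lookup (?p * ?q) (vexp e + vsum M) = lookup ?p (vexp e) * lookup ?q (vsum M)"
    by (rule lookup_mult_max_on_face[OF monomial_order_lex, where U = UNIV])
      (use p1 IH pl in \<open>auto simp: in_keys_iff\<close>)
  hence 1: "lookup (?p * ?q) (vexp e + vsum M) = 1" using p1 IH by simp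
  have 2: "(b, vexp e + vsum M) \<in> lex_order" if b: "b \<in> keys (?p * ?q)" for b
  proof -
    obtain c d where cd: "b = c + d" "c \<in> keys ?p" "d \<in> keys ?q"
      using b keys_mult[of ?p ?q] by blast
    have "(c + d, vexp e + d) \<in> lex_order"
      by (rule lexD(5)[OF pl[OF cd(2)]])
    moreover have "(vexp e + d, vexp e + vsum M) \<in> lex_order"
      by (rule lexD(6)[OF IH(2)[OF cd(3)]])
    ultimately show ?thesis unfolding cd(1) by (rule lexD(3))
  qed
  show ?case unfolding fprod_simps vsum_simps using 1 2 by blast
qed

lemma term_lead:
  fixes M :: "('n::{finite,linorder} \<times> 'n) multiset"
  assumes "closed_edges D" "set_mset M \<subseteq> D"
  shows "lookup (T m M :: ('n, 'k::field) xypoly) (m + vsum M) = 1"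
    and "b \<in> keys (T m M :: ('n, 'k) xypoly) \<Longrightarrow> (b, m + vsum M) \<in> lex_order"
proof -
  note l = fprod_lead[OF assms, where 'k = 'k]
  show "lookup (T m M :: ('n, 'k) xypoly) (m + vsum M) = 1"
    using l by simp
  assume "b \<in> keys (T m M :: ('n, 'k) xypoly)"
  then obtain c where c: "b = m + c" "c \<in> keys (fprod M :: ('n, 'k) xypoly)"
    unfolding keys_monomial_mult by blast
  show "(b, m + vsum M) \<in> lex_order"
    unfolding c(1) using l c(2) monomial_orderD(6)[OF monomial_order_lex, of c "vsum M" m] by blast
qed

text \<open>
  The exponents of the monomials in the \<open>k\<close>-th power of the ideal generated by the \<open>x\<^sub>i y\<^sub>j\<close>.
\<close>

definition points :: "('n \<times> 'n) set \<Rightarrow> nat \<Rightarrow> ('n + 'n) expo set" where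
  "points D k = {m + vsum M | m M. set_mset M \<subseteq> D \<and> size M = k}"

text \<open>
  One product for each leading exponent; by the straightening law these already span.
\<close>

definition rep :: "('n \<times> 'n) set \<Rightarrow> nat \<Rightarrow> ('n + 'n) expo \<Rightarrow> ('n, 'k::comm_ring_1) xypoly" where
  "rep D k a = (SOME p. \<exists>m M. p = T m M \<and> set_mset M \<subseteq> D \<and> size M = k \<and> m + vsum M = a)"

lemma rep:
  assumes "a \<in> points D k"
  obtains m M where "rep D k a = T m M" "set_mset M \<subseteq> D" "size M = k" "m + vsum M = a"
proof -
  have "\<exists>p m M. p = T m M \<and> set_mset M \<subseteq> D \<and> size M = k \<and> m + vsum M = a"
    using assms unfolding points_def by blast
  from someI_ex[OF this] show ?thesis using that unfolding rep_def by blast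
qed

lemma rep_lead:
  assumes "closed_edges D" "a \<in> points D k"
  shows "lookup (rep D k a :: ('n::{finite,linorder}, 'k::field) xypoly) a = 1"
    and "b \<in> keys (rep D k a :: ('n, 'k) xypoly) \<Longrightarrow> (b, a) \<in> lex_order"
proof -
  obtain m M where *: "(rep D k a :: ('n, 'k) xypoly) = T m M" "set_mset M \<subseteq> D" "m + vsum M = a"
    using assms(2) by (rule rep)
  show "lookup (rep D k a :: ('n, 'k) xypoly) a = 1"
    using term_lead(1)[OF assms(1) *(2), of m, where 'k = 'k] * by simp
  show "b \<in> keys (rep D k a :: ('n, 'k) xypoly) \<Longrightarrow> (b, a) \<in> lex_order"
    using term_lead(2)[OF assms(1) *(2), of b m, where 'k = 'k] * by simp
qed

lemma finite_expo_deg: "finite {b :: 'v::finite expo. expo_deg b = d}"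
proof (rule finite_imageD)
  have "lookup b v \<le> expo_deg b" for b :: "'v expo" and v
    unfolding expo_deg_def by (rule member_le_sum) auto
  hence "lookup ` {b :: 'v expo. expo_deg b = d} \<subseteq> PiE UNIV (\<lambda>_. {..d})"
    by (intro image_subsetI PiE_I) (simp_all, metis)
  moreover have "finite (PiE (UNIV :: 'v set) (\<lambda>_. {..d}))"
    by (intro finite_PiE) simp_all
  ultimately show "finite (lookup ` {b :: 'v expo. expo_deg b = d})"
    by (rule finite_subset)
  show "inj_on lookup {b :: 'v expo. expo_deg b = d}"
    by (rule inj_onI) (simp only: poly_mapping_eq_iff)
qed

text \<open>
  The straightening law rewrites a product as its representative plus products with smaller leading
  exponent of the same degree, of which there are finitely many.
\<close>

lemma term_in_span_rep:
  fixes M :: "('n::{finite,linorder} \<times> 'n) multiset"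
  assumes D: "closed_edges D" and "set_mset M \<subseteq> D" "size M = k" "expo_deg (m + vsum M) = d"
  shows "T m M \<in> kvs.span (rep D k ` {b \<in> points D k. expo_deg b = d} :: ('n, 'k::field) xypoly set)"
    (is "_ \<in> kvs.span ?R")
  using assms(2-)
proof (induct "card {b. expo_deg b = d \<and> (b, m + vsum M) \<in> lex_order \<and> b \<noteq> m + vsum M}"
    arbitrary: m M rule: less_induct)
  case less
  define a where "a = m + vsum M"
  have a: "a \<in> points D k" using less.prems unfolding points_def a_def by blast
  obtain m' M' where r: "(rep D k a :: ('n, 'k) xypoly) = T m' M'" "set_mset M' \<subseteq> D" "size M' = k"
    "m' + vsum M' = a" using a by (rule rep)
  have "T m M - rep D k a \<in> kvs.span (lower D k a :: ('n, 'k) xypoly set)"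
    unfolding r(1) using straightening[OF D less.prems(1) r(2), of m m', where 'k = 'k] less.prems(2) r(3,4)
    by (simp add: a_def)
  moreover have "lower D k a \<subseteq> kvs.span ?R"
  proof
    fix g :: "('n, 'k) xypoly" assume "g \<in> lower D k a"
    then obtain n N where g: "g = T n N" "set_mset N \<subseteq> D" "size N = k" "expo_deg (n + vsum N) = expo_deg a"
      "(n + vsum N, a) \<in> lex_order" "n + vsum N \<noteq> a" unfolding lower_def by blast
    let ?L = "\<lambda>c. {b. expo_deg b = d \<and> (b, c) \<in> lex_order \<and> b \<noteq> c}"
    have da: "expo_deg a = d" using less.prems a_def by simp
    have "?L (n + vsum N) \<subset> ?L a"
    proof
      show "?L (n + vsum N) \<subseteq> ?L a"
      proof (intro Collect_mono impI, elim conjE)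
        fix b assume b: "expo_deg b = d" "(b, n + vsum N) \<in> lex_order" "b \<noteq> n + vsum N"
        have "(b, a) \<in> lex_order" by (rule lexD(3)[OF b(2) g(5)])
        moreover have "b \<noteq> a" using lexD(2)[OF b(2)] g(5) b(3) by blast
        ultimately show "expo_deg b = d \<and> (b, a) \<in> lex_order \<and> b \<noteq> a" using b(1) by simp
      qed
      have "n + vsum N \<in> ?L a" using g(4-6) da by simp
      thus "?L (n + vsum N) \<noteq> ?L a" by blast
    qed
    hence "card (?L (n + vsum N)) < card (?L a)"
      by (rule psubset_card_mono[rotated]) (rule finite_subset[OF _ finite_expo_deg[of d]], blast)
    thus "g \<in> kvs.span ?R"
      unfolding g(1) by (intro less.hyps) (use g da in \<open>auto simp: a_def\<close>)
  qed
  hence "kvs.span (lower D k a) \<subseteq> kvs.span ?R" by (rule kvs.span_minimal) (rule kvs.subspace_span)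
  ultimately have "T m M - rep D k a \<in> kvs.span ?R" by blast
  moreover have "rep D k a \<in> kvs.span ?R"
    by (rule kvs.span_base) (use a less.prems a_def in auto)
  ultimately have "(T m M - rep D k a) + rep D k a \<in> kvs.span ?R" by (rule kvs.span_add)
  thus ?case by simp
qed

lemma span_image_explicit:
  fixes f :: "'i \<Rightarrow> ('v, 'k::field) mpolynomial"
  assumes "p \<in> kvs.span (f ` P)"
  obtains B c where "finite B" "B \<subseteq> P" "p = (\<Sum>b\<in>B. cmul (c b) (f b))"
proof -
  obtain t r where t: "finite t" "t \<subseteq> f ` P" "p = (\<Sum>a\<in>t. cmul (r a) a)"
    using assms unfolding kvs.span_explicit by blast
  obtain B where B: "B \<subseteq> P" "inj_on f B" "t = f ` B"
    using t(2) unfolding subset_image_inj by blast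
  have "finite B" using t(1) B finite_imageD by blast
  moreover have "p = (\<Sum>b\<in>B. cmul (r (f b)) (f b))"
    unfolding t(3) B(3) by (simp add: sum.reindex[OF B(2)])
  ultimately show ?thesis using B(1) by (intro that)
qed

text \<open>
  In a linear combination of representatives the leading exponents are distinct, so the largest one
  survives.
\<close>

lemma lead_in_points:
  fixes p :: "('n::{finite,linorder}, 'k::field) xypoly"
  assumes D: "closed_edges D" and P: "P \<subseteq> points D k" and p: "p \<in> kvs.span (rep D k ` P)" "p \<noteq> 0"
  shows "lead_expo lex_order p \<in> P"
proof -
  let ?f = "rep D k :: ('n + 'n) expo \<Rightarrow> ('n, 'k) xypoly"
  obtain B c where B: "finite B" "B \<subseteq> P" "p = (\<Sum>b\<in>B. cmul (c b) (?f b))"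
    using p(1) by (rule span_image_explicit)
  define C where "C = {b\<in>B. c b \<noteq> 0}"
  have C: "finite C" "C \<subseteq> P" using B by (auto simp: C_def)
  have pC: "p = (\<Sum>b\<in>C. cmul (c b) (?f b))"
    unfolding B(3) C_def using B(1) by (intro sum.mono_neutral_right) auto
  have "C \<noteq> {}" using p(2) pC by auto
  then obtain a where a: "a \<in> C" "\<forall>b\<in>C. (b, a) \<in> lex_order"
    using monomial_order_ex_max[OF monomial_order_lex C(1)] by blast
  have z: "lookup (?f b) a = 0" if "b \<in> C" "b \<noteq> a" for b
  proof (rule ccontr)
    assume "lookup (?f b) a \<noteq> 0"
    hence "(a, b) \<in> lex_order" using rep_lead(2)[OF D, of b k a] that P C by (auto simp: in_keys_iff)
    thus False using a that lexD(2) by blast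
  qed
  have "lookup p a = (\<Sum>b\<in>C. c b * lookup (?f b) a)" by (simp add: pC lookup_sum)
  also have "\<dots> = (\<Sum>b\<in>C. if b = a then c a else 0)"
    using z rep_lead(1)[OF D, of a k] a(1) C P by (intro sum.cong) auto
  also have "\<dots> = c a" using a(1) C(1) by simp
  finally have "a \<in> keys p" using a(1) by (simp add: in_keys_iff C_def)
  moreover have "(b, a) \<in> lex_order" if "b \<in> keys p" for b
  proof -
    have "p \<in> kvs.span (?f ` C)" unfolding pC
      by (intro kvs.span_sum kvs.span_scale kvs.span_base imageI)
    from keys_span_subset[OF this] that obtain e where e: "e \<in> C" "b \<in> keys (?f e)" by blast
    hence "(b, e) \<in> lex_order" using rep_lead(2)[OF D, of e k b] P C by blast
    thus ?thesis using a e lexD(3) by blast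
  qed
  ultimately have "lead_expo lex_order p = a" by (intro lead_expo_eqI[OF monomial_order_lex])
  thus ?thesis using a C by blast
qed

lemma ideal_power_eq_span_terms:
  "ideal_power (ideal_gen (ebin ` D)) k =
    kvs.span {T m M | m M. set_mset M \<subseteq> D \<and> size M = k}"
  unfolding ideal_power_eq_span fprod_def ..

theorem initial_ideal_power:
  fixes D :: "('n::{finite,linorder} \<times> 'n) set"
  assumes D: "closed_edges D"
  shows "monomial a \<in> initial_ideal lex_order (ideal_power (ideal_gen (ebin ` D) :: ('n, 'k::field) xypoly set) k)
     \<longleftrightarrow> a \<in> points D k"
proof -
  let ?I = "ideal_power (ideal_gen (ebin ` D) :: ('n, 'k) xypoly set) k"
  have up: "n + b \<in> points D k" if b: "b \<in> points D k" for n b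
  proof -
    obtain m M where "b = m + vsum M" "set_mset M \<subseteq> D" "size M = k" using b unfolding points_def by blast
    hence "n + b = (n + m) + vsum M" "set_mset M \<subseteq> D" "size M = k" by (simp_all add: add_ac)
    thus ?thesis unfolding points_def by blast
  qed
  have "T m M \<in> kvs.span (rep D k ` points D k :: ('n, 'k) xypoly set)"
    if "set_mset M \<subseteq> D" "size M = k" for m M
    using term_in_span_rep[OF D that refl, of m, where 'k = 'k]
    by (rule subsetD[OF kvs.span_mono, rotated]) blast
  hence "?I \<subseteq> kvs.span (rep D k ` points D k)"
    unfolding ideal_power_eq_span_terms by (intro kvs.span_minimal) auto
  hence lead: "lead_expo lex_order p \<in> points D k" if "p \<in> ?I" "p \<noteq> 0" for p
    using lead_in_points[OF D subset_refl] that by blast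
  show ?thesis
    unfolding monomial_in_initial_ideal_iff
  proof
    assume "\<exists>p\<in>?I. p \<noteq> 0 \<and> (\<exists>m. a = m + lead_expo lex_order p)"
    thus "a \<in> points D k" using lead up by blast
  next
    assume "a \<in> points D k"
    then obtain m M where a: "a = m + vsum M" "set_mset M \<subseteq> D" "size M = k"
      unfolding points_def by blast
    let ?p = "T m M :: ('n, 'k) xypoly"
    have k: "a \<in> keys ?p"
      using term_lead(1)[OF D a(2), of m, where 'k = 'k] a by (simp add: in_keys_iff)
    hence "?p \<noteq> 0" by auto
    moreover have "lead_expo lex_order ?p = a"
      by (rule lead_expo_eqI[OF monomial_order_lex k]) (use term_lead(2)[OF D a(2)] a(1) in blast)
    moreover have "?p \<in> ?I" unfolding ideal_power_eq_span_terms
      by (rule kvs.span_base) (use a in blast)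
    ultimately show "\<exists>p\<in>?I. p \<noteq> 0 \<and> (\<exists>m. a = m + lead_expo lex_order p)"
      by (intro bexI[of _ ?p] conjI exI[of _ 0]) simp_all
  qed
qed

section \<open>Newton polyhedra\<close>

definition orthant :: "(real ^ 'v::finite) set" where
  "orthant = {x. \<forall>v. 0 \<le> x $ v}"

definition evec :: "'v::finite expo \<Rightarrow> real ^ 'v" where
  "evec a = (\<chi> v. real (lookup a v))"

lemma evec_add: "evec (a + b) = evec a + evec b"
  by (simp add: evec_def vec_eq_iff lookup_add)

lemma closed_orthant: "closed (orthant :: (real ^ 'v::finite) set)"
proof -
  have "orthant = (\<Inter>v. {x :: real ^ 'v. x $ v \<ge> 0})" by (auto simp: orthant_def)
  moreover have "closed (\<Inter>v. {x :: real ^ 'v. x $ v \<ge> 0})"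
    by (intro closed_INT ballI closed_halfspace_component_ge_cart)
  ultimately show ?thesis by (simp only:)
qed

lemma convex_orthant: "convex orthant"
  by (auto simp: convex_def orthant_def)

text \<open>
  A point of the orthant is the average of its \<open>N\<close>-fold coordinate parts, \<open>N\<close> being the dimension, and
  each of these lies on a segment from the origin to an integral point of a coordinate axis.
\<close>

lemma orthant_subset_hull: "orthant \<subseteq> convex hull (range (evec :: 'v::finite expo \<Rightarrow> _))"
proof
  fix t :: "real ^ 'v" assume t: "t \<in> orthant"
  have ax: "c *\<^sub>R axis v 1 \<in> convex hull (range (evec :: 'v expo \<Rightarrow> _))" if "0 \<le> c" for c :: real and v
  proof -
    define n where "n = Suc (nat \<lceil>c\<rceil>)"
    have n: "c \<le> real n" "real n > 0" unfolding n_def using that by linarith+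
    have "evec (single v n) = real n *\<^sub>R (axis v 1 :: real ^ 'v)"
      by (auto simp: evec_def vec_eq_iff lookup_single when_def axis_def)
    hence "real n *\<^sub>R axis v 1 \<in> convex hull (range (evec :: 'v expo \<Rightarrow> _))"
      by (metis hull_inc rangeI)
    moreover have "evec 0 = (0 :: real ^ 'v)" by (simp add: evec_def vec_eq_iff)
    hence "0 \<in> convex hull (range (evec :: 'v expo \<Rightarrow> _))"
      by (metis hull_inc rangeI)
    ultimately have "(1 - c / real n) *\<^sub>R 0 + (c / real n) *\<^sub>R (real n *\<^sub>R axis v 1)
        \<in> convex hull (range (evec :: 'v expo \<Rightarrow> _))"
      using n that by (intro convexD[OF convex_convex_hull]) auto
    thus ?thesis using n by simp
  qed
  let ?N = "real CARD('v)"
  have "(\<Sum>v\<in>UNIV. (1 / ?N) *\<^sub>R ((?N * t $ v) *\<^sub>R axis v 1)) \<in> convex hull (range (evec :: 'v expo \<Rightarrow> _))"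
    using t by (intro convex_sum convex_convex_hull ax) (auto simp: orthant_def)
  also have "(\<Sum>v\<in>UNIV. (1 / ?N) *\<^sub>R ((?N * t $ v) *\<^sub>R axis v 1)) = t"
    by (simp add: vec_eq_iff axis_def if_distrib cong: if_cong)
  finally show "t \<in> convex hull (range (evec :: 'v expo \<Rightarrow> _))" .
qed

definition newton_polyhedron :: "(real ^ 'v::finite) set \<Rightarrow> (real ^ 'v) set" where
  "newton_polyhedron A = {q + t | q t. q \<in> convex hull A \<and> t \<in> orthant}"

lemma convex_newton_polyhedron: "convex (newton_polyhedron A)"
proof -
  have "newton_polyhedron A = convex hull A + orthant"
    by (auto simp: newton_polyhedron_def set_plus_def)
  thus ?thesis by (simp add: convex_set_plus convex_orthant)
qed

lemma closed_newton_polyhedron: "finite A \<Longrightarrow> closed (newton_polyhedron A)"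
proof -
  assume "finite A"
  hence "closed (\<Union>x\<in>orthant. \<Union>y\<in>convex hull A. {x + y})"
    by (intro closed_compact_sums closed_orthant finite_imp_compact_convex_hull)
  also have "(\<Union>x\<in>orthant. \<Union>y\<in>convex hull A. {x + y}) = newton_polyhedron A"
    by (auto simp: newton_polyhedron_def add.commute) (metis add.commute)+
  finally show ?thesis .
qed

lemma average_in_convex:
  assumes "convex C" "M \<noteq> {#}" "\<And>e. e \<in># M \<Longrightarrow> f e \<in> C"
  shows "(1 / real (size M)) *\<^sub>R (\<Sum>e\<in>#M. f e) \<in> (C :: 'a::real_vector set)"
  using assms(2,3)
proof (induct M)
  case (add e M)
  show ?case
  proof (cases "M = {#}")
    case False
    let ?n = "real (size M)"
    have n: "?n > 0" using False by (simp add: nonempty_has_size)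
    have "(1 / (1 + ?n)) *\<^sub>R f e + (?n / (1 + ?n)) *\<^sub>R ((1 / ?n) *\<^sub>R (\<Sum>e\<in>#M. f e)) \<in> C"
      using add False n by (intro convexD[OF assms(1)]) (auto simp: field_simps)
    thus ?thesis using n False by (simp add: scaleR_add_right)
  qed (use add in simp)
qed simp

lemma evec_vsum: "evec (vsum M) = (\<Sum>e\<in>#M. evec (vexp e))"
  by (induct M) (auto simp: evec_add, simp add: evec_def vec_eq_iff)

text \<open>
  The scaled points \<open>a / k\<close> are averages of exponent vectors of edges plus a vector of the orthant, so
  all levels \<open>k\<close> lie in the polyhedron of level 1; and level 1 already fills it.
\<close>

lemma newton_okounkov_eq:
  fixes I :: "nat \<Rightarrow> ('n::{finite,linorder}, 'k::field) xypoly set"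
  assumes I: "\<And>k a. monomial a \<in> I k \<longleftrightarrow> a \<in> points D k"
  shows "newton_okounkov I = newton_polyhedron ((\<lambda>e. evec (vexp e)) ` D)"
proof -
  define A where "A = (\<lambda>e. evec (vexp e)) ` D"
  define S where "S k = {(\<chi> v. real (lookup a v) / real k) | a. monomial a \<in> I k}" for k
  have Seq: "S k = (\<lambda>a. (1 / real k) *\<^sub>R evec a) ` points D k" for k
    unfolding S_def I by (auto simp: evec_def vec_eq_iff image_iff)
  have "finite A" by (simp add: A_def finite)
  have "S k \<subseteq> newton_polyhedron A" if "k \<ge> 1" for k
  proof
    fix x assume "x \<in> S k"
    then obtain m M where M: "set_mset M \<subseteq> D" "size M = k" and x: "x = (1 / real k) *\<^sub>R evec (m + vsum M)"
      unfolding Seq points_def by blast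
    have "M \<noteq> {#}" using M that by auto
    have "(1 / real (size M)) *\<^sub>R (\<Sum>e\<in>#M. evec (vexp e)) \<in> convex hull A"
      by (rule average_in_convex[OF convex_convex_hull \<open>M \<noteq> {#}\<close>])
        (use M in \<open>auto simp: A_def intro!: hull_inc\<close>)
    moreover have "(1 / real k) *\<^sub>R evec m \<in> orthant" by (simp add: orthant_def evec_def)
    moreover have "x = (1 / real (size M)) *\<^sub>R (\<Sum>e\<in>#M. evec (vexp e)) + (1 / real k) *\<^sub>R evec m"
      unfolding x evec_add evec_vsum M(2) by (simp add: scaleR_add_right)
    ultimately show "x \<in> newton_polyhedron A" unfolding newton_polyhedron_def by blast
  qed
  hence "convex hull (S k) \<subseteq> newton_polyhedron A" if "k \<ge> 1" for k
    using that by (intro hull_minimal convex_newton_polyhedron)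
  hence "closure (\<Union>k\<in>{1..}. convex hull (S k)) \<subseteq> newton_polyhedron A"
    by (intro closure_minimal closed_newton_polyhedron \<open>finite A\<close>) auto
  moreover have "newton_polyhedron A \<subseteq> closure (\<Union>k\<in>{1..}. convex hull (S k))"
  proof -
    have "A + range evec \<subseteq> S 1"
    proof
      fix x assume "x \<in> A + range (evec :: ('n + 'n) expo \<Rightarrow> _)"
      then obtain e m where e: "e \<in> D" "x = evec (vexp e) + evec m" unfolding A_def set_plus_def by blast
      have "m + vsum {#e#} \<in> points D 1" unfolding points_def using e(1) by fastforce
      moreover have "x = (1 / real 1) *\<^sub>R evec (m + vsum {#e#})"
        by (simp add: e(2) evec_add add.commute)
      ultimately show "x \<in> S 1" unfolding Seq by blast
    qed
    hence "convex hull (A + range evec) \<subseteq> convex hull (S 1)" by (rule hull_mono)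
    moreover have "newton_polyhedron A \<subseteq> convex hull A + convex hull (range evec)"
      unfolding newton_polyhedron_def set_plus_def using orthant_subset_hull by blast
    ultimately have "newton_polyhedron A \<subseteq> convex hull (S 1)"
      unfolding convex_hull_set_plus by blast
    also have "\<dots> \<subseteq> (\<Union>k\<in>{1..}. convex hull (S k))" by blast
    also have "\<dots> \<subseteq> closure \<dots>" by (rule closure_subset)
    finally show ?thesis .
  qed
  ultimately show ?thesis unfolding newton_okounkov_def S_def A_def by (rule equalityI)
qed

lemma newton_polyhedron_add:
  "x \<in> newton_polyhedron A \<Longrightarrow> t \<in> orthant \<Longrightarrow> x + t \<in> newton_polyhedron A"
proof -
  assume "x \<in> newton_polyhedron A" "t \<in> orthant"
  then obtain q s where "x = q + s" "q \<in> convex hull A" "s \<in> orthant" by (auto simp: newton_polyhedron_def)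
  moreover have "s + t \<in> orthant" using \<open>s \<in> orthant\<close> \<open>t \<in> orthant\<close> by (simp add: orthant_def)
  ultimately show ?thesis unfolding newton_polyhedron_def by (auto simp: add.assoc)
qed

text \<open>
  A point \<open>q + t\<close> of a face with \<open>t \<noteq> 0\<close> in the orthant is interior to segments on the ray from \<open>q\<close>
  in direction \<open>t\<close>, so the face contains an unbounded part of this ray.
\<close>

lemma compact_face_subset_hull:
  assumes F: "F face_of newton_polyhedron A" "compact F"
  shows "F \<subseteq> convex hull A"
proof
  fix p assume p: "p \<in> F"
  hence "p \<in> newton_polyhedron A" using F face_of_imp_subset by blast
  then obtain q t where qt: "p = q + t" "q \<in> convex hull A" "t \<in> orthant" by (auto simp: newton_polyhedron_def)
  have "0 \<in> orthant" by (simp add: orthant_def)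
  hence q: "q \<in> newton_polyhedron A" using qt(2) unfolding newton_polyhedron_def by force
  have "t = 0"
  proof (rule ccontr)
    assume "t \<noteq> 0"
    have ray: "q + s *\<^sub>R t \<in> F" if "s > 1" for s
    proof -
      have "s *\<^sub>R t \<in> orthant" using qt(3) that by (simp add: orthant_def)
      hence qs: "q + s *\<^sub>R t \<in> newton_polyhedron A" by (rule newton_polyhedron_add[OF q])
      have "p \<in> open_segment q (q + s *\<^sub>R t)"
        unfolding in_segment using that \<open>t \<noteq> 0\<close>
        by (auto intro!: exI[of _ "1 / s"] simp: qt(1) algebra_simps)
      thus ?thesis using face_ofD[OF F(1) _ q qs p] by blast
    qed
    obtain B where B: "\<And>x. x \<in> F \<Longrightarrow> norm x \<le> B"
      using F(2) compact_imp_bounded bounded_iff by metis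
    \<comment> \<open>far enough out on the ray to leave the ball of radius \<open>B\<close>\<close>
    define s where "s = 2 + (\<bar>B\<bar> + norm q) / norm t"
    have nt: "norm t > 0" using \<open>t \<noteq> 0\<close> by simp
    have s1: "s > 1" unfolding s_def using nt by (simp add: add_pos_nonneg)
    have "norm (s *\<^sub>R t) \<le> norm (q + s *\<^sub>R t) + norm q"
      by (metis add_diff_cancel_left' norm_triangle_ineq4)
    also have "\<dots> \<le> B + norm q" using B[OF ray[OF s1]] by simp
    finally have "s * norm t \<le> B + norm q" using s1 by simp
    moreover have "s * norm t = 2 * norm t + (\<bar>B\<bar> + norm q)"
      unfolding s_def using nt by (simp add: field_simps)
    ultimately show False using nt by linarith
  qed
  thus "p \<in> convex hull A" using qt by simp
qed

lemma mcd_newton_polyhedron: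
  fixes A :: "(real ^ 'v::finite) set"
  assumes "finite A" and c: "\<And>x. x \<in> A \<Longrightarrow> (\<Sum>v\<in>UNIV. x $ v) = c" "c \<noteq> 0"
  shows "mcd (newton_polyhedron A) + 1 = int (dim A)"
proof -
  define w :: "real ^ 'v" where "w = (\<chi> v. 1)"
  have w: "w \<bullet> x = (\<Sum>v\<in>UNIV. x $ v)" for x by (simp add: w_def inner_vec_def)
  have hull: "w \<bullet> x = c" if "x \<in> convex hull A" for x
  proof -
    have "convex hull A \<subseteq> {x. w \<bullet> x = c}"
      using c(1) by (intro hull_minimal convex_hyperplane) (auto simp: w)
    thus ?thesis using that by blast
  qed
  have pos: "w \<bullet> t \<ge> 0" if "t \<in> orthant" for t
    using that by (auto simp: w orthant_def intro: sum_nonneg)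
  have "newton_polyhedron A \<inter> {x. w \<bullet> x = c} = convex hull A"
  proof
    show "newton_polyhedron A \<inter> {x. w \<bullet> x = c} \<subseteq> convex hull A"
    proof (intro subsetI, elim IntE CollectE)
      fix x assume "x \<in> newton_polyhedron A" and x: "w \<bullet> x = c"
      then obtain q t where qt: "x = q + t" "q \<in> convex hull A" "t \<in> orthant" by (auto simp: newton_polyhedron_def)
      have "(\<Sum>v\<in>UNIV. t $ v) = 0" using x hull[OF qt(2)] by (simp add: qt(1) inner_add_right flip: w)
      hence "t = 0" using qt(3)
        by (subst (asm) sum_nonneg_eq_0_iff) (auto simp: orthant_def vec_eq_iff)
      thus "x \<in> convex hull A" using qt by simp
    qed
    have "x = x + 0 \<and> 0 \<in> orthant" for x :: "real ^ 'v" by (simp add: orthant_def)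
    thus "convex hull A \<subseteq> newton_polyhedron A \<inter> {x. w \<bullet> x = c}"
      unfolding newton_polyhedron_def using hull by blast
  qed
  moreover have "(newton_polyhedron A \<inter> {x. w \<bullet> x = c}) face_of newton_polyhedron A"
    by (rule face_of_Int_supporting_hyperplane_ge[OF convex_newton_polyhedron])
      (auto simp: newton_polyhedron_def inner_add_right hull pos)
  ultimately have face: "convex hull A face_of newton_polyhedron A" by simp
  have comp: "compact (convex hull A)" using assms(1) by (rule finite_imp_compact_convex_hull)
  have "mcd (newton_polyhedron A) = aff_dim A"
    unfolding mcd_def
  proof (rule Max_eqI)
    have "{aff_dim F | F. F face_of newton_polyhedron A \<and> compact F} \<subseteq> {-1..int DIM(real ^ 'v)}"
    proof (intro subsetI, elim CollectE exE conjE)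
      fix y and F :: "(real ^ 'v) set" assume "y = aff_dim F"
      thus "y \<in> {-1..int DIM(real ^ 'v)}"
        using aff_dim_geq[of F] aff_dim_le_DIM[of F] by simp
    qed
    thus "finite {aff_dim F | F. F face_of newton_polyhedron A \<and> compact F}"
      by (rule finite_subset) simp
    show "aff_dim A \<in> {aff_dim F | F. F face_of newton_polyhedron A \<and> compact F}"
      using face comp aff_dim_convex_hull[of A] by (metis (mono_tags, lifting) mem_Collect_eq)
    fix y assume "y \<in> {aff_dim F | F. F face_of newton_polyhedron A \<and> compact F}"
    then obtain F where F: "y = aff_dim F" "F face_of newton_polyhedron A" "compact F" by blast
    show "y \<le> aff_dim A"
      using aff_dim_subset[OF compact_face_subset_hull[OF F(2,3)]] by (simp add: F(1) aff_dim_convex_hull)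
  qed
  moreover have "0 \<notin> affine hull A"
  proof -
    have "affine hull A \<subseteq> {x. w \<bullet> x = c}"
      using c(1) by (intro hull_minimal affine_hyperplane) (auto simp: w)
    thus ?thesis using c(2) by auto
  qed
  hence "aff_dim (insert 0 A) = aff_dim A + 1" by (simp add: aff_dim_insert)
  moreover have "aff_dim (insert 0 A) = int (dim (insert 0 A))"
    by (rule aff_dim_zero) (simp add: hull_inc)
  moreover have "dim (insert 0 A) = dim A" by (metis dim_span span_insert_0)
  ultimately show ?thesis by simp
qed

section \<open>The rank of a closed graph\<close>

definition lower_nbrs :: "('n \<times> 'n) set \<Rightarrow> 'n \<Rightarrow> 'n set" where
  "lower_nbrs D j = {i. (i, j) \<in> D}"

text \<open>
  The largest and the second largest smaller neighbour of \<open>j\<close>; the values are meaningful for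
  \<open>j \<in> has1 D\<close> and \<open>j \<in> has2 D\<close>.
\<close>

definition pred1 :: "('n::{finite,linorder} \<times> 'n) set \<Rightarrow> 'n \<Rightarrow> 'n" where
  "pred1 D j = Max (lower_nbrs D j)"

definition pred2 :: "('n::{finite,linorder} \<times> 'n) set \<Rightarrow> 'n \<Rightarrow> 'n" where
  "pred2 D j = Max (lower_nbrs D j - {pred1 D j})"

definition has1 :: "('n::{finite,linorder} \<times> 'n) set \<Rightarrow> 'n set" where
  "has1 D = {j. lower_nbrs D j \<noteq> {}}"

definition has2 :: "('n::{finite,linorder} \<times> 'n) set \<Rightarrow> 'n set" where
  "has2 D = {j. lower_nbrs D j - {pred1 D j} \<noteq> {}}"

text \<open>
  The edges \<open>(pred1 D j, j)\<close> and \<open>(pred2 D j, j)\<close> form a maximal set of edges with linearly independent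
  exponent vectors. For a complete graph on \<open>m \<ge> 2\<close> vertices their number is \<open>2 m - 3\<close>, the dimension of the
  cone over the Grassmannian of lines.
\<close>

definition rank :: "('n::{finite,linorder} \<times> 'n) set \<Rightarrow> nat" where
  "rank D = card (has1 D) + card (has2 D)"

lemma pred1: "j \<in> has1 D \<Longrightarrow> (pred1 D j, j) \<in> D" "(i, j) \<in> D \<Longrightarrow> i \<le> pred1 D j" "(i, j) \<in> D \<Longrightarrow> j \<in> has1 D"
proof -
  assume "j \<in> has1 D"
  hence "Max (lower_nbrs D j) \<in> lower_nbrs D j" by (intro Max_in finite) (simp add: has1_def)
  thus "(pred1 D j, j) \<in> D" by (simp add: pred1_def lower_nbrs_def)
next
  assume "(i, j) \<in> D"
  hence *: "i \<in> lower_nbrs D j" by (simp add: lower_nbrs_def)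
  thus "i \<le> pred1 D j" unfolding pred1_def by (intro Max_ge finite)
  show "j \<in> has1 D" using * by (auto simp: has1_def)
qed

lemma pred2: "j \<in> has2 D \<Longrightarrow> (pred2 D j, j) \<in> D" "j \<in> has2 D \<Longrightarrow> pred2 D j < pred1 D j"
  "(i, j) \<in> D \<Longrightarrow> i \<noteq> pred1 D j \<Longrightarrow> i \<le> pred2 D j \<and> j \<in> has2 D" "has2 D \<subseteq> has1 D"
proof -
  have *: "pred2 D j \<in> lower_nbrs D j - {pred1 D j}" if "j \<in> has2 D"
    unfolding pred2_def by (rule Max_in) (use that in \<open>simp_all add: has2_def\<close>)
  show 1: "(pred2 D j, j) \<in> D" if "j \<in> has2 D" using *[OF that] by (simp add: lower_nbrs_def)
  show "pred2 D j < pred1 D j" if "j \<in> has2 D" using *[OF that] pred1(2)[OF 1[OF that]] by (simp add: less_le)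
  show "i \<le> pred2 D j \<and> j \<in> has2 D" if "(i, j) \<in> D" "i \<noteq> pred1 D j"
  proof -
    have i: "i \<in> lower_nbrs D j - {pred1 D j}" using that by (simp add: lower_nbrs_def)
    hence "i \<le> pred2 D j" unfolding pred2_def by (intro Max_ge) simp_all
    moreover have "j \<in> has2 D" unfolding has2_def using i by blast
    ultimately show ?thesis ..
  qed
  show "has2 D \<subseteq> has1 D" unfolding has1_def has2_def by blast
qed

text \<open>
  If \<open>j < j'\<close> had the same largest smaller neighbour, then they would be adjacent, and \<open>j\<close> would
  be a larger smaller neighbour of \<open>j'\<close>.
\<close>

lemma inj_pred1:
  assumes D: "closed_edges D"
  shows "inj_on (pred1 D) (has1 D)"
proof -
  have *: False if j: "j \<in> has1 D" "j' \<in> has1 D" "pred1 D j = pred1 D j'" "j < j'" for j j'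
  proof -
    have "(pred1 D j, j) \<in> D" "(pred1 D j, j') \<in> D" using pred1(1)[OF j(1)] pred1(1)[OF j(2)] j(3) by simp_all
    hence "(j, j') \<in> D" "pred1 D j < j" using closed_edgesD[OF D] j(4) by blast+
    thus False using pred1(2)[of j j' D] j(3) by simp
  qed
  show ?thesis
  proof (rule inj_onI, rule ccontr)
    fix j j' assume "j \<in> has1 D" "j' \<in> has1 D" "pred1 D j = pred1 D j'" "j \<noteq> j'"
    thus False using *[of j j'] *[of j' j] by (metis neqE)
  qed
qed

abbreviation ev :: "'n::finite \<times> 'n \<Rightarrow> real ^ ('n + 'n)" where "ev e \<equiv> evec (vexp e)"

lemma ev_Inl: "ev (i, j) $ Inl k = (if k = i then 1 else 0)"
  and ev_Inr: "ev (i, j) $ Inr k = (if k = j then 1 else 0)"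
  by (simp_all add: evec_def vexp_def lookup_add)

lemma vec_sum_eqI:
  fixes x y :: "real ^ ('n::finite + 'n)"
  assumes "\<And>k. x $ Inl k = y $ Inl k" "\<And>k. x $ Inr k = y $ Inr k"
  shows "x = y"
proof -
  have "x $ v = y $ v" for v by (cases v) (simp_all only: assms)
  thus ?thesis unfolding vec_eq_iff by blast
qed

definition ev1 :: "('n::{finite,linorder} \<times> 'n) set \<Rightarrow> 'n \<Rightarrow> real ^ ('n + 'n)" where
  "ev1 D j = ev (pred1 D j, j)"
definition ev2 :: "('n::{finite,linorder} \<times> 'n) set \<Rightarrow> 'n \<Rightarrow> real ^ ('n + 'n)" where
  "ev2 D j = ev (pred2 D j, j)"

text \<open>
  For a smaller neighbour \<open>i\<close> of \<open>j\<close> below \<open>p = pred2 D j\<close> and \<open>q = pred1 D j\<close>, the vector of \<open>(i, j)\<close> is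
  the vector of \<open>(i, q)\<close> minus that of \<open>(p, q)\<close> plus that of \<open>(p, j)\<close>, and \<open>q < j\<close> allows induction.
\<close>

lemma ev_in_span:
  assumes D: "closed_edges D"
  shows "(i, j) \<in> D \<Longrightarrow> ev (i, j) \<in> span (ev1 D ` has1 D \<union> ev2 D ` has2 D)"
proof (induct "card {k. k < j}" arbitrary: i j rule: less_induct)
  case less
  let ?B = "ev1 D ` has1 D \<union> ev2 D ` has2 D"
  have j1: "j \<in> has1 D" using less.prems by (rule pred1(3))
  show ?case
  proof (cases "i = pred1 D j")
    case True
    have "ev (i, j) = ev1 D j" unfolding True ev1_def ..
    thus ?thesis using j1 by (simp add: span_base)
  next
    case False
    hence i: "i \<le> pred2 D j" and j2: "j \<in> has2 D" using pred2(3)[OF less.prems] by blast+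
    have e2: "ev (pred2 D j, j) \<in> span ?B" using j2 unfolding ev2_def[symmetric] by (simp add: span_base)
    show ?thesis
    proof (cases "i = pred2 D j")
      case True
      show ?thesis unfolding True by (rule e2)
    next
      case ne: False
      \<comment> \<open>the edge \<open>(i, j)\<close> is the alternating sum of the path through \<open>q\<close> and \<open>p\<close>\<close>
      define q where "q = pred1 D j"
      define p where "p = pred2 D j"
      have pq: "p < q" and qj: "(q, j) \<in> D" and pj: "(p, j) \<in> D"
        unfolding p_def q_def using pred2(1,2)[OF j2] pred1(1)[OF j1] by simp_all
      have ip: "i < p" using i ne unfolding p_def by simp
      have iq: "(i, q) \<in> D" by (rule closed_edgesD(3)[OF D less.prems qj]) (use ip pq in simp)
      have pq': "(p, q) \<in> D" by (rule closed_edgesD(3)[OF D pj qj pq])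
      have "q < j" by (rule closed_edgesD(1)[OF D qj])
      hence "{k. k < q} \<subset> {k. k < j}" by (intro psubsetI) (auto dest: less_trans)
      hence c: "card {k. k < q} < card {k. k < j}" by (rule psubset_card_mono[rotated]) simp
      have "ev (i, j) = ev (i, q) - ev (p, q) + ev (p, j)"
        by (rule vec_sum_eqI) (simp_all add: ev_Inl ev_Inr)
      moreover have "ev (i, q) - ev (p, q) + ev (p, j) \<in> span ?B"
        by (intro span_add span_diff less.hyps[OF c iq] less.hyps[OF c pq'] e2[folded p_def])
      ultimately show ?thesis by (simp only:)
    qed
  qed
qed

definition comb :: "('n::{finite,linorder} \<times> 'n) set \<Rightarrow> ('n \<Rightarrow> real) \<Rightarrow> ('n \<Rightarrow> real) \<Rightarrow> real ^ ('n + 'n)" where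
  "comb D c d = (\<Sum>j\<in>has1 D. c j *\<^sub>R ev1 D j) + (\<Sum>j\<in>has2 D. d j *\<^sub>R ev2 D j)"

lemma comb_Inl: "comb D c d $ Inl k = (\<Sum>j\<in>has1 D. if k = pred1 D j then c j else 0) +
    (\<Sum>j\<in>has2 D. if k = pred2 D j then d j else 0)"
  by (simp add: comb_def ev1_def ev2_def ev_Inl if_distrib cong: if_cong)

lemma comb_Inr: "j \<in> has2 D \<Longrightarrow> comb D c d $ Inr j = c j + d j"
proof -
  assume j: "j \<in> has2 D"
  hence j1: "j \<in> has1 D" using pred2(4) by blast
  have "comb D c d $ Inr j = (\<Sum>k\<in>has1 D. if j = k then c k else 0) + (\<Sum>k\<in>has2 D. if j = k then d k else 0)"
    by (simp add: comb_def ev1_def ev2_def ev_Inr if_distrib cong: if_cong)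
  thus ?thesis using j j1 by (simp add: sum.delta')
qed

text \<open>
  The system is triangular when the \<open>j\<close> are processed by decreasing \<open>pred1 D j\<close>: besides \<open>c j\<close>, only \<open>d k\<close>
  with \<open>pred2 D k = pred1 D j\<close> contribute to the coordinate of \<open>x\<close> at \<open>pred1 D j\<close>, and such \<open>k\<close> have a
  larger \<open>pred1 D k\<close>.
\<close>

lemma comb_eq_0:
  assumes D: "closed_edges D"
    and z1: "\<And>j. j \<in> has1 D \<Longrightarrow> comb D c d $ Inl (pred1 D j) = 0"
    and z2: "\<And>j. j \<in> has2 D \<Longrightarrow> comb D c d $ Inr j = 0"
  shows "j \<in> has1 D \<Longrightarrow> c j = 0 \<and> (j \<in> has2 D \<longrightarrow> d j = 0)"
proof (induct "card {k. pred1 D j < k}" arbitrary: j rule: less_induct)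
  case less
  have "(\<Sum>k\<in>has1 D. if pred1 D j = pred1 D k then c k else 0) = (\<Sum>k\<in>has1 D. if k = j then c j else 0)"
  proof (intro sum.cong refl)
    fix k assume "k \<in> has1 D"
    hence "pred1 D j = pred1 D k \<longleftrightarrow> j = k"
      using inj_on_eq_iff[OF inj_pred1[OF D] less.prems] by blast
    thus "(if pred1 D j = pred1 D k then c k else 0) = (if k = j then c j else 0)" by auto
  qed
  also have "\<dots> = c j" using less.prems by simp
  finally have 1: "(\<Sum>k\<in>has1 D. if pred1 D j = pred1 D k then c k else 0) = c j" .
  have 2: "(\<Sum>k\<in>has2 D. if pred1 D j = pred2 D k then d k else 0) = 0"
  proof (intro sum.neutral ballI)
    fix k assume k: "k \<in> has2 D"
    show "(if pred1 D j = pred2 D k then d k else 0) = 0"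
    proof (cases "pred1 D j = pred2 D k")
      case True
      hence lt: "pred1 D j < pred1 D k" using pred2(2)[OF k] by simp
      hence "{l. pred1 D k < l} \<subset> {l. pred1 D j < l}" by (intro psubsetI) (auto dest: less_trans)
      hence "card {l. pred1 D k < l} < card {l. pred1 D j < l}" by (rule psubset_card_mono[rotated]) simp
      moreover have "k \<in> has1 D" using k pred2(4) by blast
      ultimately have "d k = 0" using less.hyps[of k] k by blast
      thus ?thesis by simp
    qed simp
  qed
  have "c j = 0" using z1[OF less.prems] unfolding comb_Inl 1 2 by simp
  moreover have "d j = 0" if "j \<in> has2 D" using z2[OF that] \<open>c j = 0\<close> by (simp add: comb_Inr[OF that])
  ultimately show ?case by blast
qed

lemma span_eq_comb:
  assumes "w \<in> span (ev1 D ` has1 D \<union> ev2 D ` has2 D)"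
  obtains c d where "w = comb D c d"
proof -
  have "\<exists>c d. w = comb D c d"
  proof (rule span_induct[OF assms, of "\<lambda>w. \<exists>c d. w = comb D c d"])
    have add: "comb D c d + comb D c' d' = comb D (\<lambda>j. c j + c' j) (\<lambda>j. d j + d' j)" for c d c' d'
      by (simp add: comb_def scaleR_add_left sum.distrib)
    have scale: "r *\<^sub>R comb D c d = comb D (\<lambda>j. r * c j) (\<lambda>j. r * d j)" for r c d
      by (simp add: comb_def scaleR_add_right scaleR_right.sum)
    have zero: "0 = comb D (\<lambda>j. 0) (\<lambda>j. 0)" by (simp add: comb_def)
    show "subspace {w. \<exists>c d. w = comb D c d}"
    proof (rule subspaceI)
      show "0 \<in> {w. \<exists>c d. w = comb D c d}" using zero by blast
      show "x + y \<in> {w. \<exists>c d. w = comb D c d}"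
        if "x \<in> {w. \<exists>c d. w = comb D c d}" "y \<in> {w. \<exists>c d. w = comb D c d}" for x y
        using that add by blast
      show "r *\<^sub>R x \<in> {w. \<exists>c d. w = comb D c d}" if "x \<in> {w. \<exists>c d. w = comb D c d}" for r x
        using that scale by blast
    qed
    fix x assume "x \<in> ev1 D ` has1 D \<union> ev2 D ` has2 D"
    thus "\<exists>c d. x = comb D c d"
    proof
      assume "x \<in> ev1 D ` has1 D"
      then obtain j where j: "j \<in> has1 D" "x = ev1 D j" by blast
      have "comb D (\<lambda>k. if k = j then 1 else 0) (\<lambda>k. 0) = x"
        using j by (simp add: comb_def if_distrib[of "\<lambda>r. r *\<^sub>R _"] cong: if_cong)
      thus ?thesis by metis
    next
      assume "x \<in> ev2 D ` has2 D"
      then obtain j where j: "j \<in> has2 D" "x = ev2 D j" by blast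
      have "comb D (\<lambda>k. 0) (\<lambda>k. if k = j then 1 else 0) = x"
        using j by (simp add: comb_def if_distrib[of "\<lambda>r. r *\<^sub>R _"] cong: if_cong)
      thus ?thesis by metis
    qed
  qed
  thus ?thesis using that by blast
qed

text \<open>
  The pivot coordinates determine a vector in the span of the edge vectors. There are \<open>rank D\<close> of them,
  which makes counting exponents easy.
\<close>

lemma span_zero_on_pivots:
  assumes D: "closed_edges D" and w: "w \<in> span (ev ` D)"
    and "\<And>j. j \<in> has1 D \<Longrightarrow> w $ Inl (pred1 D j) = 0" "\<And>j. j \<in> has2 D \<Longrightarrow> w $ Inr j = 0"
  shows "w = 0"
proof -
  have "ev ` D \<subseteq> span (ev1 D ` has1 D \<union> ev2 D ` has2 D)" using ev_in_span[OF D] by auto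
  hence "w \<in> span (ev1 D ` has1 D \<union> ev2 D ` has2 D)" using w span_minimal[OF _ subspace_span] by blast
  then obtain c d where wc: "w = comb D c d" by (rule span_eq_comb)
  have "c j = 0" if "j \<in> has1 D" for j
    using comb_eq_0[OF D, of c d j] assms(3,4) that unfolding wc by blast
  moreover have "d j = 0" if "j \<in> has2 D" for j
    using comb_eq_0[OF D, of c d j] assms(3,4) that pred2(4)[of D] unfolding wc by blast
  ultimately show ?thesis unfolding wc comb_def by simp
qed

lemma dim_ev:
  fixes D :: "('n::{finite,linorder} \<times> 'n) set"
  assumes D: "closed_edges D"
  shows "dim (ev ` D) = rank D"
proof -
  let ?B = "ev1 D ` has1 D \<union> ev2 D ` has2 D"
  have evinj: "e = e'" if "ev e = ev e'" for e e' :: "'n \<times> 'n"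
  proof -
    obtain i j i' j' where e: "e = (i, j)" "e' = (i', j')" by (metis prod.exhaust)
    have "ev (i, j) $ Inl i = ev (i', j') $ Inl i" "ev (i, j) $ Inr j = ev (i', j') $ Inr j"
      using that unfolding e by simp_all
    hence "i = i'" "j = j'" unfolding ev_Inl ev_Inr by (metis zero_neq_one)+
    thus ?thesis by (simp add: e)
  qed
  have inj1: "inj_on (ev1 D) (has1 D)"
    by (rule inj_onI) (unfold ev1_def, drule evinj, simp)
  have inj2: "inj_on (ev2 D) (has2 D)"
    by (rule inj_onI) (unfold ev2_def, drule evinj, simp)
  have "x \<notin> ev2 D ` has2 D" if x: "x \<in> ev1 D ` has1 D" for x
  proof
    assume "x \<in> ev2 D ` has2 D"
    then obtain j j' where "x = ev (pred1 D j, j)" "x = ev (pred2 D j', j')" "j' \<in> has2 D"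
      using x unfolding ev1_def ev2_def by blast
    hence "(pred1 D j, j) = (pred2 D j', j')" using evinj by metis
    thus False using pred2(2)[OF \<open>j' \<in> has2 D\<close>] by auto
  qed
  hence disj: "ev1 D ` has1 D \<inter> ev2 D ` has2 D = {}" by blast
  have "card ?B = rank D"
    unfolding rank_def by (subst card_Un_disjoint[OF _ _ disj]) (simp_all add: card_image inj1 inj2)
  moreover have "independent ?B"
  proof (rule independent_if_scalars_zero)
    fix f x assume s: "(\<Sum>x\<in>?B. f x *\<^sub>R x) = 0" and x: "x \<in> ?B"
    have "(\<Sum>x\<in>?B. f x *\<^sub>R x) = comb D (f \<circ> ev1 D) (f \<circ> ev2 D)"
      unfolding comb_def
      by (subst sum.union_disjoint[OF _ _ disj]) (simp_all add: sum.reindex inj1 inj2)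
    hence z: "comb D (f \<circ> ev1 D) (f \<circ> ev2 D) = 0" using s by simp
    have "(f \<circ> ev1 D) j = 0 \<and> (j \<in> has2 D \<longrightarrow> (f \<circ> ev2 D) j = 0)" if "j \<in> has1 D" for j
      by (rule comb_eq_0[OF D _ _ that]) (simp_all only: z zero_index)
    thus "f x = 0" using x pred2(4)[of D] by auto
  qed simp
  moreover have "span ?B = span (ev ` D)"
  proof
    show "span (ev ` D) \<subseteq> span ?B" by (intro span_minimal subspace_span) (use ev_in_span[OF D] in auto)
    have "?B \<subseteq> ev ` D" using pred1(1)[of _ D] pred2(1)[of _ D] by (auto simp: ev1_def ev2_def)
    thus "span ?B \<subseteq> span (ev ` D)" by (rule span_mono)
  qed
  ultimately show ?thesis using dim_eq_card by metis
qed

section \<open>Counting exponents\<close>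

definition pivots :: "('n::{finite,linorder} \<times> 'n) set \<Rightarrow> ('n + 'n) set" where
  "pivots D = Inl ` pred1 D ` has1 D \<union> Inr ` has2 D"

lemma card_pivots: "closed_edges D \<Longrightarrow> card (pivots D) = rank D"
proof -
  assume D: "closed_edges D"
  have "Inl ` pred1 D ` has1 D \<inter> Inr ` has2 D = {}" by blast
  thus ?thesis unfolding pivots_def rank_def
    by (subst card_Un_disjoint) (simp_all add: card_image inj_pred1[OF D])
qed

definition vsums :: "('n \<times> 'n) set \<Rightarrow> nat \<Rightarrow> ('n + 'n) expo set" where
  "vsums D K = {vsum M | M. set_mset M \<subseteq> D \<and> size M \<le> K}"

lemma lookup_vsum_le: "lookup (vsum M) v \<le> size M"
proof (induct M)
  case (add e M)
  have "lookup (vexp e) v \<le> 1" by (auto simp: vexp_def lookup_add)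
  thus ?case using add by (simp add: lookup_add)
qed simp

lemma evec_vsum_in_span: "set_mset M \<subseteq> D \<Longrightarrow> evec (vsum M) \<in> span (ev ` D)"
proof (induct M)
  case empty
  have "evec (vsum {#}) = (0 :: real ^ ('a + 'a))" by (simp add: evec_def vec_eq_iff)
  thus ?case by (simp add: span_zero)
next
  case (add e M)
  thus ?case by (simp add: evec_add span_add span_base)
qed

lemma card_vsums:
  fixes D :: "('n::{finite,linorder} \<times> 'n) set"
  assumes D: "closed_edges D"
  shows "finite (vsums D K)" "card (vsums D K) \<le> (K + 1) ^ rank D"
proof -
  let ?g = "\<lambda>a. restrict (lookup a) (pivots D)"
  have inj: "inj_on ?g (vsums D K)"
  proof (rule inj_onI)
    fix a a' assume a: "a \<in> vsums D K" "a' \<in> vsums D K" and eq: "?g a = ?g a'"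
    have eq': "lookup a v = lookup a' v" if "v \<in> pivots D" for v
      using fun_cong[OF eq, of v] that by simp
    have "evec a - evec a' = 0"
    proof (rule span_zero_on_pivots[OF D])
      show "evec a - evec a' \<in> span (ev ` D)"
        using a evec_vsum_in_span unfolding vsums_def by (intro span_diff) blast+
    qed (use eq' in \<open>auto simp: evec_def pivots_def\<close>)
    hence "evec a = evec a'" by simp
    thus "a = a'" by (intro poly_mapping_eqI) (simp add: evec_def vec_eq_iff)
  qed
  have sub: "?g ` vsums D K \<subseteq> PiE (pivots D) (\<lambda>_. {..K})"
  proof (intro image_subsetI restrict_PiE_iff[THEN iffD2] ballI)
    fix a v assume "a \<in> vsums D K"
    then obtain M where "a = vsum M" "size M \<le> K" unfolding vsums_def by blast
    thus "lookup a v \<in> {..K}" using lookup_vsum_le[of M v] by simp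
  qed
  have fin: "finite (PiE (pivots D) (\<lambda>_. {..K}))" by (intro finite_PiE) simp_all
  show "finite (vsums D K)" using finite_subset[OF sub fin] inj by (rule finite_imageD)
  have "card (vsums D K) \<le> card (PiE (pivots D) (\<lambda>_. {..K}))"
    using card_mono[OF fin sub] by (simp add: card_image[OF inj])
  also have "\<dots> = (K + 1) ^ rank D" by (simp add: card_PiE card_pivots[OF D])
  finally show "card (vsums D K) \<le> (K + 1) ^ rank D" .
qed

section \<open>The fiber algebra\<close>

text \<open>
  The algebra \<open>K[f\<^sub>e | e \<in> D]\<close> as a subset of the polynomial ring.
\<close>

definition fiber :: "('n \<times> 'n) set \<Rightarrow> ('n, 'k::field) xypoly set" where
  "fiber D = kvs.span {fprod M | M. set_mset M \<subseteq> D}"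

definition fiber_upto :: "('n \<times> 'n) set \<Rightarrow> nat \<Rightarrow> ('n, 'k::field) xypoly set" where
  "fiber_upto D K = kvs.span {fprod M | M. set_mset M \<subseteq> D \<and> size M \<le> K}"

lemma fiber_upto_mult:
  assumes "p \<in> fiber_upto D K" "q \<in> fiber_upto D L"
  shows "p * q \<in> fiber_upto D (K + L)"
proof -
  let ?G = "\<lambda>K. {fprod M | M. set_mset M \<subseteq> D \<and> size M \<le> K}"
  have "p * q \<in> kvs.span {a * b | a b. a \<in> ?G K \<and> b \<in> ?G L}"
    using assms unfolding fiber_upto_def by (rule span_mult)
  moreover have "{a * b | a b. a \<in> ?G K \<and> b \<in> ?G L} \<subseteq> ?G (K + L)"
  proof safe
    fix M N assume *: "set_mset M \<subseteq> D" "size M \<le> K" "set_mset N \<subseteq> D" "size N \<le> L"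
    show "\<exists>M'. fprod M * fprod N = fprod M' \<and> set_mset M' \<subseteq> D \<and> size M' \<le> K + L"
      by (rule exI[of _ "M + N"]) (use * in \<open>auto simp: fprod_union\<close>)
  qed
  ultimately show ?thesis unfolding fiber_upto_def using kvs.span_mono by blast
qed

lemma fiber_upto_mono: "K \<le> L \<Longrightarrow> fiber_upto D K \<subseteq> fiber_upto D L"
  unfolding fiber_upto_def by (intro kvs.span_mono) auto

lemma fiber_upto_1: "1 \<in> fiber_upto D K"
  unfolding fiber_upto_def by (intro kvs.span_base) (auto intro!: exI[of _ "{#}"])

lemma fiber_upto_power: "p \<in> fiber_upto D K \<Longrightarrow> p ^ n \<in> fiber_upto D (K * n)"
proof (induct n)
  case (Suc n)
  thus ?case using fiber_upto_mult[of p D K "p ^ n" "K * n"] by simp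
qed (simp add: fiber_upto_1)

lemma fiber_upto_prod:
  assumes "finite I" "\<And>i. i \<in> I \<Longrightarrow> g i \<in> fiber_upto D (h i)"
  shows "(\<Prod>i\<in>I. g i) \<in> fiber_upto D (\<Sum>i\<in>I. h i)"
  using assms
proof (induct I)
  case (insert i I)
  thus ?case using fiber_upto_mult[of "g i" D "h i"] by simp
qed (simp add: fiber_upto_1)

lemma fiber_in_upto:
  fixes p :: "('n, 'k::field) xypoly"
  assumes "p \<in> fiber D"
  shows "\<exists>K. p \<in> fiber_upto D K"
proof (rule kvs.span_induct[OF assms[unfolded fiber_def], of "\<lambda>p. \<exists>K. p \<in> fiber_upto D K"])
  show "kvs.subspace {p :: ('n, 'k) xypoly. \<exists>K. p \<in> fiber_upto D K}"
  proof (rule kvs.subspaceI, goal_cases)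
    case 1
    show ?case by (simp add: fiber_upto_def kvs.span_zero)
  next
    case (2 x y)
    then obtain K L where KL: "x \<in> fiber_upto D K" "y \<in> fiber_upto D L" by blast
    have "x \<in> fiber_upto D (max K L)" "y \<in> fiber_upto D (max K L)"
      using KL fiber_upto_mono[of K "max K L" D] fiber_upto_mono[of L "max K L" D] by auto
    hence "x + y \<in> fiber_upto D (max K L)" unfolding fiber_upto_def by (rule kvs.span_add)
    thus ?case by blast
  next
    case (3 c x)
    then obtain K where "x \<in> fiber_upto D K" by blast
    hence "cmul c x \<in> fiber_upto D K" unfolding fiber_upto_def by (rule kvs.span_scale)
    thus ?case by blast
  qed
  fix x :: "('n, 'k) xypoly" assume "x \<in> {fprod M | M. set_mset M \<subseteq> D}"
  then obtain M where "x = fprod M" "set_mset M \<subseteq> D" by blast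
  thus "\<exists>K. x \<in> fiber_upto D K"
    unfolding fiber_upto_def by (intro exI[of _ "size M"] kvs.span_base) blast
qed

text \<open>
  By straightening, one product for each leading exponent suffices, and the leading exponents are
  determined by \<open>rank D\<close> coordinates between 0 and \<open>K\<close>.
\<close>

lemma fiber_upto_span_finite:
  fixes D :: "('n::{finite,linorder} \<times> 'n) set"
  assumes D: "closed_edges D"
  obtains R :: "('n, 'k::field) xypoly set"
    where "finite R" "card R \<le> (K + 1) ^ rank D" "fiber_upto D K \<subseteq> kvs.span R"
proof
  let ?R = "(\<lambda>a. rep D (expo_deg a div 2) a :: ('n, 'k) xypoly) ` vsums D K"
  show "finite ?R" using card_vsums(1)[OF D] by (rule finite_imageI)
  show "card ?R \<le> (K + 1) ^ rank D"
    using card_image_le[OF card_vsums(1)[OF D, of K]] card_vsums(2)[OF D, of K] by (rule le_trans)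
  show "fiber_upto D K \<subseteq> kvs.span ?R"
    unfolding fiber_upto_def
  proof (intro kvs.span_minimal kvs.subspace_span subsetI)
    fix x :: "('n, 'k) xypoly" assume "x \<in> {fprod M | M. set_mset M \<subseteq> D \<and> size M \<le> K}"
    then obtain M where M: "x = fprod M" "set_mset M \<subseteq> D" "size M \<le> K" by blast
    have "x \<in> kvs.span (rep D (size M) ` {b \<in> points D (size M). expo_deg b = 2 * size M})"
      using term_in_span_rep[OF D M(2) refl, of 0 "2 * size M", where 'k = 'k] by (simp add: M(1))
    moreover have "rep D (size M) ` {b \<in> points D (size M). expo_deg b = 2 * size M} \<subseteq> ?R"
    proof (intro image_subsetI, elim CollectE conjE)
      fix b assume b: "b \<in> points D (size M)" "expo_deg b = 2 * size M"
      then obtain m N where N: "b = m + vsum N" "set_mset N \<subseteq> D" "size N = size M"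
        unfolding points_def by blast
      hence "expo_deg m = 0" using b(2) by simp
      hence "b = vsum N" using N(1) by simp
      hence "b \<in> vsums D K" using N M(3) unfolding vsums_def by auto
      moreover have "rep D (size M) b = rep D (expo_deg b div 2) b" using b(2) by simp
      ultimately show "rep D (size M) b \<in> ?R" by blast
    qed
    ultimately show "x \<in> kvs.span ?R" using kvs.span_mono by blast
  qed
qed

lemma nontrivial_relation:
  fixes f :: "'i \<Rightarrow> ('v, 'k::field) mpolynomial"
  assumes fin: "finite I" "finite R" and sub: "f ` I \<subseteq> kvs.span R" and card: "card R < card I"
  obtains c where "\<exists>i\<in>I. c i \<noteq> 0" "(\<Sum>i\<in>I. cmul (c i) (f i)) = 0"
proof (cases "inj_on f I")
  case True
  have "kvs.dependent (f ` I)"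
  proof (rule ccontr)
    assume "\<not> kvs.dependent (f ` I)"
    from kvs.independent_span_bound[OF fin(2) this sub] show False
      using card card_image[OF True] by simp
  qed
  then obtain u where u: "\<exists>v\<in>f ` I. u v \<noteq> 0" "(\<Sum>v\<in>f ` I. cmul (u v) v) = 0"
    using kvs.dependent_finite[of "f ` I"] fin(1) by blast
  show ?thesis
    by (rule that[of "u \<circ> f"]) (use u True in \<open>auto simp: sum.reindex\<close>)
next
  case False
  then obtain x y where xy: "x \<in> I" "y \<in> I" "f x = f y" "x \<noteq> y" unfolding inj_on_def by blast
  define c :: "'i \<Rightarrow> 'k" where "c i = (if i = x then 1 else if i = y then - 1 else 0)" for i
  have "(\<Sum>i\<in>I. cmul (c i) (f i)) = (\<Sum>i\<in>{x, y}. cmul (c i) (f i))"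
    using fin(1) xy by (intro sum.mono_neutral_right) (auto simp: c_def)
  also have "\<dots> = 0" using xy by (simp add: c_def kvs.scale_minus_left)
  finally have "(\<Sum>i\<in>I. cmul (c i) (f i)) = 0" .
  moreover have "\<exists>i\<in>I. c i \<noteq> 0" using xy(1) by (intro bexI[of _ x]) (simp_all add: c_def)
  ultimately show ?thesis using that by blast
qed

text \<open>
  More than \<open>rank D\<close> elements of the algebra are algebraically dependent, because the number of their
  monomials with exponents below \<open>N\<close> grows as \<open>N ^ (rank D + 1)\<close>, faster than the dimension of the
  space in which they lie. The monomials of the relation are indexed by functions that differ on
  \<open>{0..rank D}\<close>.
\<close>

lemma algebraic_relation:
  fixes z :: "nat \<Rightarrow> ('n::{finite,linorder}, 'k::field) xypoly"
  assumes D: "closed_edges D" and z: "\<And>i. i \<le> rank D \<Longrightarrow> z i \<in> fiber D"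
  obtains \<Lambda> and c :: "(nat \<Rightarrow> nat) \<Rightarrow> 'k" where "finite \<Lambda>" "\<Lambda> \<noteq> {}" "\<And>f. f \<in> \<Lambda> \<Longrightarrow> c f \<noteq> 0"
    "\<And>f g. f \<in> \<Lambda> \<Longrightarrow> g \<in> \<Lambda> \<Longrightarrow> (\<And>j. j \<in> {0..rank D} \<Longrightarrow> f j = g j) \<Longrightarrow> f = g"
    "(\<Sum>f\<in>\<Lambda>. cmul (c f) (\<Prod>j=0..rank D. z j ^ f j)) = 0"
proof -
  define r where "r = rank D"
  have "\<forall>i\<in>{0..r}. \<exists>K. z i \<in> fiber_upto D K"
    using z fiber_in_upto unfolding r_def by (metis atLeastAtMost_iff)
  then obtain k where k: "\<And>i. i \<in> {0..r} \<Longrightarrow> z i \<in> fiber_upto D (k i)" by metis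
  define K where "K = (\<Sum>i=0..r. k i)"
  have zK: "z i \<in> fiber_upto D K" if "i \<in> {0..r}" for i
  proof -
    have "k i \<le> K" unfolding K_def using that by (intro member_le_sum) simp_all
    thus ?thesis using k[OF that] fiber_upto_mono by blast
  qed
  \<comment> \<open>with these \<open>C\<close> and \<open>N\<close> one has \<open>(K (r + 1) N + 1)\<^sup>r \<le> C\<^sup>r N\<^sup>r < N\<^sup>r\<^sup>+\<^sup>1\<close>, so there are more monomials than dimensions\<close>
  define C where "C = K * (r + 1) + 1"
  define N where "N = C ^ r + 1"
  define I where "I = PiE {0..r} (\<lambda>_. {..<N})"
  define f where "f = (\<lambda>e :: nat \<Rightarrow> nat. \<Prod>j=0..r. z j ^ e j)"
  obtain R :: "('n, 'k) xypoly set" where R: "finite R" 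
    "card R \<le> (K * (r + 1) * N + 1) ^ r" "fiber_upto D (K * (r + 1) * N) \<subseteq> kvs.span R"
    using fiber_upto_span_finite[OF D, of "K * (r + 1) * N", where 'k = 'k] unfolding r_def by blast
  have finI: "finite I" unfolding I_def by (intro finite_PiE) simp_all
  have "f e \<in> kvs.span R" if e: "e \<in> I" for e
  proof -
    have "f e \<in> fiber_upto D (\<Sum>j=0..r. K * e j)"
      unfolding f_def using zK by (intro fiber_upto_prod fiber_upto_power) simp_all
    moreover have "(\<Sum>j=0..r. K * e j) \<le> (\<Sum>j=0..r. K * N)"
      using e unfolding I_def by (intro sum_mono mult_le_mono2) (force simp: PiE_iff)
    hence "(\<Sum>j=0..r. K * e j) \<le> K * (r + 1) * N" by (simp add: algebra_simps)
    ultimately show ?thesis using fiber_upto_mono R(3) by blast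
  qed
  hence sub: "f ` I \<subseteq> kvs.span R" by blast
  have "K * (r + 1) * N + 1 \<le> C * N"
    unfolding C_def by (simp add: N_def add_mult_distrib)
  hence "card R \<le> (C * N) ^ r" using R(2) by (meson le_trans power_mono zero_le)
  also have "\<dots> = C ^ r * N ^ r" by (rule power_mult_distrib)
  also have "\<dots> < N * N ^ r" unfolding N_def by simp
  also have "\<dots> = card I" by (simp add: I_def card_PiE)
  finally have card: "card R < card I" .
  obtain c where c: "\<exists>e\<in>I. c e \<noteq> 0" "(\<Sum>e\<in>I. cmul (c e) (f e)) = 0"
    using nontrivial_relation[OF finI R(1) sub card] .
  define \<Lambda> where "\<Lambda> = {e\<in>I. c e \<noteq> 0}"
  have "(\<Sum>e\<in>\<Lambda>. cmul (c e) (f e)) = (\<Sum>e\<in>I. cmul (c e) (f e))"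
    unfolding \<Lambda>_def using finI by (intro sum.mono_neutral_left) auto
  hence s: "(\<Sum>e\<in>\<Lambda>. cmul (c e) (f e)) = 0" using c(2) by simp
  have ext: "e = e'" if "e \<in> \<Lambda>" "e' \<in> \<Lambda>" "\<And>j. j \<in> {0..r} \<Longrightarrow> e j = e' j" for e e'
  proof -
    have "e \<in> PiE {0..r} (\<lambda>_. {..<N})" "e' \<in> PiE {0..r} (\<lambda>_. {..<N})"
      using that(1,2) unfolding \<Lambda>_def I_def by simp_all
    thus ?thesis by (rule PiE_ext) (rule that(3))
  qed
  show ?thesis
    by (rule that[of \<Lambda> c]) (use finI c(1) s ext in \<open>auto simp: \<Lambda>_def f_def r_def\<close>)
qed

section \<open>Chains of prime ideals in the fiber algebra\<close>

text \<open>
  Prime ideals of a subring \<open>A\<close> of a commutative ring, in terms of the operations of the ambient ring.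
\<close>

definition prime_in :: "'a::comm_ring_1 set \<Rightarrow> 'a set \<Rightarrow> bool" where
  "prime_in A P \<longleftrightarrow> P \<subseteq> A \<and> 0 \<in> P \<and> (\<forall>x\<in>P. \<forall>y\<in>P. x + y \<in> P) \<and> (\<forall>a\<in>A. \<forall>x\<in>P. a * x \<in> P) \<and>
     1 \<notin> P \<and> (\<forall>a\<in>A. \<forall>b\<in>A. a * b \<in> P \<longrightarrow> a \<in> P \<or> b \<in> P)"

lemma prime_inD:
  assumes "prime_in A P"
  shows "P \<subseteq> A" "0 \<in> P" "x \<in> P \<Longrightarrow> y \<in> P \<Longrightarrow> x + y \<in> P" "a \<in> A \<Longrightarrow> x \<in> P \<Longrightarrow> a * x \<in> P"
    "1 \<notin> P" "a \<in> A \<Longrightarrow> b \<in> A \<Longrightarrow> a * b \<in> P \<Longrightarrow> a \<in> P \<or> b \<in> P"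
  using assms unfolding prime_in_def by blast+

lemma fiber_closed:
  shows fiber_1: "1 \<in> fiber D" and fiber_add: "p \<in> fiber D \<Longrightarrow> q \<in> fiber D \<Longrightarrow> p + q \<in> fiber D"
    and fiber_mult: "p \<in> fiber D \<Longrightarrow> q \<in> fiber D \<Longrightarrow> p * q \<in> fiber D"
    and fiber_cmul: "p \<in> fiber D \<Longrightarrow> cmul c p \<in> fiber D"
    and fiber_0: "0 \<in> fiber D"
    and fiber_ebin: "e \<in> D \<Longrightarrow> ebin e \<in> fiber D"
proof -
  show "1 \<in> fiber D" unfolding fiber_def
    by (intro kvs.span_base) (auto intro!: exI[of _ "{#}"])
  show "e \<in> D \<Longrightarrow> ebin e \<in> fiber D" unfolding fiber_def
    by (intro kvs.span_base) (auto intro!: exI[of _ "{#e#}"])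
  show "p \<in> fiber D \<Longrightarrow> q \<in> fiber D \<Longrightarrow> p + q \<in> fiber D"
    and "p \<in> fiber D \<Longrightarrow> cmul c p \<in> fiber D" and "0 \<in> fiber D" unfolding fiber_def
    by (auto intro: kvs.span_add kvs.span_scale kvs.span_zero)
  assume "p \<in> fiber D" "q \<in> fiber D"
  then obtain K L where "p \<in> fiber_upto D K" "q \<in> fiber_upto D L" using fiber_in_upto by metis
  hence "p * q \<in> fiber_upto D (K + L)" by (rule fiber_upto_mult)
  thus "p * q \<in> fiber D" unfolding fiber_upto_def fiber_def
    by (rule subsetD[OF kvs.span_mono, rotated]) blast
qed

lemma fiber_power: "p \<in> fiber D \<Longrightarrow> p ^ n \<in> fiber D"
  by (induct n) (auto intro: fiber_1 fiber_mult)

lemma fiber_prod: "(\<And>i. i \<in> I \<Longrightarrow> g i \<in> fiber D) \<Longrightarrow> (\<Prod>i\<in>I. g i) \<in> fiber D"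
  by (induct I rule: infinite_finite_induct) (auto intro: fiber_1 fiber_mult)

lemma fiber_sum: "(\<And>i. i \<in> I \<Longrightarrow> g i \<in> fiber D) \<Longrightarrow> (\<Sum>i\<in>I. g i) \<in> fiber D"
  by (induct I rule: infinite_finite_induct) (auto intro: fiber_0 fiber_add)

lemma prime_in_sum:
  assumes "prime_in A P" "\<And>i. i \<in> I \<Longrightarrow> g i \<in> P"
  shows "(\<Sum>i\<in>I. g i) \<in> P"
  using assms(2) by (induct I rule: infinite_finite_induct) (auto intro: prime_inD(2,3)[OF assms(1)])

text \<open>
  From a relation lying in \<open>P i\<close>, the smallest power of \<open>z i\<close> can be divided off because \<open>z i\<close> is not in
  the prime \<open>P i\<close>. What remains is in \<open>P (Suc i)\<close>, where all terms that still contain \<open>z i\<close> can be dropped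
  because \<open>z i\<close> is in \<open>P (Suc i)\<close>. This is a relation between the later elements only; at the end of the
  chain it is a nonzero constant.
\<close>

lemma no_relation_along_chain:
  fixes z :: "nat \<Rightarrow> ('n, 'k::field) xypoly"
  assumes P: "\<And>i. i \<le> Suc r \<Longrightarrow> prime_in (fiber D) (P i)" "\<And>i. i \<le> r \<Longrightarrow> P i \<subseteq> P (Suc i)"
    and z: "\<And>i. i \<le> r \<Longrightarrow> z i \<in> P (Suc i)" "\<And>i. i \<le> r \<Longrightarrow> z i \<notin> P i"
  shows "i \<le> Suc r \<Longrightarrow> finite \<Lambda> \<Longrightarrow> \<Lambda> \<noteq> {} \<Longrightarrow> (\<And>f. f \<in> \<Lambda> \<Longrightarrow> c f \<noteq> 0) \<Longrightarrow>
    (\<And>f g. f \<in> \<Lambda> \<Longrightarrow> g \<in> \<Lambda> \<Longrightarrow> (\<And>j. j \<in> {i..r} \<Longrightarrow> f j = g j) \<Longrightarrow> f = g) \<Longrightarrow>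
    (\<Sum>f\<in>\<Lambda>. cmul (c f) (\<Prod>j=i..r. z j ^ f j)) \<notin> P i"
proof (induct "Suc r - i" arbitrary: i \<Lambda>)
  case 0
  hence i: "i = Suc r" by simp
  obtain f where f: "f \<in> \<Lambda>" using 0(4) by blast
  have "\<Lambda> = {f}" using f 0(6) i by auto
  hence eq: "(\<Sum>f\<in>\<Lambda>. cmul (c f) (\<Prod>j=i..r. z j ^ f j)) = cmul (c f) 1" using i by simp
  note pr = P(1)[OF 0(2)]
  show ?case
  proof
    assume "(\<Sum>f\<in>\<Lambda>. cmul (c f) (\<Prod>j=i..r. z j ^ f j)) \<in> P i"
    hence "cmul (inverse (c f)) 1 * cmul (c f) 1 \<in> P i"
      unfolding eq by (intro prime_inD(4)[OF pr] fiber_cmul fiber_1)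
    moreover have "cmul (inverse (c f)) 1 * cmul (c f) 1 = (1 :: ('n, 'k) xypoly)"
      using 0(5)[OF f] by (simp add: cmul_mult_left cmul_mult_right)
    ultimately show False using prime_inD(5)[OF pr] by simp
  qed
next
  case (Suc k)
  hence ir: "i \<le> r" by simp
  note pr = P(1)[OF Suc(3)]
  have zA: "z j \<in> fiber D" if "j \<le> r" for j
    using z(1)[OF that] prime_inD(1)[OF P(1)[of "Suc j"]] that by auto
  define m where "m = Min ((\<lambda>f. f i) ` \<Lambda>)"
  have m_le: "m \<le> f i" if "f \<in> \<Lambda>" for f unfolding m_def using Suc(4) that by (intro Min_le) auto
  have "m \<in> (\<lambda>f. f i) ` \<Lambda>" unfolding m_def using Suc(4,5) by (intro Min_in) auto
  then obtain f0 where f0: "f0 \<in> \<Lambda>" "f0 i = m" by blast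
  define g where "g = (\<lambda>f :: nat \<Rightarrow> nat. \<Prod>j=Suc i..r. z j ^ f j)"
  have gA: "g f \<in> fiber D" for f unfolding g_def using zA by (intro fiber_prod fiber_power) simp
  define S where "S = (\<Sum>f\<in>\<Lambda>. cmul (c f) (z i ^ (f i - m) * g f))"
  have SA: "S \<in> fiber D" unfolding S_def using zA[OF ir] gA
    by (intro fiber_sum fiber_cmul fiber_mult fiber_power)
  have "(\<Sum>f\<in>\<Lambda>. cmul (c f) (\<Prod>j=i..r. z j ^ f j)) = z i ^ m * S"
    unfolding S_def sum_distrib_left
  proof (intro sum.cong refl)
    fix f assume f: "f \<in> \<Lambda>"
    have "(\<Prod>j=i..r. z j ^ f j) = z i ^ f i * g f"
      unfolding g_def using ir by (rule prod.atLeast_Suc_atMost)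
    also have "z i ^ f i = z i ^ m * z i ^ (f i - m)"
      using m_le[OF f] by (simp flip: power_add)
    finally show "cmul (c f) (\<Prod>j=i..r. z j ^ f j) = z i ^ m * cmul (c f) (z i ^ (f i - m) * g f)"
      by (simp add: cmul_mult_right mult.assoc)
  qed
  moreover have "z i ^ n \<notin> P i" for n
  proof (induct n)
    case 0
    thus ?case using prime_inD(5)[OF pr] by simp
  next
    case (Suc n)
    thus ?case using prime_inD(6)[OF pr zA[OF ir] fiber_power[OF zA[OF ir]], of n] z(2)[OF ir] by auto
  qed
  moreover have "S \<notin> P i"
  proof
    assume "S \<in> P i"
    hence S: "S \<in> P (Suc i)" using P(2)[OF ir] by blast
    have pr': "prime_in (fiber D) (P (Suc i))" using P(1)[of "Suc i"] ir by simp
    define \<Lambda>0 where "\<Lambda>0 = {f\<in>\<Lambda>. f i = m}"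
    have fin: "finite \<Lambda>0" "\<Lambda>0 \<subseteq> \<Lambda>" using Suc(4) by (auto simp: \<Lambda>0_def)
    define S0 where "S0 = (\<Sum>f\<in>\<Lambda>0. cmul (c f) (g f))"
    define S1 where "S1 = (\<Sum>f\<in>\<Lambda> - \<Lambda>0. cmul (c f) (z i ^ (f i - m) * g f))"
    have "S = S1 + (\<Sum>f\<in>\<Lambda>0. cmul (c f) (z i ^ (f i - m) * g f))"
      unfolding S_def S1_def by (rule sum.subset_diff[OF fin(2) Suc(4)])
    also have "(\<Sum>f\<in>\<Lambda>0. cmul (c f) (z i ^ (f i - m) * g f)) = S0"
      unfolding S0_def by (intro sum.cong) (auto simp: \<Lambda>0_def)
    finally have SS: "S = S1 + S0" .
    have S1: "S1 \<in> P (Suc i)" unfolding S1_def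
    proof (rule prime_in_sum[OF pr'])
      fix f assume f: "f \<in> \<Lambda> - \<Lambda>0"
      hence "f i > m" using m_le[of f] by (auto simp: \<Lambda>0_def)
      then obtain n where n: "f i - m = Suc n" using gr0_implies_Suc[of "f i - m"] by auto
      have "cmul (c f) (z i ^ n * g f) * z i \<in> P (Suc i)"
        by (intro prime_inD(4)[OF pr'] fiber_cmul fiber_mult fiber_power zA[OF ir] gA z(1)[OF ir])
      moreover have "cmul (c f) (z i ^ n * g f) * z i = cmul (c f) (z i ^ (f i - m) * g f)"
        unfolding cmul_mult_left n power_Suc by (simp only: mult_ac)
      ultimately show "cmul (c f) (z i ^ (f i - m) * g f) \<in> P (Suc i)" by (simp only:)
    qed
    have "cmul (- 1) 1 * S1 \<in> P (Suc i)" by (intro prime_inD(4)[OF pr'] fiber_cmul fiber_1 S1)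
    moreover have "cmul (- 1) 1 * S1 = - S1" by (simp add: cmul_mult_left)
    ultimately have "- S1 \<in> P (Suc i)" by (simp only:)
    from prime_inD(3)[OF pr' S this] have S0: "S0 \<in> P (Suc i)" by (simp add: SS)
    have "(\<Sum>f\<in>\<Lambda>0. cmul (c f) (\<Prod>j=Suc i..r. z j ^ f j)) \<notin> P (Suc i)"
    proof (rule Suc(1))
      show "k = Suc r - Suc i" using Suc(2) by simp
      show "Suc i \<le> Suc r" using ir by simp
      show "finite \<Lambda>0" by (rule fin)
      show "\<Lambda>0 \<noteq> {}" using f0 by (auto simp: \<Lambda>0_def)
      show "c f \<noteq> 0" if "f \<in> \<Lambda>0" for f using Suc(6) that fin by blast
      show "f = g" if fg: "f \<in> \<Lambda>0" "g \<in> \<Lambda>0" "\<And>j. j \<in> {Suc i..r} \<Longrightarrow> f j = g j" for f g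
      proof (rule Suc(7))
        show "f \<in> \<Lambda>" "g \<in> \<Lambda>" using fg fin by blast+
        fix j assume "j \<in> {i..r}"
        hence "j = i \<or> j \<in> {Suc i..r}" by auto
        thus "f j = g j" using fg by (auto simp: \<Lambda>0_def)
      qed
    qed
    thus False using S0 unfolding S0_def g_def by blast
  qed
  ultimately show ?case using prime_inD(6)[OF pr fiber_power[OF zA[OF ir]] SA] by metis
qed

theorem chain_length_le_rank:
  fixes P :: "nat \<Rightarrow> ('n::{finite,linorder}, 'k::field) xypoly set"
  assumes D: "closed_edges D"
    and P: "\<And>i. i \<le> d \<Longrightarrow> prime_in (fiber D) (P i)" "\<And>i. i < d \<Longrightarrow> P i \<subset> P (Suc i)"
  shows "d \<le> rank D"
proof (rule ccontr)
  assume "\<not> d \<le> rank D"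
  hence d: "Suc (rank D) \<le> d" by simp
  have "\<forall>i\<in>{0..rank D}. \<exists>x. x \<in> P (Suc i) \<and> x \<notin> P i"
  proof
    fix i assume "i \<in> {0..rank D}"
    hence "P i \<subset> P (Suc i)" using d by (intro P(2)) simp
    thus "\<exists>x. x \<in> P (Suc i) \<and> x \<notin> P i" by blast
  qed
  from bchoice[OF this] obtain z where z: "\<forall>i\<in>{0..rank D}. z i \<in> P (Suc i) \<and> z i \<notin> P i" ..
  have z1: "z i \<in> P (Suc i)" "z i \<notin> P i" if "i \<le> rank D" for i using z that by simp_all
  have zA: "z i \<in> fiber D" if "i \<le> rank D" for i
  proof -
    have "Suc i \<le> d" using that d by simp
    from prime_inD(1)[OF P(1)[OF this]] z1(1)[OF that] show ?thesis by (rule subsetD)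
  qed
  show False
  proof (rule algebraic_relation[OF D, of z])
    show "z i \<in> fiber D" if "i \<le> rank D" for i using that by (rule zA)
    fix \<Lambda> and c :: "(nat \<Rightarrow> nat) \<Rightarrow> 'k"
    assume L: "finite \<Lambda>" "\<Lambda> \<noteq> {}" "\<And>f. f \<in> \<Lambda> \<Longrightarrow> c f \<noteq> 0"
      "\<And>f g. f \<in> \<Lambda> \<Longrightarrow> g \<in> \<Lambda> \<Longrightarrow> (\<And>j. j \<in> {0..rank D} \<Longrightarrow> f j = g j) \<Longrightarrow> f = g"
      "(\<Sum>f\<in>\<Lambda>. cmul (c f) (\<Prod>j=0..rank D. z j ^ f j)) = 0"
    have "(\<Sum>f\<in>\<Lambda>. cmul (c f) (\<Prod>j=0..rank D. z j ^ f j)) \<notin> P 0"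
    proof (rule no_relation_along_chain[where r = "rank D" and D = D])
      show "prime_in (fiber D) (P i)" if "i \<le> Suc (rank D)" for i using that d by (intro P(1)) simp
      show "P i \<subseteq> P (Suc i)" if "i \<le> rank D" for i
        by (rule psubset_imp_subset, rule P(2)) (use that d in simp)
      show "z i \<in> P (Suc i)" "z i \<notin> P i" if "i \<le> rank D" for i using z1[OF that] by blast+
      show "f = g" if "f \<in> \<Lambda>" "g \<in> \<Lambda>" "\<And>j. j \<in> {0..rank D} \<Longrightarrow> f j = g j" for f g
        using that by (rule L(4))
    qed (use L(1-3) in simp_all)
    thus False using prime_inD(2)[OF P(1)[of 0]] unfolding L(5) by simp
  qed
qed

text \<open>
  The elements that become zero when the variables in \<open>W\<close> are set to zero.
\<close>

definition vanishing :: "('n \<times> 'n) set \<Rightarrow> ('n + 'n) set \<Rightarrow> ('n, 'k::field) xypoly set" where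
  "vanishing D W = {p \<in> fiber D. \<forall>b\<in>keys p. \<exists>v\<in>W. lookup b v \<noteq> 0}"

lemma prime_vanishing: "prime_in (fiber D) (vanishing D W :: ('n::{finite,linorder}, 'k::field) xypoly set)"
proof -
  let ?V = "vanishing D W :: ('n, 'k) xypoly set"
  have 0: "0 \<in> ?V" by (simp add: vanishing_def fiber_0)
  have 1: "1 \<notin> ?V" by (auto simp: vanishing_def)
  have add: "x + y \<in> ?V" if "x \<in> ?V" "y \<in> ?V" for x y
    using that keys_add[of x y] fiber_add[of x D y] unfolding vanishing_def by blast
  have mult: "a * x \<in> ?V" if "a \<in> fiber D" "x \<in> ?V" for a x
  proof -
    have "\<exists>v\<in>W. lookup b v \<noteq> 0" if b: "b \<in> keys (a * x)" for b
    proof -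
      obtain c d where cd: "b = c + d" "d \<in> keys x" using keys_mult[of a x] b by blast
      then obtain v where "v \<in> W" "lookup d v \<noteq> 0" using \<open>x \<in> ?V\<close> unfolding vanishing_def by blast
      thus ?thesis by (intro bexI[of _ v]) (simp_all add: cd(1) lookup_add)
    qed
    thus ?thesis using that fiber_mult unfolding vanishing_def by blast
  qed
  define U where "U = {b :: ('n + 'n) expo. \<forall>v\<in>W. lookup b v = 0}"
  have U: "b + c \<in> U \<longleftrightarrow> b \<in> U \<and> c \<in> U" for b c
    by (auto simp: U_def lookup_add)
  have V: "x \<in> ?V \<longleftrightarrow> x \<in> fiber D \<and> keys x \<inter> U = {}" for x
    by (auto simp: vanishing_def U_def disjoint_iff)
  have prime: "a \<in> ?V \<or> b \<in> ?V" if ab: "a \<in> fiber D" "b \<in> fiber D" "a * b \<in> ?V" for a b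
  proof (rule ccontr)
    assume "\<not> (a \<in> ?V \<or> b \<in> ?V)"
    hence ne: "keys a \<inter> U \<noteq> {}" "keys b \<inter> U \<noteq> {}" using ab V by blast+
    have fin: "finite (keys a \<inter> U)" "finite (keys b \<inter> U)" by simp_all
    obtain s where s: "s \<in> keys a \<inter> U" "\<forall>c\<in>keys a \<inter> U. (c, s) \<in> lex_order"
      using monomial_order_ex_max[OF monomial_order_lex fin(1) ne(1)] by blast
    obtain t where t: "t \<in> keys b \<inter> U" "\<forall>c\<in>keys b \<inter> U. (c, t) \<in> lex_order"
      using monomial_order_ex_max[OF monomial_order_lex fin(2) ne(2)] by blast
    have "lookup (a * b) (s + t) = lookup a s * lookup b t"
      by (rule lookup_mult_max_on_face[OF monomial_order_lex U]) (use s t in blast)+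
    hence "lookup (a * b) (s + t) \<noteq> 0" using s(1) t(1) by (auto simp: in_keys_iff)
    hence "s + t \<in> keys (a * b) \<inter> U" using U[of s t] s(1) t(1) by (auto simp: in_keys_iff)
    thus False using ab(3) V by blast
  qed
  have sub: "?V \<subseteq> fiber D" unfolding vanishing_def by blast
  show ?thesis unfolding prime_in_def using 0 1 add mult prime sub by blast
qed

lemma vanishing_mono: "W \<subseteq> W' \<Longrightarrow> vanishing D W \<subseteq> vanishing D W'"
  unfolding vanishing_def by blast

text \<open>
  The repetitions are dropped one step at a time, so that the positions of the strict steps need not be
  enumerated in increasing order.
\<close>

lemma chain_from_strict_steps:
  fixes Q :: "nat \<Rightarrow> 'a set"
  assumes "\<And>m. Q m \<subseteq> Q (Suc m)"
  shows "\<exists>P. P (card {m. m < M \<and> Q m \<subset> Q (Suc m)}) = Q M \<and> range P \<subseteq> range Q \<and>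
    (\<forall>i<card {m. m < M \<and> Q m \<subset> Q (Suc m)}. P i \<subset> P (Suc i))"
proof (induct M)
  case 0
  show ?case by (rule exI[of _ "\<lambda>_. Q 0"]) auto
next
  case (Suc M)
  let ?c = "card {m. m < M \<and> Q m \<subset> Q (Suc m)}"
  obtain P where P: "P ?c = Q M" "range P \<subseteq> range Q" "\<forall>i<?c. P i \<subset> P (Suc i)" using Suc by blast
  show ?case
  proof (cases "Q M \<subset> Q (Suc M)")
    case True
    have "{m. m < Suc M \<and> Q m \<subset> Q (Suc m)} = insert M {m. m < M \<and> Q m \<subset> Q (Suc m)}"
      using True by (auto simp: less_Suc_eq)
    hence c: "card {m. m < Suc M \<and> Q m \<subset> Q (Suc m)} = Suc ?c" by simp
    show ?thesis unfolding c
    proof (intro exI[of _ "P(Suc ?c := Q (Suc M))"] conjI allI impI)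
      show "range (P(Suc ?c := Q (Suc M))) \<subseteq> range Q" using P(2) by auto
      fix i assume "i < Suc ?c"
      then consider "i < ?c" | "i = ?c" by linarith
      thus "(P(Suc ?c := Q (Suc M))) i \<subset> (P(Suc ?c := Q (Suc M))) (Suc i)"
        by cases (use P True in auto)
    qed simp
  next
    case False
    hence eq: "Q (Suc M) = Q M" using assms[of M] by blast
    have c: "{m. m < Suc M \<and> Q m \<subset> Q (Suc m)} = {m. m < M \<and> Q m \<subset> Q (Suc m)}"
      using False by (auto simp: less_Suc_eq)
    show ?thesis unfolding c using P eq by (intro exI[of _ P]) simp
  qed
qed

definition ord :: "'n::{finite,linorder} \<Rightarrow> nat" where
  "ord i = card {k. k < i}"

lemma ord_less: "i < j \<Longrightarrow> ord i < ord (j :: 'n::{finite,linorder})"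
proof -
  assume "i < j"
  hence "{k. k < i} \<subset> {k. k < j}" by (intro psubsetI) (auto dest: less_trans)
  thus ?thesis unfolding ord_def by (rule psubset_card_mono[rotated]) simp
qed

lemma inj_ord: "inj (ord :: 'n::{finite,linorder} \<Rightarrow> nat)"
proof (rule injI, rule ccontr)
  fix i j :: 'n assume "ord i = ord j" "i \<noteq> j"
  thus False using ord_less[of i j] ord_less[of j i] by (metis neqE less_irrefl)
qed

lemma ord_le: "ord (i :: 'n::{finite,linorder}) \<le> CARD('n)"
  unfolding ord_def by (rule card_mono) simp_all

text \<open>
  The variables are ordered by giving \<open>x\<^sub>i\<close> the position \<open>2 * ord i + 1\<close> and \<open>y\<^sub>j\<close> the position
  \<open>2 * ord (pred1 D j)\<close>, just below the largest neighbour \<open>x\<^sub>p\<close> of \<open>y\<^sub>j\<close>; then \<open>upper D m\<close> consists of the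
  variables from position \<open>m\<close> on. In this order the higher variable of the edge \<open>(pred1 D j, j)\<close> is the
  \<open>x\<close> and that of \<open>(pred2 D j, j)\<close> is the \<open>y\<close>, and these \<open>rank D\<close> variables have distinct positions.
\<close>

definition upper :: "('n::{finite,linorder} \<times> 'n) set \<Rightarrow> nat \<Rightarrow> ('n + 'n) set" where
  "upper D m = {Inl i | i. m \<le> 2 * ord i + 1} \<union> {Inr j | j. j \<in> has1 D \<and> m \<le> 2 * ord (pred1 D j)}"

text \<open>
  The witness is \<open>f\<^sub>i\<^sub>j\<close> for the edge whose higher variable has position \<open>m\<close>. Its other monomial
  \<open>x\<^sub>j y\<^sub>i\<close> contains the variable \<open>x\<^sub>j\<close>, which lies above both \<open>x\<^sub>i\<close> and \<open>y\<^sub>j\<close>.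
\<close>

lemma vanishing_upper_strict:
  fixes D :: "('n::{finite,linorder} \<times> 'n) set"
  assumes D: "closed_edges D" and e: "(i, j) \<in> D"
    and in_m: "Inl i \<in> upper D m \<or> Inr j \<in> upper D m"
    and m: "m \<le> 2 * ord (pred1 D j) + 1"
    and not_Suc: "Inl i \<notin> upper D (Suc m)" "Inr j \<notin> upper D (Suc m)"
  shows "(vanishing D (upper D (Suc m)) :: ('n, 'k::field) xypoly set) \<subset> vanishing D (upper D m)"
proof -
  let ?p = "ebin (i, j) :: ('n, 'k) xypoly"
  have ij: "i < j" by (rule closed_edgesD(1)[OF D e])
  have keys: "keys ?p = {xe i + ye j, xe j + ye i}"
    unfolding ebin_def fst_conv snd_conv using ij by (intro keys_edge_binomial) simp
  have pf: "?p \<in> fiber D" using e by (rule fiber_ebin)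
  have "ord (pred1 D j) < ord j"
    using closed_edgesD(1)[OF D pred1(1)[OF pred1(3)[OF e]]] by (rule ord_less)
  hence "Inl j \<in> upper D m" using m unfolding upper_def by simp
  hence "\<exists>v\<in>upper D m. lookup (xe j + ye i) v \<noteq> 0"
    by (intro bexI[of _ "Inl j"]) (simp_all add: lookup_add)
  moreover have "\<exists>v\<in>upper D m. lookup (xe i + ye j) v \<noteq> 0"
    using in_m
  proof
    assume "Inl i \<in> upper D m"
    thus ?thesis by (intro bexI[of _ "Inl i"]) (simp_all add: lookup_add)
  next
    assume "Inr j \<in> upper D m"
    thus ?thesis by (intro bexI[of _ "Inr j"]) (simp_all add: lookup_add)
  qed
  ultimately have "?p \<in> vanishing D (upper D m)"
    using pf by (simp add: vanishing_def keys)
  moreover have "?p \<notin> vanishing D (upper D (Suc m))"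
  proof
    assume "?p \<in> vanishing D (upper D (Suc m))"
    hence "\<exists>v\<in>upper D (Suc m). lookup (xe i + ye j) v \<noteq> 0" by (simp add: vanishing_def keys)
    then obtain v where v: "v \<in> upper D (Suc m)" "lookup (xe i + ye j) v \<noteq> 0" by blast
    have "v = Inl i \<or> v = Inr j" using v(2) by (auto simp: lookup_add split: if_splits)
    thus False using v(1) not_Suc by blast
  qed
  moreover have "upper D (Suc m) \<subseteq> upper D m" unfolding upper_def by auto
  hence "(vanishing D (upper D (Suc m)) :: ('n, 'k) xypoly set) \<subseteq> vanishing D (upper D m)"
    by (rule vanishing_mono)
  ultimately show ?thesis by blast
qed

theorem chain_of_length_rank:
  fixes D :: "('n::{finite,linorder} \<times> 'n) set"
  assumes D: "closed_edges D"
  obtains P :: "nat \<Rightarrow> ('n, 'k::field) xypoly set"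
    where "\<And>i. prime_in (fiber D) (P i)" "\<And>i. i < rank D \<Longrightarrow> P i \<subset> P (Suc i)"
proof -
  \<comment> \<open>\<open>L\<close> is above all positions: \<open>Q 0\<close> belongs to the empty set of variables, and \<open>Q\<close> grows as the position descends\<close>
  define L where "L = 2 * CARD('n) + 2"
  define V where "V m = (vanishing D (upper D m) :: ('n, 'k) xypoly set)" for m
  define Q where "Q m = V (L - m)" for m
  have Vmono: "V m' \<subseteq> V m" if "m \<le> m'" for m m'
  proof -
    have "upper D m' \<subseteq> upper D m" unfolding upper_def using that by auto
    thus ?thesis unfolding V_def by (rule vanishing_mono)
  qed
  have Q: "Q m \<subseteq> Q (Suc m)" for m unfolding Q_def by (rule Vmono) simp
  define K1 where "K1 = (\<lambda>j. 2 * ord (pred1 D j) + 1) ` has1 D"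
  define K2 where "K2 = (\<lambda>j. 2 * ord (pred1 D j)) ` has2 D"
  have strict: "V (Suc m) \<subset> V m" if m: "m \<in> K1 \<union> K2" for m
    using m
  proof
    assume "m \<in> K1"
    then obtain j where j: "j \<in> has1 D" "m = 2 * ord (pred1 D j) + 1" unfolding K1_def by blast
    show ?thesis unfolding V_def
      by (rule vanishing_upper_strict[OF D pred1(1)[OF j(1)]]) (use j in \<open>simp_all add: upper_def\<close>)
  next
    assume "m \<in> K2"
    then obtain j where j: "j \<in> has2 D" "m = 2 * ord (pred1 D j)" unfolding K2_def by blast
    have j1: "j \<in> has1 D" using j(1) pred2(4) by blast
    have lt: "ord (pred2 D j) < ord (pred1 D j)" by (rule ord_less[OF pred2(2)[OF j(1)]])
    show ?thesis unfolding V_def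
      by (rule vanishing_upper_strict[OF D pred2(1)[OF j(1)]]) (use j j1 lt in \<open>simp_all add: upper_def\<close>)
  qed
  have KL: "m < L" if "m \<in> K1 \<union> K2" for m
  proof -
    have "2 * ord (pred1 D j) + 1 < L" for j using ord_le[of "pred1 D j"] by (simp add: L_def)
    thus ?thesis using that add_lessD1 unfolding K1_def K2_def by blast
  qed
  have "inj_on (\<lambda>j. 2 * ord (pred1 D j) + 1) (has1 D)" "inj_on (\<lambda>j. 2 * ord (pred1 D j)) (has2 D)"
  proof -
    have *: "x = y" if "x \<in> has1 D" "y \<in> has1 D" "ord (pred1 D x) = ord (pred1 D y)" for x y
      by (rule inj_onD[OF inj_pred1[OF D] injD[OF inj_ord that(3)] that(1,2)])
    show "inj_on (\<lambda>j. 2 * ord (pred1 D j) + 1) (has1 D)" by (rule inj_onI) (rule *, simp_all)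
    show "inj_on (\<lambda>j. 2 * ord (pred1 D j)) (has2 D)"
      by (rule inj_onI) (rule *, use pred2(4)[of D] in auto)
  qed
  hence "card K1 = card (has1 D)" "card K2 = card (has2 D)"
    unfolding K1_def K2_def by (simp_all only: card_image)
  moreover have "K1 \<inter> K2 = {}"
  proof -
    have "odd m" if "m \<in> K1" for m using that unfolding K1_def by auto
    moreover have "even m" if "m \<in> K2" for m using that unfolding K2_def by auto
    ultimately show ?thesis by blast
  qed
  moreover have "finite K1" "finite K2" unfolding K1_def K2_def by simp_all
  ultimately have cardK: "card (K1 \<union> K2) = rank D" unfolding rank_def by (simp add: card_Un_disjoint)
  let ?S = "{m. m < L \<and> Q m \<subset> Q (Suc m)}"
  have sub: "(\<lambda>m. L - Suc m) ` (K1 \<union> K2) \<subseteq> ?S"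
  proof (intro image_subsetI CollectI conjI)
    fix m assume m: "m \<in> K1 \<union> K2"
    show "L - Suc m < L" using KL[OF m] by simp
    have "L - (L - Suc m) = Suc m" "L - Suc (L - Suc m) = m" using KL[OF m] by simp_all
    thus "Q (L - Suc m) \<subset> Q (Suc (L - Suc m))" unfolding Q_def using strict[OF m] by simp
  qed
  have inj: "inj_on (\<lambda>m. L - Suc m) (K1 \<union> K2)"
  proof (rule inj_onI)
    fix m m' assume m: "m \<in> K1 \<union> K2" "m' \<in> K1 \<union> K2" "L - Suc m = L - Suc m'"
    show "m = m'" using m(3) KL[OF m(1)] KL[OF m(2)] by linarith
  qed
  have "finite ?S" by (rule finite_subset[of _ "{..<L}"]) auto
  from card_inj_on_le[OF inj sub this] have ge: "rank D \<le> card ?S" by (simp only: cardK)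
  from chain_from_strict_steps[where Q = Q and M = L, OF Q]
  obtain P where "P (card ?S) = Q L \<and> range P \<subseteq> range Q \<and> (\<forall>i<card ?S. P i \<subset> P (Suc i))" ..
  note P = conjunct1[OF conjunct2[OF this]] conjunct2[OF conjunct2[OF this]]
  show ?thesis
  proof (rule that[of P])
    fix i
    obtain m where "P i = Q m" using P(1) by blast
    thus "prime_in (fiber D) (P i)" unfolding Q_def V_def by (simp only: prime_vanishing)
  qed (use P(2) ge in simp)
qed

section \<open>Homogeneous components\<close>

definition hom_comp :: "nat \<Rightarrow> ('v::finite, 'k::field) mpolynomial \<Rightarrow> ('v, 'k) mpolynomial" where
  "hom_comp d p = (\<Sum>a\<in>{a\<in>keys p. expo_deg a = d}. cmul (lookup p a) (monomial a))"

lemma lookup_hom_comp: "lookup (hom_comp d p) a = (if expo_deg a = d then lookup p a else 0)"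
proof -
  have "lookup (hom_comp d p) a = (\<Sum>b\<in>{b\<in>keys p. expo_deg b = d}. if a = b then lookup p b else 0)"
    by (simp add: hom_comp_def lookup_sum lookup_monomial if_distrib cong: if_cong)
  also have "\<dots> = (if a \<in> {b\<in>keys p. expo_deg b = d} then lookup p a else 0)"
    by (rule sum.delta') simp
  finally show ?thesis by (simp add: in_keys_iff)
qed

lemma hom_comp_add: "hom_comp d (p + q) = hom_comp d p + hom_comp d q"
  by (rule poly_mapping_eqI) (simp add: lookup_hom_comp lookup_add)

lemma hom_comp_cmul: "hom_comp d (cmul c p) = cmul c (hom_comp d p)"
  by (rule poly_mapping_eqI) (simp add: lookup_hom_comp)

lemma hom_comp_0 [simp]: "hom_comp d 0 = 0"
  by (rule poly_mapping_eqI) (simp add: lookup_hom_comp)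

lemma hom_comp_same: "(\<And>a. a \<in> keys p \<Longrightarrow> expo_deg a = d) \<Longrightarrow> hom_comp d p = p"
  by (rule poly_mapping_eqI) (auto simp: lookup_hom_comp in_keys_iff)

lemma hom_comp_other: "(\<And>a. a \<in> keys p \<Longrightarrow> expo_deg a \<noteq> d) \<Longrightarrow> hom_comp d p = 0"
  by (rule poly_mapping_eqI) (auto simp: lookup_hom_comp in_keys_iff)

lemma keys_hom_comp: "a \<in> keys (hom_comp d p) \<Longrightarrow> expo_deg a = d \<and> a \<in> keys p"
  by (auto simp: in_keys_iff lookup_hom_comp split: if_splits)

lemma hom_comp_mult_lowest:
  assumes p: "\<And>a. a \<in> keys p \<Longrightarrow> i \<le> expo_deg a" and q: "\<And>a. a \<in> keys q \<Longrightarrow> j \<le> expo_deg a"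
  shows "hom_comp (i + j) (p * q) = hom_comp i p * hom_comp j q"
proof -
  define p' where "p' = p - hom_comp i p"
  define q' where "q' = q - hom_comp j q"
  have p': "i < expo_deg a" if a: "a \<in> keys p'" for a
  proof -
    have "lookup p a - (if expo_deg a = i then lookup p a else 0) \<noteq> 0"
      using a by (simp only: in_keys_iff p'_def lookup_minus lookup_hom_comp) simp
    hence "expo_deg a \<noteq> i" "a \<in> keys p" by (auto simp: in_keys_iff split: if_splits)
    thus ?thesis using p[of a] by simp
  qed
  have q': "j < expo_deg a" if a: "a \<in> keys q'" for a
  proof -
    have "lookup q a - (if expo_deg a = j then lookup q a else 0) \<noteq> 0"
      using a by (simp only: in_keys_iff q'_def lookup_minus lookup_hom_comp) simp
    hence "expo_deg a \<noteq> j" "a \<in> keys q" by (auto simp: in_keys_iff split: if_splits)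
    thus ?thesis using q[of a] by simp
  qed
  have "p * q = hom_comp i p * hom_comp j q + hom_comp i p * q' + p' * q"
    by (simp add: p'_def q'_def algebra_simps)
  moreover have "hom_comp (i + j) (hom_comp i p * hom_comp j q) = hom_comp i p * hom_comp j q"
  proof (rule hom_comp_same)
    fix a assume "a \<in> keys (hom_comp i p * hom_comp j q)"
    then obtain b c where bc: "a = b + c" "b \<in> keys (hom_comp i p)" "c \<in> keys (hom_comp j q)"
      using keys_mult by blast
    show "expo_deg a = i + j" using keys_hom_comp[OF bc(2)] keys_hom_comp[OF bc(3)] by (simp add: bc(1))
  qed
  moreover have "hom_comp (i + j) (hom_comp i p * q') = 0"
  proof (rule hom_comp_other)
    fix a assume "a \<in> keys (hom_comp i p * q')"
    then obtain b c where bc: "a = b + c" "b \<in> keys (hom_comp i p)" "c \<in> keys q'"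
      using keys_mult by blast
    show "expo_deg a \<noteq> i + j" using keys_hom_comp[OF bc(2)] q'[OF bc(3)] by (simp add: bc(1))
  qed
  moreover have "hom_comp (i + j) (p' * q) = 0"
  proof (rule hom_comp_other)
    fix a assume "a \<in> keys (p' * q)"
    then obtain b c where bc: "a = b + c" "b \<in> keys p'" "c \<in> keys q"
      using keys_mult by blast
    show "expo_deg a \<noteq> i + j" using p'[OF bc(2)] q[OF bc(3)] by (simp add: bc(1))
  qed
  ultimately show ?thesis by (simp add: hom_comp_add)
qed

abbreviation terms :: "('n \<times> 'n) set \<Rightarrow> nat \<Rightarrow> ('n, 'k::comm_ring_1) xypoly set" where
  "terms D k \<equiv> {T m M | m M. set_mset M \<subseteq> D \<and> size M = k}"

definition Jpow :: "('n::finite \<times> 'n) set \<Rightarrow> nat \<Rightarrow> ('n, 'k::field) xypoly set" where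
  "Jpow D k = ideal_power (ideal_gen (ebin ` D)) k"

lemma Jpow_eq: "Jpow D k = kvs.span (terms D k)"
  unfolding Jpow_def by (rule ideal_power_eq_span_terms)

lemma Jpow_0: "Jpow D 0 = UNIV"
  unfolding Jpow_def by (rule ideal_power_0)

lemma Jpow_mult:
  assumes "p \<in> Jpow D i" "q \<in> Jpow D j"
  shows "p * q \<in> Jpow D (i + j)"
proof -
  have "p * q \<in> kvs.span {a * b | a b. a \<in> terms D i \<and> b \<in> terms D j}"
    using assms unfolding Jpow_eq by (rule span_mult)
  moreover have "{a * b | a b. a \<in> terms D i \<and> b \<in> terms D j} \<subseteq> terms D (i + j)"
  proof safe
    fix m M n N assume *: "set_mset M \<subseteq> D" "set_mset N \<subseteq> D" "i = size M" "j = size N"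
    show "\<exists>m' M'. T m M * T n N = T m' M' \<and> set_mset M' \<subseteq> D \<and> size M' = size M + size N"
      by (rule exI[of _ "m + n"], rule exI[of _ "M + N"])
        (use * in \<open>auto simp: fprod_union monomial_add mult_ac\<close>)
  qed
  ultimately show ?thesis unfolding Jpow_eq using kvs.span_mono by blast
qed

lemma keys_ebin_deg: "a \<in> keys (ebin e :: ('n::finite, 'k::field) xypoly) \<Longrightarrow> expo_deg a = 2"
proof -
  assume "a \<in> keys (ebin e :: ('n, 'k) xypoly)"
  hence "a = xe (fst e) + ye (snd e) \<or> a = xe (snd e) + ye (fst e)"
    by (auto simp: ebin_def edge_binomial_eq in_keys_iff lookup_minus lookup_monomial split: if_splits)
  thus ?thesis by auto
qed

lemma keys_fprod_deg: "a \<in> keys (fprod M :: ('n::finite, 'k::field) xypoly) \<Longrightarrow> expo_deg a = 2 * size M"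
proof (induct M arbitrary: a)
  case (add e M)
  then obtain b c where bc: "a = b + c" "b \<in> keys (ebin e :: ('n, 'k) xypoly)"
    "c \<in> keys (fprod M :: ('n, 'k) xypoly)"
    using keys_mult[of "ebin e :: ('n, 'k) xypoly" "fprod M"] unfolding fprod_simps by blast
  show ?case using keys_ebin_deg[OF bc(2)] add(1)[OF bc(3)] by (simp add: bc(1))
qed simp

lemma keys_Jpow_deg:
  fixes q :: "('n::finite, 'k::field) xypoly"
  assumes "q \<in> Jpow D k" "a \<in> keys q"
  shows "2 * k \<le> expo_deg a"
proof -
  have "a \<in> (\<Union>g\<in>(terms D k :: ('n, 'k) xypoly set). keys g)"
    by (rule subsetD[OF keys_span_subset[OF assms(1)[unfolded Jpow_eq]] assms(2)])
  then obtain g where g: "g \<in> (terms D k :: ('n, 'k) xypoly set)" "a \<in> keys g" ..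
  then obtain m M where M: "g = T m M" "size M = k" by blast
  obtain b where b: "a = m + b" "b \<in> keys (fprod M :: ('n, 'k) xypoly)"
    using g(2) unfolding M(1) keys_monomial_mult by blast
  show ?thesis using keys_fprod_deg[OF b(2)] M(2) by (simp add: b(1))
qed

lemma hom_comp_term: "hom_comp (2 * size M) (T m M) = (if m = 0 then fprod M else 0 :: ('n::finite, 'k::field) xypoly)"
proof (cases "m = 0")
  case True
  have "hom_comp (2 * size M) (fprod M :: ('n, 'k) xypoly) = fprod M"
    by (rule hom_comp_same) (rule keys_fprod_deg)
  thus ?thesis using True by simp
next
  case False
  have "hom_comp (2 * size M) (T m M :: ('n, 'k) xypoly) = 0"
  proof (rule hom_comp_other)
    fix a assume "a \<in> keys (T m M :: ('n, 'k) xypoly)"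
    then obtain b where b: "a = m + b" "b \<in> keys (fprod M :: ('n, 'k) xypoly)"
      unfolding keys_monomial_mult by blast
    have "expo_deg m \<noteq> 0" using False by simp
    thus "expo_deg a \<noteq> 2 * size M" using keys_fprod_deg[OF b(2)] by (simp add: b(1))
  qed
  thus ?thesis using False by simp
qed

lemma subspace_vimage_hom_comp:
  assumes "kvs.subspace V"
  shows "kvs.subspace {q. hom_comp d q \<in> V}" "kvs.subspace {q. q - hom_comp d q \<in> V}"
proof -
  show "kvs.subspace {q. hom_comp d q \<in> V}"
    by (rule kvs.subspaceI)
      (simp_all add: hom_comp_add hom_comp_cmul kvs.subspace_0[OF assms] kvs.subspace_add[OF assms] kvs.subspace_scale[OF assms])
  show "kvs.subspace {q. q - hom_comp d q \<in> V}"
  proof (rule kvs.subspaceI)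
    fix x y assume "x \<in> {q. q - hom_comp d q \<in> V}" "y \<in> {q. q - hom_comp d q \<in> V}"
    hence "(x - hom_comp d x) + (y - hom_comp d y) \<in> V" by (intro kvs.subspace_add[OF assms]) simp_all
    thus "x + y \<in> {q. q - hom_comp d q \<in> V}" by (simp add: hom_comp_add algebra_simps)
  next
    fix c x assume "x \<in> {q. q - hom_comp d q \<in> V}"
    hence "cmul c (x - hom_comp d x) \<in> V" by (intro kvs.subspace_scale[OF assms]) simp_all
    thus "cmul c x \<in> {q. q - hom_comp d q \<in> V}" by (simp add: hom_comp_cmul kvs.scale_right_diff_distrib)
  qed (simp add: kvs.subspace_0[OF assms])
qed

lemma hom_comp_Jpow:
  fixes q :: "('n::finite, 'k::field) xypoly"
  assumes "q \<in> Jpow D k"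
  shows "hom_comp (2 * k) q \<in> fiber D"
proof (rule kvs.span_induct[OF assms[unfolded Jpow_eq], of "\<lambda>q. hom_comp (2 * k) q \<in> fiber D"])
  show "kvs.subspace {q :: ('n, 'k) xypoly. hom_comp (2 * k) q \<in> fiber D}"
    unfolding fiber_def by (intro subspace_vimage_hom_comp kvs.subspace_span)
  fix g :: "('n, 'k) xypoly" assume "g \<in> terms D k"
  then obtain m M where M: "g = T m M" "set_mset M \<subseteq> D" "size M = k" by blast
  have "(fprod M :: ('n, 'k) xypoly) \<in> fiber D"
    unfolding fiber_def using M by (intro kvs.span_base) blast
  thus "hom_comp (2 * k) g \<in> fiber D" unfolding M(1) M(3)[symmetric] hom_comp_term by (simp add: fiber_0)
qed

text \<open>
  Since \<open>J\<^sup>k\<close> is generated in degree \<open>2 k\<close>, its elements without a component of this degree lie in the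
  product of the irrelevant ideal with \<open>J\<^sup>k\<close>.
\<close>

lemma Jpow_minus_hom_comp:
  fixes q :: "('n::finite, 'k::field) xypoly"
  assumes "q \<in> Jpow D k"
  shows "q - hom_comp (2 * k) q \<in> kvs.span {T m M | m M. m \<noteq> 0 \<and> set_mset M \<subseteq> D \<and> size M = k}"
    (is "_ \<in> kvs.span ?G")
proof (rule kvs.span_induct[OF assms[unfolded Jpow_eq], of "\<lambda>q. q - hom_comp (2 * k) q \<in> kvs.span ?G"])
  show "kvs.subspace {q :: ('n, 'k) xypoly. q - hom_comp (2 * k) q \<in> kvs.span ?G}"
    by (intro subspace_vimage_hom_comp kvs.subspace_span)
  fix g :: "('n, 'k) xypoly" assume "g \<in> terms D k"
  then obtain m M where M: "g = T m M" "set_mset M \<subseteq> D" "size M = k" by blast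
  show "g - hom_comp (2 * k) g \<in> kvs.span ?G"
  proof (cases "m = 0")
    case True
    thus ?thesis unfolding M(1) M(3)[symmetric] hom_comp_term by (simp add: kvs.span_zero)
  next
    case False
    hence "T m M \<in> ?G" using M by blast
    thus ?thesis using False unfolding M(1) M(3)[symmetric] hom_comp_term by (simp add: kvs.span_base)
  qed
qed

section \<open>The special fiber ring\<close>

text \<open>
  On the Rees algebra this map takes the lowest possible component, of degree \<open>2 k\<close>, in each \<open>J\<^sup>k t\<^sup>k\<close>.
  The components of different \<open>k\<close> have different degrees, so the variable \<open>t\<close> can be dropped.
\<close>

definition fiber_map :: "('v::finite, 'k::field) mpolynomial poly \<Rightarrow> ('v, 'k) mpolynomial" where
  "fiber_map p = (\<Sum>k\<le>Polynomial.degree p. hom_comp (2 * k) (Polynomial.coeff p k))"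

lemma fiber_map_eq: "Polynomial.degree p \<le> N \<Longrightarrow> fiber_map p = (\<Sum>k\<le>N. hom_comp (2 * k) (Polynomial.coeff p k))"
  unfolding fiber_map_def
  by (rule sum.mono_neutral_left) (auto simp: Polynomial.coeff_eq_0)

lemma fiber_map_add: "fiber_map (p + q) = fiber_map p + fiber_map q"
proof -
  let ?N = "max (Polynomial.degree p) (Polynomial.degree q)"
  have "fiber_map (p + q) = (\<Sum>k\<le>?N. hom_comp (2 * k) (Polynomial.coeff (p + q) k))"
    by (rule fiber_map_eq) (rule Polynomial.degree_add_le_max)
  thus ?thesis by (simp add: fiber_map_eq[of p ?N] fiber_map_eq[of q ?N] hom_comp_add sum.distrib)
qed

lemma fiber_map_0: "fiber_map 0 = 0"
  by (simp add: fiber_map_def)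

lemma fiber_map_sum: "fiber_map (\<Sum>i\<in>I. f i) = (\<Sum>i\<in>I. fiber_map (f i))"
  by (induct I rule: infinite_finite_induct) (simp_all add: fiber_map_add fiber_map_0)

lemma fiber_map_monom: "fiber_map (Polynomial.monom c k) = hom_comp (2 * k) c"
proof -
  have "fiber_map (Polynomial.monom c k) = (\<Sum>i\<le>k. hom_comp (2 * i) (Polynomial.coeff (Polynomial.monom c k) i))"
    by (rule fiber_map_eq) (rule Polynomial.degree_monom_le)
  also have "\<dots> = (\<Sum>i\<le>k. if i = k then hom_comp (2 * k) c else 0)"
    by (intro sum.cong) auto
  finally show ?thesis by simp
qed

lemma fiber_map_const: "fiber_map [:c:] = hom_comp 0 c"
  using fiber_map_monom[of c 0] by (simp add: Polynomial.monom_0)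

definition rees_carrier :: "('n::finite \<times> 'n) set \<Rightarrow> ('n, 'k::field) xypoly poly set" where
  "rees_carrier D = {p. \<forall>k. Polynomial.coeff p k \<in> Jpow D k}"

lemma rees_algebra_eq:
  "rees_algebra (ideal_gen (ebin ` D)) =
    (ring_of TYPE(('n::finite, 'k::field) xypoly poly))\<lparr>carrier := rees_carrier D\<rparr>"
  unfolding rees_algebra_def rees_carrier_def Jpow_def ..

lemma Jpow_subspace: "0 \<in> Jpow D k" "p \<in> Jpow D k \<Longrightarrow> q \<in> Jpow D k \<Longrightarrow> p + q \<in> Jpow D k"
  "p \<in> Jpow D k \<Longrightarrow> cmul c p \<in> Jpow D k"
  unfolding Jpow_eq by (auto intro: kvs.span_zero kvs.span_add kvs.span_scale)

lemma rees_const: "[:c:] \<in> rees_carrier D"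
  by (auto simp: rees_carrier_def Polynomial.coeff_pCons Jpow_0 Jpow_subspace split: nat.splits)

lemma rees_add: "p \<in> rees_carrier D \<Longrightarrow> q \<in> rees_carrier D \<Longrightarrow> p + q \<in> rees_carrier D"
  by (simp add: rees_carrier_def Jpow_subspace)

lemma rees_mult:
  assumes "p \<in> rees_carrier D" "q \<in> rees_carrier D"
  shows "p * q \<in> rees_carrier D"
proof -
  have "Polynomial.coeff (p * q) k \<in> Jpow D k" for k
  proof -
    have "Polynomial.coeff p i * Polynomial.coeff q (k - i) \<in> Jpow D k" if "i \<le> k" for i
      using Jpow_mult[of "Polynomial.coeff p i" D i "Polynomial.coeff q (k - i)" "k - i"] assms that
      by (simp add: rees_carrier_def)
    thus ?thesis unfolding Polynomial.coeff_mult Jpow_eq by (intro kvs.span_sum) simp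
  qed
  thus ?thesis by (simp add: rees_carrier_def)
qed

lemma rees_monom: "c \<in> Jpow D k \<Longrightarrow> Polynomial.monom c k \<in> rees_carrier D"
  by (simp add: rees_carrier_def Jpow_subspace)

text \<open>
  Lowest components multiply; by additivity it is enough to see this for the summands \<open>c t\<^sup>k\<close>.
\<close>

lemma fiber_map_mult:
  assumes p: "p \<in> rees_carrier D" and q: "q \<in> rees_carrier D"
  shows "fiber_map (p * q) = fiber_map p * fiber_map q"
proof -
  let ?c = "Polynomial.coeff" and ?m = "Polynomial.monom"
  have "p * q = (\<Sum>i\<le>Polynomial.degree p. ?m (?c p i) i) * (\<Sum>j\<le>Polynomial.degree q. ?m (?c q j) j)"
    by (simp only: Polynomial.poly_as_sum_of_monoms)
  also have "\<dots> = (\<Sum>i\<le>Polynomial.degree p. \<Sum>j\<le>Polynomial.degree q. ?m (?c p i * ?c q j) (i + j))"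
    by (simp only: sum_product Polynomial.mult_monom)
  finally have "fiber_map (p * q) =
      (\<Sum>i\<le>Polynomial.degree p. \<Sum>j\<le>Polynomial.degree q. hom_comp (2 * (i + j)) (?c p i * ?c q j))"
    by (simp only: fiber_map_sum fiber_map_monom)
  also have "\<dots> = (\<Sum>i\<le>Polynomial.degree p. \<Sum>j\<le>Polynomial.degree q. hom_comp (2 * i) (?c p i) * hom_comp (2 * j) (?c q j))"
  proof (intro sum.cong refl)
    fix i j
    have pi: "?c p i \<in> Jpow D i" and qj: "?c q j \<in> Jpow D j"
      using p q by (simp_all add: rees_carrier_def)
    show "hom_comp (2 * (i + j)) (?c p i * ?c q j) = hom_comp (2 * i) (?c p i) * hom_comp (2 * j) (?c q j)"
      unfolding distrib_left by (rule hom_comp_mult_lowest) (rule keys_Jpow_deg[OF pi], simp, rule keys_Jpow_deg[OF qj], simp)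
  qed
  also have "\<dots> = fiber_map p * fiber_map q" by (simp only: fiber_map_def sum_product)
  finally show ?thesis .
qed

lemma fiber_map_in_fiber: "p \<in> rees_carrier D \<Longrightarrow> fiber_map p \<in> fiber D"
  unfolding fiber_map_def by (intro fiber_sum hom_comp_Jpow) (simp add: rees_carrier_def)

lemma hom_comp_0_const: "hom_comp 0 (single 0 c) = single 0 c"
  by (rule hom_comp_same) (simp split: if_splits)

lemma fiber_map_1: "fiber_map 1 = 1"
proof -
  have "fiber_map 1 = fiber_map [:1:]" by (simp only: one_pCons)
  also have "\<dots> = hom_comp 0 (single 0 1)" unfolding fiber_map_const single_one ..
  also have "\<dots> = single 0 1" by (rule hom_comp_0_const)
  also have "\<dots> = 1" by (rule single_one)
  finally show ?thesis .
qed

lemma fiber_map_image: "fiber_map ` rees_carrier D = fiber D"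
proof
  show "fiber_map ` rees_carrier D \<subseteq> fiber D" using fiber_map_in_fiber by blast
  show "fiber D \<subseteq> fiber_map ` rees_carrier D"
    unfolding fiber_def
  proof (rule kvs.span_minimal)
    show "{fprod M | M. set_mset M \<subseteq> D} \<subseteq> fiber_map ` rees_carrier D"
    proof safe
      fix M assume M: "set_mset M \<subseteq> D"
      have "T 0 M \<in> Jpow D (size M)" unfolding Jpow_eq using M by (intro kvs.span_base) blast
      hence "Polynomial.monom (T 0 M) (size M) \<in> rees_carrier D" by (rule rees_monom)
      moreover have "fiber_map (Polynomial.monom (T 0 M) (size M)) = fprod M"
        unfolding fiber_map_monom hom_comp_term by simp
      ultimately show "fprod M \<in> fiber_map ` rees_carrier D" by (metis image_eqI)
    qed
    show "kvs.subspace (fiber_map ` rees_carrier D)"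
    proof (rule kvs.subspaceI)
      have "0 \<in> rees_carrier D" by (simp add: rees_carrier_def Jpow_subspace)
      thus "0 \<in> fiber_map ` rees_carrier D" using fiber_map_0 by (metis image_eqI)
      show "x + y \<in> fiber_map ` rees_carrier D" if "x \<in> fiber_map ` rees_carrier D" "y \<in> fiber_map ` rees_carrier D" for x y
      proof -
        obtain p q where "x = fiber_map p" "p \<in> rees_carrier D" "y = fiber_map q" "q \<in> rees_carrier D"
          using \<open>x \<in> _\<close> \<open>y \<in> _\<close> by blast
        thus ?thesis by (intro image_eqI[of _ _ "p + q"]) (simp_all add: fiber_map_add rees_add)
      qed
      show "cmul c x \<in> fiber_map ` rees_carrier D" if "x \<in> fiber_map ` rees_carrier D" for c x
      proof -
        obtain p where p: "x = fiber_map p" "p \<in> rees_carrier D" using \<open>x \<in> _\<close> by blast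
        have "fiber_map ([:single 0 c:] * p) = cmul c x"
          unfolding fiber_map_mult[OF rees_const p(2)] fiber_map_const hom_comp_0_const p(1) cmul_def ..
        thus ?thesis using rees_mult[OF rees_const p(2), of "single 0 c"] by (metis image_eqI)
      qed
    qed
  qed
qed

lemma fiber_map_eq_0:
  assumes "fiber_map p = 0"
  shows "hom_comp (2 * k) (Polynomial.coeff p k) = 0"
proof (rule poly_mapping_eqI)
  fix a
  show "lookup (hom_comp (2 * k) (Polynomial.coeff p k)) a = lookup 0 a"
  proof (cases "expo_deg a = 2 * k")
    case True
    let ?N = "max k (Polynomial.degree p)"
    have "lookup (fiber_map p) a = (\<Sum>i\<le>?N. if i = k then lookup (Polynomial.coeff p k) a else 0)"
      unfolding fiber_map_eq[of p ?N, OF max.cobounded2] lookup_sum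
      by (intro sum.cong refl) (simp add: lookup_hom_comp True)
    also have "\<dots> = lookup (Polynomial.coeff p k) a" by simp
    finally show ?thesis using assms by (simp add: lookup_hom_comp)
  qed (simp add: lookup_hom_comp)
qed

lemma cring_ring_of_subset:
  fixes A :: "'a::comm_ring_1 set"
  assumes "1 \<in> A" "\<And>x y. x \<in> A \<Longrightarrow> y \<in> A \<Longrightarrow> x + y \<in> A" "\<And>x y. x \<in> A \<Longrightarrow> y \<in> A \<Longrightarrow> x * y \<in> A"
    "\<And>x. x \<in> A \<Longrightarrow> - x \<in> A"
  shows "cring ((ring_of TYPE('a))\<lparr>carrier := A\<rparr>)"
proof -
  have "0 \<in> A" using assms(2)[OF assms(1) assms(4)[OF assms(1)]] by simp
  moreover have "\<exists>y\<in>A. y + x = 0 \<and> x + y = 0" if "x \<in> A" for x using assms(4)[OF that] by (intro bexI[of _ "- x"]) simp_all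
  ultimately show ?thesis
    by unfold_locales (use assms in \<open>auto simp: algebra_simps Units_def\<close>)
qed

lemma minus_ring_of_subset:
  fixes A :: "'a::comm_ring_1 set"
  assumes "cring ((ring_of TYPE('a))\<lparr>carrier := A\<rparr>)" "x \<in> A" "- x \<in> A"
  shows "inv\<^bsub>add_monoid ((ring_of TYPE('a))\<lparr>carrier := A\<rparr>)\<^esub> x = - x"
proof -
  interpret cring "(ring_of TYPE('a))\<lparr>carrier := A\<rparr>" by fact
  have "\<ominus>\<^bsub>(ring_of TYPE('a))\<lparr>carrier := A\<rparr>\<^esub> x = - x"
    by (rule minus_equality) (use assms in auto)
  thus ?thesis by (simp add: a_inv_def)
qed

lemma cring_fiber: "cring ((ring_of TYPE(('n, 'k::field) xypoly))\<lparr>carrier := fiber D\<rparr>)"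
proof (rule cring_ring_of_subset)
  fix x :: "('n, 'k) xypoly" assume "x \<in> fiber D"
  hence "cmul (- 1) x \<in> fiber D" by (rule fiber_cmul)
  thus "- x \<in> fiber D" by simp
qed (auto intro: fiber_1 fiber_add fiber_mult)

lemma cring_rees: "cring ((ring_of TYPE(('n::finite, 'k::field) xypoly poly))\<lparr>carrier := rees_carrier D\<rparr>)"
proof (rule cring_ring_of_subset)
  show one: "1 \<in> (rees_carrier D :: ('n, 'k) xypoly poly set)"
    using rees_const[of "1 :: ('n, 'k) xypoly" D] by (simp add: one_pCons)
  fix x :: "('n, 'k) xypoly poly" assume "x \<in> rees_carrier D"
  from rees_mult[OF rees_const[of "- 1"] this] show "- x \<in> rees_carrier D" by simp
qed (auto intro: rees_add rees_mult)

lemma primeideal_fiber_iff: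
  fixes P :: "('n, 'k::field) xypoly set"
  shows "primeideal P ((ring_of TYPE(('n, 'k) xypoly))\<lparr>carrier := fiber D\<rparr>) \<longleftrightarrow> prime_in (fiber D) P"
    (is "primeideal P ?R \<longleftrightarrow> _")
proof
  assume pr: "primeideal P ?R"
  have idl: "ideal P ?R" using pr by (rule primeideal.axioms)
  have ag: "additive_subgroup P ?R" using idl by (rule ideal.axioms)
  have sub: "P \<subseteq> fiber D" using additive_subgroup.a_subset[OF ag] by simp
  have 0: "0 \<in> P" using additive_subgroup.zero_closed[OF ag] by simp
  have add: "x + y \<in> P" if "x \<in> P" "y \<in> P" for x y
    using additive_subgroup.a_closed[OF ag that] by simp
  have mult: "a * x \<in> P" if "a \<in> fiber D" "x \<in> P" for a x
    using ideal.I_l_closed[OF idl that(2), of a] that(1) by simp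
  have prime: "a \<in> P \<or> b \<in> P" if "a \<in> fiber D" "b \<in> fiber D" "a * b \<in> P" for a b
    using primeideal.I_prime[OF pr, of a b] that by simp
  have 1: "1 \<notin> P"
  proof
    assume "1 \<in> P"
    hence "fiber D \<subseteq> P" using mult[OF _ \<open>1 \<in> P\<close>] by auto
    thus False using primeideal.I_notcarr[OF pr] sub by simp
  qed
  show "prime_in (fiber D) P"
    unfolding prime_in_def using sub 0 add mult prime 1 by blast
next
  assume P: "prime_in (fiber D) P"
  note PD = prime_inD[OF P]
  have neg: "- x \<in> P" if "x \<in> P" for x
    using PD(4)[OF fiber_cmul[OF fiber_1, of "- 1"] that] by (simp add: cmul_mult_left)
  have inv: "inv\<^bsub>add_monoid ?R\<^esub> x = - x" if "x \<in> P" for x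
    using that neg[OF that] PD(1) by (intro minus_ring_of_subset[OF cring_fiber]) blast+
  have "ideal P ?R"
  proof (rule idealI)
    show "ring ?R" using cring_fiber by (rule cring.axioms)
    show "subgroup P (add_monoid ?R)"
    proof (rule subgroup.intro)
      show "P \<subseteq> carrier (add_monoid ?R)" using PD(1) by simp
      show "x \<otimes>\<^bsub>add_monoid ?R\<^esub> y \<in> P" if "x \<in> P" "y \<in> P" for x y using PD(3)[OF that] by simp
      show "\<one>\<^bsub>add_monoid ?R\<^esub> \<in> P" using PD(2) by simp
      show "inv\<^bsub>add_monoid ?R\<^esub> x \<in> P" if "x \<in> P" for x using neg[OF that] inv[OF that] by simp
    qed
    show "x \<otimes>\<^bsub>?R\<^esub> a \<in> P" "a \<otimes>\<^bsub>?R\<^esub> x \<in> P" if "a \<in> P" "x \<in> carrier ?R" for a x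
      using PD(4)[of x a] that by (simp_all add: mult.commute)
  qed
  thus "primeideal P ?R"
  proof (rule primeidealI)
    show "cring ?R" by (rule cring_fiber)
    show "carrier ?R \<noteq> P" using PD(5) fiber_1[of D] by auto
    show "a \<in> P \<or> b \<in> P" if "a \<in> carrier ?R" "b \<in> carrier ?R" "a \<otimes>\<^bsub>?R\<^esub> b \<in> P" for a b
      using PD(6)[of a b] that by simp
  qed
qed

lemma monomial_in_irrelevant:
  assumes "m \<noteq> 0"
  shows "monomial m \<in> (irrelevant_ideal :: ('v, 'k::field) mpolynomial set)"
proof -
  have "\<exists>v. lookup m v \<noteq> lookup 0 v" using assms by (metis poly_mapping_eqI)
  then obtain v where "lookup m v > 0" by auto
  then obtain m0 where m: "m = m0 + single v 1" by (rule expo_split)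
  have "monomial m = monomial m0 * (var v :: ('v, 'k) mpolynomial)" by (simp add: m monomial_add var_def)
  moreover have "var v \<in> (irrelevant_ideal :: ('v, 'k) mpolynomial set)"
    unfolding irrelevant_ideal_def by (rule subsetD[OF ideal_gen_self]) simp
  ultimately show ?thesis
    using ideal_ring_ofD(3)[OF ideal_gen_ideal] unfolding irrelevant_ideal_def by metis
qed

lemma hom_comp_0_irrelevant:
  assumes "c \<in> (irrelevant_ideal :: ('v::finite, 'k::field) mpolynomial set)"
  shows "hom_comp 0 c = 0"
proof (rule hom_comp_other)
  fix a assume a: "a \<in> keys c"
  have "c \<in> kvs.span {monomial m * b | m b. b \<in> range var}"
    using assms unfolding irrelevant_ideal_def ideal_gen_eq_span .
  from keys_span_subset[OF this] a obtain m v where "a \<in> keys (monomial m * var v :: ('v, 'k) mpolynomial)" by blast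
  hence "a = m + single v 1" unfolding keys_monomial_mult var_def by simp
  thus "expo_deg a \<noteq> 0" by (simp only: expo_deg_add expo_deg_single)
qed

text \<open>
  If \<open>fiber_map\<close> vanishes on an element of the Rees algebra, then each coefficient has no component in
  its lowest degree, so by \<open>Jpow_minus_hom_comp\<close> the element lies in the ideal generated by the irrelevant
  ideal. The image of \<open>fiber_map\<close> is generated by the \<open>f\<^sub>e\<close>.
\<close>

theorem special_fiber_iso:
  fixes D :: "('n::{finite,linorder} \<times> 'n) set"
  shows "special_fiber irrelevant_ideal (ideal_gen (ebin ` D) :: ('n, 'k::field) xypoly set)
    \<simeq> (ring_of TYPE(('n, 'k) xypoly))\<lparr>carrier := fiber D\<rparr>"
    and "cring (special_fiber irrelevant_ideal (ideal_gen (ebin ` D) :: ('n, 'k) xypoly set))"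
proof -
  let ?R = "(ring_of TYPE(('n, 'k) xypoly poly))\<lparr>carrier := rees_carrier D\<rparr>"
  let ?S = "(ring_of TYPE(('n, 'k) xypoly))\<lparr>carrier := fiber D\<rparr>"
  let ?H = "(\<lambda>c. [:c:]) ` irrelevant_ideal :: ('n, 'k) xypoly poly set"
  let ?I = "Idl\<^bsub>?R\<^esub> ?H"
  have cR: "cring ?R" by (rule cring_rees)
  have rR: "ring ?R" and rS: "ring ?S" using cR cring_fiber by (auto intro: cring.axioms)
  have hom: "ring_hom_ring ?R ?S fiber_map"
  proof (rule ring_hom_ringI[OF rR rS])
    show "fiber_map x \<in> carrier ?S" if "x \<in> carrier ?R" for x
      using fiber_map_in_fiber[of x D] that by simp
    show "fiber_map (x \<otimes>\<^bsub>?R\<^esub> y) = fiber_map x \<otimes>\<^bsub>?S\<^esub> fiber_map y"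
      if "x \<in> carrier ?R" "y \<in> carrier ?R" for x y
      using fiber_map_mult[of x D y] that by simp
    show "fiber_map (x \<oplus>\<^bsub>?R\<^esub> y) = fiber_map x \<oplus>\<^bsub>?S\<^esub> fiber_map y"
      if "x \<in> carrier ?R" "y \<in> carrier ?R" for x y
      using fiber_map_add[of x y] by simp
    show "fiber_map \<one>\<^bsub>?R\<^esub> = \<one>\<^bsub>?S\<^esub>" using fiber_map_1 by simp
  qed
  have ker: "p \<in> a_kernel ?R ?S fiber_map \<longleftrightarrow> p \<in> rees_carrier D \<and> fiber_map p = 0" for p
    unfolding a_kernel_def' by simp
  have Hc: "?H \<subseteq> carrier ?R" using rees_const by auto
  have idl: "ideal (?I) ?R" by (rule ring.genideal_ideal[OF rR Hc])
  have ag: "additive_subgroup (?I) ?R" using idl by (rule ideal.axioms)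
  have Iadd: "x + y \<in> ?I" if "x \<in> ?I" "y \<in> ?I" for x y
    using additive_subgroup.a_closed[OF ag that] by simp
  have I0: "0 \<in> ?I"
    using additive_subgroup.zero_closed[OF ag] by simp
  have Imult: "x * y \<in> ?I" if "x \<in> ?I" "y \<in> rees_carrier D" for x y
    using ideal.I_r_closed[OF idl that(1), of y] that(2) by simp
  have "a_kernel ?R ?S fiber_map = ?I"
  proof
    have "?H \<subseteq> a_kernel ?R ?S fiber_map"
      using ker rees_const hom_comp_0_irrelevant by (auto simp: fiber_map_const)
    thus "?I \<subseteq> a_kernel ?R ?S fiber_map"
      by (rule ring.genideal_minimal[OF rR ring_hom_ring.kernel_is_ideal[OF hom]])
    show "a_kernel ?R ?S fiber_map \<subseteq> ?I"
    proof
      fix p assume "p \<in> a_kernel ?R ?S fiber_map"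
      hence p: "p \<in> rees_carrier D" "fiber_map p = 0" using ker by blast+
      have mono: "Polynomial.monom (Polynomial.coeff p k) k \<in> ?I" for k
      proof -
        let ?G = "{T m M | m M. m \<noteq> 0 \<and> set_mset M \<subseteq> D \<and> size M = k} :: ('n, 'k) xypoly set"
        have "Polynomial.coeff p k \<in> Jpow D k" using p(1) by (simp add: rees_carrier_def)
        from Jpow_minus_hom_comp[OF this] have "Polynomial.coeff p k \<in> kvs.span ?G"
          using fiber_map_eq_0[OF p(2), of k] by simp
        thus ?thesis
        proof (rule kvs.span_induct[of _ _ "\<lambda>q. Polynomial.monom q k \<in> ?I"])
          show "kvs.subspace {q :: ('n, 'k) xypoly. Polynomial.monom q k \<in> ?I}"
          proof (rule kvs.subspaceI)
            show "0 \<in> {q. Polynomial.monom q k \<in> ?I}" using I0 by simp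
            show "x + y \<in> {q. Polynomial.monom q k \<in> ?I}"
              if "x \<in> {q. Polynomial.monom q k \<in> ?I}" "y \<in> {q. Polynomial.monom q k \<in> ?I}" for x y
              using that Iadd by (simp flip: Polynomial.add_monom)
            show "cmul c x \<in> {q. Polynomial.monom q k \<in> ?I}"
              if "x \<in> {q. Polynomial.monom q k \<in> ?I}" for c x
            proof -
              have "Polynomial.monom x k * [:single 0 c:] \<in> ?I"
                using that by (intro Imult rees_const) simp
              moreover have "Polynomial.monom x k * [:single 0 c:] = Polynomial.monom (cmul c x) k"
                by (simp add: cmul_def Polynomial.smult_monom)
              ultimately show ?thesis by simp
            qed
          qed
          fix g :: "('n, 'k) xypoly" assume "g \<in> ?G"
          then obtain m M where g: "g = T m M" "m \<noteq> 0" "set_mset M \<subseteq> D" "size M = k" by blast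
          have "[:monomial m:] \<in> ?I"
            by (rule subsetD[OF ring.genideal_self[OF rR Hc]], rule imageI) (rule monomial_in_irrelevant[OF g(2)])
          moreover have "(T 0 M :: ('n, 'k) xypoly) \<in> Jpow D k" unfolding Jpow_eq using g by (intro kvs.span_base) blast
          hence "Polynomial.monom (T 0 M :: ('n, 'k) xypoly) k \<in> rees_carrier D"
            by (rule rees_monom)
          ultimately have "[:monomial m:] * Polynomial.monom (T 0 M) k \<in> ?I" by (rule Imult)
          thus "Polynomial.monom g k \<in> ?I" by (simp add: g(1) Polynomial.smult_monom)
        qed
      qed
      have "(\<Sum>k\<in>I. Polynomial.monom (Polynomial.coeff p k) k) \<in> ?I" for I
        by (induct I rule: infinite_finite_induct) (simp_all add: I0 Iadd mono)
      from this[of "{..Polynomial.degree p}"] show "p \<in> ?I"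
        by (simp only: Polynomial.poly_as_sum_of_monoms)
    qed
  qed
  moreover have "?R Quot (a_kernel ?R ?S fiber_map) \<simeq> ?S"
    by (rule ring_hom_ring.FactRing_iso[OF hom]) (simp add: fiber_map_image)
  ultimately show "special_fiber irrelevant_ideal (ideal_gen (ebin ` D) :: ('n, 'k) xypoly set) \<simeq> ?S"
    unfolding special_fiber_def rees_algebra_eq by simp
  show "cring (special_fiber irrelevant_ideal (ideal_gen (ebin ` D) :: ('n, 'k) xypoly set))"
    unfolding special_fiber_def rees_algebra_eq by (rule ideal.quotient_is_cring[OF idl cR])
qed

section \<open>Krull dimension\<close>

definition has_prime_chain :: "('a, 'b) ring_scheme \<Rightarrow> nat \<Rightarrow> bool" where
  "has_prime_chain R d \<longleftrightarrow> (\<exists>P. (\<forall>i\<le>d. primeideal (P i) R) \<and> (\<forall>i<d. P i \<subset> P (Suc i)))"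

text \<open>
  Preimages of primes under a surjection are prime, and distinct primes have distinct preimages.
\<close>

lemma prime_chain_vimage:
  assumes h: "ring_hom_ring A B h" and A: "cring A" and surj: "h ` carrier A = carrier B"
    and B: "has_prime_chain B d"
  shows "has_prime_chain A d"
proof -
  obtain P where P: "\<forall>i\<le>d. primeideal (P i) B" "\<forall>i<d. P i \<subset> P (Suc i)"
    using B unfolding has_prime_chain_def by blast
  define Q where "Q i = {r \<in> carrier A. h r \<in> P i}" for i
  have "primeideal (Q i) A" if "i \<le> d" for i
    unfolding Q_def using ring_hom_ring.primeideal_vimage[OF h A] P(1) that by blast
  moreover have "Q i \<subset> Q (Suc i)" if "i < d" for i
  proof -
    have lt: "P i \<subset> P (Suc i)" using P(2) that by blast
    then obtain x where x: "x \<in> P (Suc i)" "x \<notin> P i" by blast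
    have "primeideal (P (Suc i)) B" using P(1) that by simp
    hence "P (Suc i) \<subseteq> carrier B"
      by (intro additive_subgroup.a_subset ideal.axioms(1) primeideal.axioms(1))
    then obtain r where "r \<in> carrier A" "x = h r" using x(1) surj by blast
    hence "r \<in> Q (Suc i)" "r \<notin> Q i" using x by (simp_all add: Q_def)
    moreover have "Q i \<subseteq> Q (Suc i)" using lt unfolding Q_def by blast
    ultimately show ?thesis by blast
  qed
  ultimately show ?thesis unfolding has_prime_chain_def by blast
qed

lemma prime_chain_iso:
  assumes "A \<simeq> B" "cring A" "ring B" "has_prime_chain B d"
  shows "has_prime_chain A d"
proof -
  obtain h where h: "h \<in> ring_iso A B" using assms(1) unfolding is_ring_iso_def by blast
  show ?thesis
  proof (rule prime_chain_vimage[OF _ assms(2) _ assms(4)])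
    show "ring_hom_ring A B h"
      using h assms(2,3) by (intro ring_hom_ringI2) (auto simp: ring_iso_def cring.axioms)
    show "h ` carrier A = carrier B" using h by (auto simp: ring_iso_def bij_betw_def)
  qed
qed

theorem analytic_spread_eq_rank:
  fixes D :: "('n::{finite,linorder} \<times> 'n) set"
  assumes D: "closed_edges D"
  shows "analytic_spread (ideal_gen (ebin ` D) :: ('n, 'k::field) xypoly set) = ereal (real (rank D))"
proof -
  let ?F = "special_fiber irrelevant_ideal (ideal_gen (ebin ` D) :: ('n, 'k) xypoly set)"
  let ?S = "(ring_of TYPE(('n, 'k) xypoly))\<lparr>carrier := fiber D\<rparr>"
  note iso = special_fiber_iso(1)[of D, where 'k = 'k] and cr = special_fiber_iso(2)[of D, where 'k = 'k]
  have rF: "ring ?F" and rS: "ring ?S" using cr cring_fiber by (auto intro: cring.axioms)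
  have iso': "?S \<simeq> ?F" by (rule ring_iso_sym[OF rF iso])
  have chain: "has_prime_chain ?F d \<longleftrightarrow> has_prime_chain ?S d" for d
    using prime_chain_iso[OF iso cr rS] prime_chain_iso[OF iso' cring_fiber rF] by blast
  have "has_prime_chain ?S d \<Longrightarrow> d \<le> rank D" for d
    unfolding has_prime_chain_def primeideal_fiber_iff using chain_length_le_rank[OF D, where 'k = 'k] by blast
  moreover have "has_prime_chain ?S (rank D)"
  proof -
    obtain P :: "nat \<Rightarrow> ('n, 'k) xypoly set"
      where "\<And>i. prime_in (fiber D) (P i)" "\<And>i. i < rank D \<Longrightarrow> P i \<subset> P (Suc i)"
      using chain_of_length_rank[OF D] by blast
    thus ?thesis unfolding has_prime_chain_def primeideal_fiber_iff by blast
  qed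
  ultimately have "(SUP d\<in>{d. has_prime_chain ?F d}. ereal (real d)) = ereal (real (rank D))"
    unfolding chain by (intro antisym SUP_least SUP_upper2[of "rank D"]) auto
  thus ?thesis
    unfolding analytic_spread_def krull_dim_def has_prime_chain_def .
qed

theorem theorem6p4:
  fixes E :: "'n::{finite,linorder} set set"
    and J :: "('n + 'n, 'k::field) mpolynomial set"
  assumes "infinite (UNIV :: 'k set)"
    and "simple_graph E"
    and "closed_graph TYPE('k) E"
    and "J = binomial_edge_ideal E"
  shows "analytic_spread J = ereal (real_of_int (mcd (initial_newton_okounkov J) + 1))"
proof -
  define D where "D = oriented_edges E"
  have D: "closed_edges D"
    unfolding D_def using assms(2,3) by (rule closed_edges_if_closed_graph)
  have J: "J = ideal_gen (ebin ` D)"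
    unfolding assms(4) D_def using assms(2) by (rule binomial_edge_ideal_eq)
  have "initial_newton_okounkov J = newton_polyhedron (ev ` D)"
    unfolding initial_newton_okounkov_def J
    by (rule newton_okounkov_eq) (rule initial_ideal_power[OF D])
  moreover have "mcd (newton_polyhedron (ev ` D)) + 1 = int (dim (ev ` D))"
  proof (rule mcd_newton_polyhedron[where c = 2])
    fix x assume "x \<in> ev ` D"
    then obtain e where x: "x = ev e" by blast
    have "(\<Sum>v\<in>UNIV. x $ v) = real (expo_deg (vexp e))"
      by (simp add: x evec_def expo_deg_def)
    thus "(\<Sum>v\<in>UNIV. x $ v) = 2" by simp
  qed (simp_all add: finite)
  ultimately have "mcd (initial_newton_okounkov J) + 1 = int (rank D)"
    by (simp only: dim_ev[OF D])
  moreover have "analytic_spread J = ereal (real (rank D))"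
    unfolding J by (rule analytic_spread_eq_rank[OF D])
  ultimately show ?thesis by simp
qed

end
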